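(* Let $\mathbb{F}$ be a field with $\mathrm{char}(\mathbb{F})\neq 3$. Then $\beta(H_3)=9$.
   Context: $H_3$ is the Heisenberg group of order $27$: the group with generators $a,b,c$ and relations $a^3=b^3=c^3=1$, $[a,b]=c$, $[a,c]=[b,c]=1$, where $[a,b]=a^{-1}b^{-1}ab$. For a finite group $G$ and a finite-dimensional $G$-module $V$ over $\mathbb{F}$ (characteristic not dividing $|G|$), $G$ acts on the coordinate ring $\mathbb{F}[V]$ (the polynomial ring on $V$) by $f^g(v)=f(g\cdot v)$, and $\mathbb{F}[V]^G$ is the graded ring of polynomial invariants. The Noether number $\beta(G,V)$ is the maximal degree of an element in a minimal homogeneous generating set of the $\mathbb{F}$-algebra $\mathbb{F}[V]^G$. $\beta(G):=\sup_V \beta(G,V)$, where $V$ runs over all $G$-modules over the base field $\mathbb{F}$. *)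

theory Defs
  imports
    "HOL-Library.Poly_Mapping"
    "HOL-Library.Extended_Nat"
    "HOL-Algebra.Group"
    "HOL-Algebra.Coset"
    "HOL-Computational_Algebra.Computational_Algebra"
    "Jordan_Normal_Form.Matrix"
begin

section \<open>Groups given by generators and relations\<close>

text \<open>The letter \<open>(x, True)\<close> stands for the generator \<open>x\<close>, the letter \<open>(x, False)\<close> for its
  inverse. A relation is a pair of words (left-hand side, right-hand side).\<close>

type_synonym 'x word = "('x \<times> bool) list"

inductive word_eq :: "('x word \<times> 'x word) set \<Rightarrow> 'x word \<Rightarrow> 'x word \<Rightarrow> bool"
  for R :: "('x word \<times> 'x word) set" where
  refl: "word_eq R u u"
| sym: "word_eq R u v \<Longrightarrow> word_eq R v u"
| trans: "word_eq R u v \<Longrightarrow> word_eq R v w \<Longrightarrow> word_eq R u w"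
| append: "word_eq R u u' \<Longrightarrow> word_eq R v v' \<Longrightarrow> word_eq R (u @ v) (u' @ v')"
| cancel: "word_eq R [(x, s), (x, \<not> s)] []"
| relation: "(u, v) \<in> R \<Longrightarrow> word_eq R u v"

definition word_class :: "('x word \<times> 'x word) set \<Rightarrow> 'x word \<Rightarrow> 'x word set" where
  "word_class R u = {v. word_eq R u v}"

definition presented_group :: "('x word \<times> 'x word) set \<Rightarrow> 'x word set monoid" where
  "presented_group R =
    \<lparr>carrier = range (word_class R),
     monoid.mult = (\<lambda>X Y. \<Union>u\<in>X. \<Union>v\<in>Y. word_class R (u @ v)),
     one = word_class R []\<rparr>"

lemma word_class_eq_iff: "word_class R u = word_class R v \<longleftrightarrow> word_eq R u v"
  unfolding word_class_def
  by (blast intro: word_eq.refl word_eq.sym word_eq.trans)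

lemma presented_group_mult:
  "word_class R u \<otimes>\<^bsub>presented_group R\<^esub> word_class R v = word_class R (u @ v)"
proof -
  have "word_class R (u' @ v') = word_class R (u @ v)"
    if "u' \<in> word_class R u" "v' \<in> word_class R v" for u' v'
    using that unfolding word_class_eq_iff
    by (auto simp: word_class_def intro: word_eq.sym word_eq.append)
  moreover have "u \<in> word_class R u" "v \<in> word_class R v"
    by (auto simp: word_class_def intro: word_eq.refl)
  ultimately have "(\<Union>u'\<in>word_class R u. \<Union>v'\<in>word_class R v. word_class R (u' @ v')) =
      word_class R (u @ v)"
    by blast
  then show ?thesis
    by (simp add: presented_group_def)
qed

lemma presented_group_carrier: "carrier (presented_group R) = range (word_class R)"
  and presented_group_one: "\<one>\<^bsub>presented_group R\<^esub> = word_class R []"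
  by (simp_all add: presented_group_def)

lemma word_eq_left_inverse: "word_eq R (rev (map (\<lambda>(x, s). (x, \<not> s)) w) @ w) []"
proof (induction w)
  case Nil
  show ?case by (simp add: word_eq.refl)
next
  case (Cons l w)
  obtain x s where l: "l = (x, s)" by (cases l)
  let ?i = "rev (map (\<lambda>(x, s). (x, \<not> s)) w)"
  have "word_eq R ([(x, \<not> s), (x, s)]) []"
    using word_eq.cancel[of R x "\<not> s"] by simp
  then have "word_eq R ([(x, \<not> s), (x, s)] @ w) ([] @ w)"
    by (rule word_eq.append[OF _ word_eq.refl])
  then have "word_eq R (?i @ ([(x, \<not> s), (x, s)] @ w)) (?i @ ([] @ w))"
    by (rule word_eq.append[OF word_eq.refl])
  then show ?case
    using Cons by (auto simp: l intro: word_eq.trans)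
qed

lemma group_presented_group: "group (presented_group R)"
proof (rule groupI)
  fix X assume "X \<in> carrier (presented_group R)"
  then obtain w where w: "X = word_class R w"
    by (auto simp: presented_group_carrier)
  show "\<exists>Y\<in>carrier (presented_group R). Y \<otimes>\<^bsub>presented_group R\<^esub> X = \<one>\<^bsub>presented_group R\<^esub>"
    using word_eq_left_inverse[of R w]
    unfolding w presented_group_carrier presented_group_one
    by (auto simp: presented_group_mult word_class_eq_iff)
qed (auto simp: presented_group_carrier presented_group_one presented_group_mult)


section \<open>The Heisenberg group of order 27\<close>

datatype heis_gen = Gen_a | Gen_b | Gen_c

definition heis_relations :: "(heis_gen word \<times> heis_gen word) set" where
  "heis_relations =
    (let a = (Gen_a, True); a' = (Gen_a, False);
         b = (Gen_b, True); b' = (Gen_b, False);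
         c = (Gen_c, True); c' = (Gen_c, False)
     in {([a, a, a], []), ([b, b, b], []), ([c, c, c], []),
         ([a', b', a, b], [c]), ([a', c', a, c], []), ([b', c', b, c], [])})"

definition heisenberg3 :: "heis_gen word set monoid" where
  "heisenberg3 = presented_group heis_relations"

lemma group_heisenberg3: "group heisenberg3"
  by (simp add: heisenberg3_def group_presented_group)

lemma (in group) heis_closure:
  assumes [simp]: "x \<in> carrier G" "y \<in> carrier G" "z \<in> carrier G"
    and x3: "x \<otimes> x \<otimes> x = \<one>" and y3: "y \<otimes> y \<otimes> y = \<one>" and z3: "z \<otimes> z \<otimes> z = \<one>"
    and xy: "x \<otimes> y = y \<otimes> x \<otimes> z" and xz: "z \<otimes> x = x \<otimes> z" and yz: "z \<otimes> y = y \<otimes> z"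
    and h: "h \<in> (\<lambda>(i, j, k). x [^] i \<otimes> y [^] j \<otimes> z [^] k) ` ({..<3::nat} \<times> {..<3::nat} \<times> {..<3::nat})"
    and l: "l \<in> {x, y, z}"
  shows "l \<otimes> h \<in> (\<lambda>(i, j, k). x [^] i \<otimes> y [^] j \<otimes> z [^] k) `
           ({..<3::nat} \<times> {..<3::nat} \<times> {..<3::nat})" (is "_ \<in> ?f ` ?I")
proof -
  have pow3: "g [^] n = g [^] (n mod 3)" if "g \<in> carrier G" "g \<otimes> g \<otimes> g = \<one>" for g and n :: nat
  proof -
    have "g [^] (3::nat) = \<one>"
      using that by (simp add: numeral_3_eq_3)
    moreover have "g [^] (3 * (n div 3) + n mod 3) = (g [^] (3::nat)) [^] (n div 3) \<otimes> g [^] (n mod 3)"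
      using that(1) by (simp only: nat_pow_mult nat_pow_pow nat_pow_closed)
    ultimately show ?thesis using that(1) by simp
  qed
  have in_image: "x [^] i \<otimes> y [^] j \<otimes> z [^] k \<in> ?f ` ?I" for i j k :: nat
    using pow3[OF _ x3, of i] pow3[OF _ y3, of j] pow3[OF _ z3, of k]
    by (intro image_eqI[of _ _ "(i mod 3, j mod 3, k mod 3)"]) auto
  have zx: "z \<otimes> x [^] n = x [^] n \<otimes> z" for n :: nat
    by (induction n) (simp_all add: m_assoc[symmetric], simp add: m_assoc xz)
  have zy: "z \<otimes> y [^] n = y [^] n \<otimes> z" for n :: nat
    by (induction n) (simp_all add: m_assoc[symmetric], simp add: m_assoc yz)
  have yx: "y \<otimes> x = x \<otimes> y \<otimes> (z \<otimes> z)"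
    using xy z3 by (simp add: m_assoc)
  have zz: "z \<otimes> z [^] n = z [^] Suc n" for n :: nat
    by (metis assms(3) nat_pow_Suc2)
  have zn_x: "z [^] n \<otimes> x = x \<otimes> z [^] n" for n :: nat
    by (induction n) (simp_all add: m_assoc xz, simp add: m_assoc[symmetric])
  have zn_y: "z [^] n \<otimes> y [^] j = y [^] j \<otimes> z [^] n" for n j :: nat
    by (induction n) (simp_all add: m_assoc zy, simp add: m_assoc[symmetric])
  have yxn: "y \<otimes> x [^] n = x [^] n \<otimes> y \<otimes> z [^] (2 * n)" for n :: nat
  proof (induction n)
    case (Suc n)
    have "y \<otimes> x [^] Suc n = x [^] n \<otimes> y \<otimes> z [^] (2 * n) \<otimes> x"
      using Suc by (simp add: m_assoc[symmetric])
    also have "\<dots> = x [^] n \<otimes> (y \<otimes> x) \<otimes> z [^] (2 * n)"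
      by (simp add: m_assoc zn_x)
    also have "\<dots> = x [^] n \<otimes> x \<otimes> y \<otimes> (z [^] (2::nat) \<otimes> z [^] (2 * n))"
      by (simp add: yx m_assoc numeral_2_eq_2)
    finally show ?case by (simp add: nat_pow_mult)
  qed simp
  obtain i j k :: nat where h_eq: "h = x [^] i \<otimes> y [^] j \<otimes> z [^] k"
    using h by auto
  have "x \<otimes> h = x [^] Suc i \<otimes> y [^] j \<otimes> z [^] k"
    unfolding h_eq nat_pow_Suc2[OF assms(1)] by (simp add: m_assoc)
  moreover have "z \<otimes> h = x [^] i \<otimes> y [^] j \<otimes> z [^] Suc k"
  proof -
    have "z \<otimes> h = z \<otimes> x [^] i \<otimes> y [^] j \<otimes> z [^] k"
      by (simp add: h_eq m_assoc)
    also have "\<dots> = x [^] i \<otimes> (z \<otimes> y [^] j) \<otimes> z [^] k"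
      by (simp add: zx m_assoc)
    also have "\<dots> = x [^] i \<otimes> y [^] j \<otimes> (z \<otimes> z [^] k)"
      by (simp add: zy m_assoc)
    finally show ?thesis by (simp only: zz)
  qed
  moreover have "y \<otimes> h = x [^] i \<otimes> y [^] Suc j \<otimes> z [^] (2 * i + k)"
  proof -
    have "y \<otimes> h = y \<otimes> x [^] i \<otimes> y [^] j \<otimes> z [^] k"
      by (simp add: h_eq m_assoc)
    also have "\<dots> = x [^] i \<otimes> y \<otimes> (z [^] (2 * i) \<otimes> y [^] j) \<otimes> z [^] k"
      by (simp add: yxn m_assoc)
    also have "\<dots> = x [^] i \<otimes> (y \<otimes> y [^] j) \<otimes> (z [^] (2 * i) \<otimes> z [^] k)"
      by (simp add: zn_y m_assoc)
    finally show ?thesis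
      unfolding nat_pow_Suc2[OF assms(2)] by (simp add: nat_pow_mult)
  qed
  moreover have "l = x \<or> l = y \<or> l = z"
    using l by simp
  ultimately show ?thesis
    by (elim disjE; simp only: in_image)
qed

text \<open>Left multiplication by a letter in normal-form coordinates: \<open>(i, j, k)\<close> stands for
  \<open>a\<^sup>i b\<^sup>j c\<^sup>k\<close>.\<close>

fun heis_step :: "heis_gen \<times> bool \<Rightarrow> int \<times> int \<times> int \<Rightarrow> int \<times> int \<times> int" where
  "heis_step (Gen_a, s) (i, j, k) = ((i + (if s then 1 else -1)) mod 3, j mod 3, k mod 3)"
| "heis_step (Gen_b, s) (i, j, k) =
    (i mod 3, (j + (if s then 1 else -1)) mod 3, (if s then k - i else k + i) mod 3)"
| "heis_step (Gen_c, s) (i, j, k) = (i mod 3, j mod 3, (k + (if s then 1 else -1)) mod 3)"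

lemma heis_step_range: "heis_step l p \<in> {0..<3} \<times> {0..<3} \<times> {0..<3}"
  by (cases "(l, p)" rule: heis_step.cases) auto

lemma word_eq_heis_step:
  assumes "word_eq heis_relations u v" "p \<in> {0..<3} \<times> {0..<3} \<times> {0..<3}"
  shows "foldr heis_step u p = foldr heis_step v p"
  using assms
proof (induction arbitrary: p)
  case (append u u' v v')
  have "foldr heis_step w p \<in> {0..<3} \<times> {0..<3} \<times> {0..<3}" for w
    using append.prems by (cases w) (use heis_step_range in auto)
  then show ?case using append by simp
next
  case (cancel x s)
  then show ?case
    by (cases x; cases s) (auto simp: mod_simps)
next
  case (relation u v)
  obtain i j k where p: "p = (i, j, k)" by (cases p)
  have mods: "i mod 3 = i" "j mod 3 = j" "k mod 3 = k"
    using relation.prems by (auto simp: p)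
  have b3: "(k - i * 3) mod 3 = k"
    using mods(3) mod_mult_self1[of k "- i" 3] by simp
  have comm: "(1 + (i + (k - i) mod 3)) mod 3 = (1 + k) mod 3"
    using mod_add_right_eq[of "1 + i" "k - i" 3] by (simp add: add.assoc)
  show ?case
    using relation.hyps mods
    by (auto simp: p heis_relations_def Let_def mod_simps algebra_simps)
       (simp_all only: b3 comm)
qed auto

lemma order_heisenberg3: "Coset.order heisenberg3 = 27"
proof -
  let ?H = heisenberg3 and ?I = "{..<3::nat} \<times> {..<3::nat} \<times> {..<3::nat}"
  interpret group ?H by (rule group_heisenberg3)
  define cl where "cl = word_class heis_relations"
  define x y z where "x = cl [(Gen_a, True)]" and "y = cl [(Gen_b, True)]" and "z = cl [(Gen_c, True)]"
  define f where "f = (\<lambda>(i :: nat, j :: nat, k :: nat). x [^]\<^bsub>?H\<^esub> i \<otimes>\<^bsub>?H\<^esub> y [^]\<^bsub>?H\<^esub> j \<otimes>\<^bsub>?H\<^esub> z [^]\<^bsub>?H\<^esub> k :: heis_gen word set)"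
  have mult: "cl u \<otimes>\<^bsub>?H\<^esub> cl v = cl (u @ v)" for u v
    by (simp add: cl_def heisenberg3_def presented_group_mult)
  have one: "\<one>\<^bsub>?H\<^esub> = cl []"
    by (simp add: cl_def heisenberg3_def presented_group_one)
  have carrier: "carrier ?H = range cl"
    by (simp add: cl_def[abs_def] heisenberg3_def presented_group_carrier)
  have xyz [simp]: "x \<in> carrier ?H" "y \<in> carrier ?H" "z \<in> carrier ?H"
    by (simp_all add: carrier x_def y_def z_def)
  have pow: "cl [l] [^]\<^bsub>?H\<^esub> n = cl (replicate n l)" for l and n :: nat
    by (induction n) (simp_all add: one mult replicate_append_same)
  have rel: "cl u = cl v" if "(u, v) \<in> heis_relations" for u v
    using that by (simp add: cl_def word_class_eq_iff word_eq.relation)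
  have inv: "cl [(g, False)] = inv\<^bsub>?H\<^esub> (cl [(g, True)])" for g
  proof (rule inv_equality[symmetric])
    have "cl [(g, False), (g, True)] = cl []"
      using word_eq.cancel[of heis_relations g False] by (simp add: cl_def word_class_eq_iff)
    then show "cl [(g, False)] \<otimes>\<^bsub>?H\<^esub> cl [(g, True)] = \<one>\<^bsub>?H\<^esub>"
      by (simp add: mult one)
  qed (simp_all add: carrier)
  have cubes: "x \<otimes>\<^bsub>?H\<^esub> x \<otimes>\<^bsub>?H\<^esub> x = \<one>\<^bsub>?H\<^esub>" "y \<otimes>\<^bsub>?H\<^esub> y \<otimes>\<^bsub>?H\<^esub> y = \<one>\<^bsub>?H\<^esub>" "z \<otimes>\<^bsub>?H\<^esub> z \<otimes>\<^bsub>?H\<^esub> z = \<one>\<^bsub>?H\<^esub>"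
    by (simp_all add: x_def y_def z_def mult one rel heis_relations_def Let_def)
  have comm: "p \<otimes>\<^bsub>?H\<^esub> q = q \<otimes>\<^bsub>?H\<^esub> p \<otimes>\<^bsub>?H\<^esub> r"
    if "inv\<^bsub>?H\<^esub> p \<otimes>\<^bsub>?H\<^esub> inv\<^bsub>?H\<^esub> q \<otimes>\<^bsub>?H\<^esub> p \<otimes>\<^bsub>?H\<^esub> q = r" "p \<in> carrier ?H" "q \<in> carrier ?H" for p q r
  proof -
    have "q \<otimes>\<^bsub>?H\<^esub> p \<otimes>\<^bsub>?H\<^esub> r = q \<otimes>\<^bsub>?H\<^esub> (p \<otimes>\<^bsub>?H\<^esub> inv\<^bsub>?H\<^esub> p) \<otimes>\<^bsub>?H\<^esub> inv\<^bsub>?H\<^esub> q \<otimes>\<^bsub>?H\<^esub> p \<otimes>\<^bsub>?H\<^esub> q"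
      using that(2,3) unfolding that(1)[symmetric] by (simp only: m_assoc m_closed inv_closed)
    then show ?thesis using that(2,3) by simp
  qed
  have xy: "x \<otimes>\<^bsub>?H\<^esub> y = y \<otimes>\<^bsub>?H\<^esub> x \<otimes>\<^bsub>?H\<^esub> z"
    by (rule comm) (simp_all, simp add: x_def y_def z_def inv[symmetric] mult rel heis_relations_def Let_def)
  have "x \<otimes>\<^bsub>?H\<^esub> z = z \<otimes>\<^bsub>?H\<^esub> x \<otimes>\<^bsub>?H\<^esub> \<one>\<^bsub>?H\<^esub>" "y \<otimes>\<^bsub>?H\<^esub> z = z \<otimes>\<^bsub>?H\<^esub> y \<otimes>\<^bsub>?H\<^esub> \<one>\<^bsub>?H\<^esub>"
    by (rule comm; simp add: x_def y_def z_def inv[symmetric] mult one rel heis_relations_def Let_def carrier)+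
  then have xz: "z \<otimes>\<^bsub>?H\<^esub> x = x \<otimes>\<^bsub>?H\<^esub> z" and yz: "z \<otimes>\<^bsub>?H\<^esub> y = y \<otimes>\<^bsub>?H\<^esub> z"
    by simp_all
  have step: "l \<otimes>\<^bsub>?H\<^esub> h \<in> f ` ?I" if "h \<in> f ` ?I" "l \<in> {x, y, z}" for l h
    using heis_closure[OF xyz cubes xy xz yz _ that(2)] that(1) unfolding f_def by blast
  have f_carrier: "f ` ?I \<subseteq> carrier ?H"
    by (auto simp: f_def)
  have inv_sq: "inv\<^bsub>?H\<^esub> l = l \<otimes>\<^bsub>?H\<^esub> l" if "l \<in> {x, y, z}" for l
    using that cubes by (intro inv_equality) auto
  have letter: "cl [(g, True)] \<in> {x, y, z}" for g
    by (cases g) (simp_all add: x_def y_def z_def)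
  have "cl w \<in> f ` ?I" for w
  proof (induction w)
    case Nil
    show ?case
      by (intro image_eqI[of _ _ "(0, 0, 0)"]) (auto simp: f_def one[symmetric])
  next
    case (Cons l w)
    obtain g s where l: "l = (g, s)" by (cases l)
    define t where "t = cl [(g, True)]"
    have t: "t \<in> {x, y, z}" "t \<in> carrier ?H" "cl w \<in> carrier ?H"
      using letter by (auto simp: t_def carrier)
    have "cl (l # w) = (if s then t \<otimes>\<^bsub>?H\<^esub> cl w else t \<otimes>\<^bsub>?H\<^esub> (t \<otimes>\<^bsub>?H\<^esub> cl w))"
      using inv_sq[OF t(1)] t(2,3) inv[of g] mult[of "[l]" w]
      by (auto simp: l t_def[symmetric] m_assoc)
    then show ?case using step t(1) Cons.IH by simp
  qed
  then have image: "f ` ?I = carrier ?H"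
    using f_carrier by (auto simp: carrier)
  have "inj_on f ?I"
  proof (rule inj_onI)
    fix p q assume pq: "p \<in> ?I" "q \<in> ?I" "f p = f q"
    define nf where "nf = (\<lambda>(i, j, k). replicate i (Gen_a, True) @ replicate j (Gen_b, True) @ replicate k (Gen_c, True))"
    have "f r = cl (nf r)" for r
      by (cases r) (simp add: f_def nf_def x_def y_def z_def pow mult)
    then have "foldr heis_step (nf p) (0, 0, 0) = foldr heis_step (nf q) (0, 0, 0)"
      using pq(3) by (intro word_eq_heis_step) (auto simp: cl_def word_class_eq_iff)
    moreover have "foldr heis_step (nf r) (0, 0, 0) = (case r of (i, j, k) \<Rightarrow> (int i, int j, int k))"
      if "r \<in> ?I" for r
    proof -
      obtain i j k where r: "r = (i, j, k)" by (cases r)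
      have "i = 0 \<or> i = Suc 0 \<or> i = Suc (Suc 0)" "j = 0 \<or> j = Suc 0 \<or> j = Suc (Suc 0)"
        "k = 0 \<or> k = Suc 0 \<or> k = Suc (Suc 0)"
        using that by (auto simp: r)
      then show ?thesis
        by (elim disjE) (simp_all add: r nf_def)
    qed
    ultimately show "p = q"
      using pq(1,2) by (auto split: prod.splits)
  qed
  then have "card (carrier ?H) = card ?I"
    by (metis image card_image)
  then show ?thesis
    by (simp add: Coset.order_def card_cartesian_product)
qed


section \<open>Polynomial functions on a representation\<close>

text \<open>Polynomials in variables indexed by the natural numbers; a monomial is its exponent vector.\<close>

type_synonym 'a mpoly = "(nat \<Rightarrow>\<^sub>0 nat) \<Rightarrow>\<^sub>0 'a"

definition mconst :: "'a::comm_ring_1 \<Rightarrow> 'a mpoly" where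
  "mconst c = Poly_Mapping.single 0 c"

definition mvar :: "nat \<Rightarrow> 'a::comm_ring_1 mpoly" where
  "mvar i = Poly_Mapping.single (Poly_Mapping.single i 1) 1"

definition mpoly_ring :: "nat \<Rightarrow> 'a::comm_ring_1 mpoly set" where
  "mpoly_ring n = {f. \<forall>m \<in> Poly_Mapping.keys f. Poly_Mapping.keys m \<subseteq> {..<n}}"

definition monom_degree :: "(nat \<Rightarrow>\<^sub>0 nat) \<Rightarrow> nat" where
  "monom_degree m = (\<Sum>i \<in> Poly_Mapping.keys m. Poly_Mapping.lookup m i)"

definition total_degree :: "'a::comm_ring_1 mpoly \<Rightarrow> nat" where
  "total_degree f = Max (insert 0 (monom_degree ` Poly_Mapping.keys f))"

definition homogeneous :: "'a::comm_ring_1 mpoly \<Rightarrow> bool" where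
  "homogeneous f \<longleftrightarrow> (\<exists>d. \<forall>m \<in> Poly_Mapping.keys f. monom_degree m = d)"

text \<open>The polynomial \<open>v \<mapsto> f (M v)\<close> on column vectors of length \<open>n\<close>: the \<open>i\<close>-th coordinate
  is replaced by the linear form given by the \<open>i\<close>-th row of \<open>M\<close>.\<close>

definition mpoly_act :: "nat \<Rightarrow> 'a::comm_ring_1 mat \<Rightarrow> 'a mpoly \<Rightarrow> 'a mpoly" where
  "mpoly_act n M f =
    (\<Sum>m \<in> Poly_Mapping.keys f. mconst (Poly_Mapping.lookup f m) *
      (\<Prod>i \<in> Poly_Mapping.keys m.
        (\<Sum>j<n. mconst (M $$ (i, j)) * mvar j) ^ Poly_Mapping.lookup m i))"

text \<open>Choosing a basis, an \<open>n\<close>-dimensional \<open>G\<close>-module is a homomorphism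
  from \<open>G\<close> to the group of invertible \<open>n \<times> n\<close> matrices. The case \<open>n = 0\<close> is allowed.\<close>

definition representations :: "('g, 'r) monoid_scheme \<Rightarrow> nat \<Rightarrow> ('g \<Rightarrow> 'a::field mat) set" where
  "representations G n = hom G (units_of (ring_mat TYPE('a) n ()))"

definition invariants ::
    "('g, 'r) monoid_scheme \<Rightarrow> nat \<Rightarrow> ('g \<Rightarrow> 'a::field mat) \<Rightarrow> 'a mpoly set" where
  "invariants G n \<rho> = {f \<in> mpoly_ring n. \<forall>g \<in> carrier G. mpoly_act n (\<rho> g) f = f}"

inductive_set generated_algebra :: "'a::comm_ring_1 mpoly set \<Rightarrow> 'a mpoly set"
  for S :: "'a mpoly set" where
  const: "mconst c \<in> generated_algebra S"
| base: "f \<in> S \<Longrightarrow> f \<in> generated_algebra S"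
| add: "f \<in> generated_algebra S \<Longrightarrow> g \<in> generated_algebra S \<Longrightarrow> f + g \<in> generated_algebra S"
| mult: "f \<in> generated_algebra S \<Longrightarrow> g \<in> generated_algebra S \<Longrightarrow> f * g \<in> generated_algebra S"


section \<open>Noether numbers\<close>

definition minimal_homogeneous_generators ::
    "'a::comm_ring_1 mpoly set \<Rightarrow> 'a mpoly set \<Rightarrow> bool" where
  "minimal_homogeneous_generators R S \<longleftrightarrow>
    S \<subseteq> R \<and> (\<forall>f \<in> S. homogeneous f) \<and> generated_algebra S = R \<and>
    (\<forall>T. T \<subset> S \<longrightarrow> generated_algebra T \<noteq> R)"

text \<open>The maximal degree does not depend on the minimal homogeneous generating set.
  It is 0 if that set is empty, that is, for the zero module.\<close>

definition noether_number_rep ::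
    "('g, 'r) monoid_scheme \<Rightarrow> nat \<Rightarrow> ('g \<Rightarrow> 'a::field mat) \<Rightarrow> enat" where
  "noether_number_rep G n \<rho> =
    (THE d. \<exists>S. minimal_homogeneous_generators (invariants G n \<rho>) S \<and>
                d = (SUP f \<in> S. enat (total_degree f)))"

definition noether_number :: "'a::field itself \<Rightarrow> ('g, 'r) monoid_scheme \<Rightarrow> enat" where
  "noether_number F G =
    (SUP (n, \<rho> :: 'g \<Rightarrow> 'a mat) \<in> {(n, \<rho>). \<rho> \<in> representations G n}. noether_number_rep G n \<rho>)"

end

theory Submission
  imports Defs
begin

text \<open>
  \<^bold>\<open>Upper bound.\<close> Let \<open>a\<close>, \<open>b\<close> and the central element \<open>c = [a, b]\<close> act on a polynomial ring, with a
  primitive cube root of unity \<open>\<omega>\<close> among the scalars. The linear forms are sums of common eigenvectors of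
  the commuting operators \<open>a\<close> and \<open>c\<close>, so a product of such eigenvectors is a sequence of weights in
  \<open>C\<^sub>3 \<times> C\<^sub>3\<close>. It is fixed by \<open>a\<close> and \<open>c\<close> iff the weights sum to zero, and \<open>b\<close> shears the weights. No
  classification of irreducible modules and no basis is involved.

  The key statement (\<open>semi_invariant_in_hilbert_part\<close>) is that a semi-invariant of degree at least 9
  whose character is not trivial lies in the ideal generated by the invariants of positive degree.
  After a change of generators the character is trivial on \<open>a\<close>. A zero-sum sequence of length at least 9
  over \<open>C\<^sub>3 \<times> C\<^sub>3\<close> splits into three zero-sum pieces (\<open>zero_sum_split3\<close>). When these pieces are expanded into
  eigenvectors of \<open>b\<close>, some product of one or two of the three factors is invariant: otherwise the three
  characters would coincide and their product would be trivial (\<open>three_factors\<close>). The same conclusion holds in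
  degree 8 when \<open>c\<close> fixes none of the linear factors. There two pieces are available; modulo the ideal,
  applying \<open>b\<close> to one of them only changes the product by a root of unity (\<open>two_factors\<close>), and for a
  suitable power of \<open>b\<close> the sheared sequence does split into three pieces (\<open>eight_letters\<close>).

  Now consider an invariant of degree at least 10, written with products of eigenvectors of \<open>c\<close>. From each product
  one can split off a \<open>c\<close>-invariant factor of degree at most 3 so that the cofactor is covered by the key
  statement (\<open>long_type_split\<close>). Both factors decompose into semi-invariants with opposite characters. If these are
  trivial, the product is decomposable as it stands, and otherwise the cofactor lies in the ideal
  generated by the invariants of positive degree, which makes the product decomposable
  (\<open>eigen_product_decomposable\<close>, \<open>invariant_decomposable\<close>).

  A field without a primitive cube root of unity is treated by adjoining \<open>\<omega>\<close> formally to the polynomial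
  ring. Invariants over the extension are pairs of invariants, and the part of \<open>(r + r' \<omega>) (s + s' \<omega>)\<close> that
  is free of \<open>\<omega>\<close> is \<open>r s - r' s'\<close>, so decomposability descends (\<open>inv_part_decomposable\<close>).

  \<^bold>\<open>The Noether number of a representation.\<close> In a homogeneous generating set, the generators of degree
  at most \<open>D\<close> already generate all invariants of degree at most \<open>D\<close>. Hence the maximal degree in a
  minimal homogeneous generating set is the least \<open>D\<close> such that the invariants of degree at most \<open>D\<close>
  generate (\<open>minimal_generators_degree\<close>, \<open>generated_by_bounded_degree\<close>).

  \<^bold>\<open>Lower bound.\<close> A permutation representation on nine points is defined over every field. After
  adjoining \<open>\<omega>\<close> it contains a three-dimensional irreducible representation with coordinates \<open>x, y, z\<close>, on which
  \<open>a\<close> and \<open>c\<close> act diagonally and \<open>b\<close> rotates the coordinates. Restricted to it, an invariant of degree at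
  most 8 is symmetric in \<open>y\<close> and \<open>z\<close>: its monomials have exponents that are congruent modulo 3 and sum to at
  most 8, so two of them are equal, and then a cyclic sum is a symmetric sum
  (\<open>value_at_symmetric\<close>). The invariant \<open>cyclic_invariant\<close> of degree 9 restricts to
  \<open>x\<^sup>6y\<^sup>3 + y\<^sup>6z\<^sup>3 + z\<^sup>6x\<^sup>3\<close>, which is not symmetric.
\<close>

section \<open>Adjoining a primitive cube root of unity\<close>

text \<open>The pair \<open>Eis p q\<close> stands for \<open>p + q \<omega>\<close> with \<open>\<omega>\<^sup>2 + \<omega> + 1 = 0\<close>. This is a commutative ring over any base,
  whether or not the quadratic polynomial splits there; for this reason the degree bound is
  developed over rings and not over fields.\<close>

datatype 'a eis = Eis (ratpart: 'a) (omegapart: 'a)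

instantiation eis :: (comm_ring_1) comm_ring_1
begin

definition "0 = Eis 0 0"
definition "1 = Eis 1 0"
definition "x + y = Eis (ratpart x + ratpart y) (omegapart x + omegapart y)"
definition "x - y = Eis (ratpart x - ratpart y) (omegapart x - omegapart y)"
definition "- x = Eis (- ratpart x) (- omegapart x)"
definition "x * y = Eis (ratpart x * ratpart y - omegapart x * omegapart y)
  (ratpart x * omegapart y + omegapart x * ratpart y - omegapart x * omegapart y)"

instance
proof
  fix x y z :: "'a eis"
  note eis_ops = zero_eis_def one_eis_def plus_eis_def minus_eis_def uminus_eis_def times_eis_def
  show "x * y * z = x * (y * z)"
    by (simp only: eis_ops eis.sel eis.inject) (simp add: algebra_simps)
  show "(x + y) * z = x * z + y * z"
    by (simp only: eis_ops eis.sel eis.inject) (simp add: algebra_simps)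
  show "x * y = y * x"
    by (simp only: eis_ops eis.sel eis.inject) (simp add: algebra_simps)
  show "x + y + z = x + (y + z)" "x + y = y + x" "x - y = x + - y" "- x + x = 0" "0 + x = x" "1 * x = x"
    "(0 :: 'a eis) \<noteq> 1"
    by (simp_all add: eis_ops add_ac)
qed

end

definition omega :: "'a::comm_ring_1 eis" where "omega = Eis 0 1"

definition eis_of :: "'a::comm_ring_1 \<Rightarrow> 'a eis" where "eis_of x = Eis x 0"

lemma omega_relation: "1 + omega + omega * omega = (0 :: 'a::comm_ring_1 eis)"
  by (simp add: omega_def zero_eis_def one_eis_def plus_eis_def times_eis_def)

lemma eis_of_0: "eis_of 0 = 0"
  and eis_of_1: "eis_of 1 = 1"
  and eis_of_add: "eis_of (x + y) = eis_of x + eis_of y"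
  and eis_of_mult: "eis_of (x * y) = eis_of x * eis_of y"
  by (simp_all add: eis_of_def zero_eis_def one_eis_def plus_eis_def times_eis_def)

section \<open>Additive spans\<close>

text \<open>Only sums are formed. Scalars enter through spanning sets that are closed under them.\<close>

inductive_set addspan :: "'a::comm_monoid_add set \<Rightarrow> 'a set" for S :: "'a set" where
  addspan_zero: "0 \<in> addspan S"
| addspan_step: "x \<in> S \<Longrightarrow> y \<in> addspan S \<Longrightarrow> x + y \<in> addspan S"

lemma addspan_base: "x \<in> S \<Longrightarrow> x \<in> addspan S"
  using addspan_step[OF _ addspan_zero] by fastforce

lemma addspan_add: "x \<in> addspan S \<Longrightarrow> y \<in> addspan S \<Longrightarrow> x + y \<in> addspan S"
  by (induction rule: addspan.induct) (auto simp: add.assoc intro: addspan_step)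

lemma addspan_sum: "(\<And>i. i \<in> A \<Longrightarrow> f i \<in> addspan S) \<Longrightarrow> sum f A \<in> addspan S"
  by (induction A rule: infinite_finite_induct) (auto intro: addspan_zero addspan_add)

text \<open>The form in which a spanning statement is used: an additive map need only be checked on the
  spanning set.\<close>

lemma addspan_map:
  assumes "x \<in> addspan S" and "F 0 = 0" and "\<And>x y. F (x + y) = F x + F y"
    and "\<And>x. x \<in> S \<Longrightarrow> F x \<in> addspan T"
  shows "F x \<in> addspan T"
  using assms(1) by induction (auto simp: assms intro: addspan_zero addspan_add)

lemma addspan_subset:
  assumes "x \<in> addspan S" and "\<And>x. x \<in> S \<Longrightarrow> x \<in> addspan T"
  shows "x \<in> addspan T"
  using addspan_map[of x S "\<lambda>x. x" T] assms by auto

lemma addspan_addspan: "addspan (addspan S) = addspan S"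
  using addspan_subset[of _ "addspan S" S] addspan_base by blast

lemma addspan_closed:
  assumes "x \<in> addspan S" and "0 \<in> T" and "\<And>x y. x \<in> T \<Longrightarrow> y \<in> T \<Longrightarrow> x + y \<in> T" and "S \<subseteq> T"
  shows "x \<in> T"
  using assms(1) by induction (use assms in auto)

lemma addspan_mult:
  fixes x y :: "'a::comm_ring_1"
  assumes "x \<in> addspan S" "y \<in> addspan T"
    and "\<And>x y. x \<in> S \<Longrightarrow> y \<in> T \<Longrightarrow> x * y \<in> addspan U"
  shows "x * y \<in> addspan U"
proof -
  have "x * y \<in> addspan U" if "x \<in> S" for x
    by (rule addspan_map[OF assms(2), where F = "\<lambda>y. x * y"])
       (auto simp: distrib_left intro: assms(3) that)
  then show ?thesis
    by (intro addspan_map[OF assms(1), where F = "\<lambda>x. x * y"]) (auto simp: distrib_right)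
qed

section \<open>Zero-sum sequences over \<open>C\<^sub>3 \<times> C\<^sub>3\<close>\<close>

text \<open>Sequences over \<open>C\<^sub>3 \<times> C\<^sub>3\<close> are multisets of objects with a weight in \<open>\<nat> \<times> \<nat>\<close>, to be read
  modulo 3. The weights are natural numbers because they serve as exponents of a cube root of unity.\<close>

definition zero_sum :: "('x \<Rightarrow> nat \<times> nat) \<Rightarrow> 'x multiset \<Rightarrow> bool" where
  "zero_sum wt X \<longleftrightarrow> 3 dvd (\<Sum>x\<in>#X. fst (wt x)) \<and> 3 dvd (\<Sum>x\<in>#X. snd (wt x))"

lemma zero_sum_union:
  assumes "zero_sum wt X"
  shows "zero_sum wt (X + Y) \<longleftrightarrow> zero_sum wt Y"
  using assms by (auto simp: zero_sum_def dvd_add_right_iff)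

lemma zero_sum_diff:
  assumes "zero_sum wt X" "U \<subseteq># X" "zero_sum wt U"
  shows "zero_sum wt (X - U)"
  using zero_sum_union[OF assms(3), of "X - U"] assms(1,2) by simp

definition residues3 :: "(nat \<times> nat) list" where
  "residues3 = List.product [0, 1, 2] [0, 1, 2]"

definition null3 :: "(nat \<times> nat) list \<Rightarrow> bool" where
  "null3 vs \<longleftrightarrow> (\<Sum>v\<leftarrow>vs. fst v) mod 3 = 0 \<and> (\<Sum>v\<leftarrow>vs. snd v) mod 3 = 0"

text \<open>Choosing one of the two generators of each of the four subgroups of order 3 always creates
  three elements with sum zero.\<close>

lemma four_directions:
  assumes "p \<in> {(1, 0), (2, 0)}" "q \<in> {(0, 1), (0, 2)}" "r \<in> {(1, 1), (2, 2)}" "s \<in> {(1, 2), (2, 1)}"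
  shows "null3 [p, q, r] \<or> null3 [p, q, s] \<or> null3 [p, r, s] \<or> null3 [q, r, s]"
  using assms by (elim insertE emptyE) (simp_all add: null3_def)

lemma sub_mset_of_image:
  assumes "W \<subseteq># image_mset f X"
  shows "\<exists>U. U \<subseteq># X \<and> image_mset f U = W"
proof -
  have "image_mset f X = W + (image_mset f X - W)" using assms by simp
  from image_mset_eq_plusD[OF this] obtain B C where BC: "X = B + C" "W = image_mset f B"
    by blast
  then show ?thesis
    by (metis mset_subset_eq_add_left)
qed

lemma mod3_in_residues3: "(i mod 3, j mod 3) \<in> set residues3"
proof -
  have "n mod 3 = 0 \<or> n mod 3 = 1 \<or> n mod 3 = 2" for n :: nat by presburger
  from this[of i] this[of j] show ?thesis by (elim disjE) (simp_all add: residues3_def)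
qed

lemma sum_mset_mod3:
  fixes f :: "'x \<Rightarrow> nat"
  shows "(\<Sum>x\<in>#U. f x mod 3) mod 3 = (\<Sum>x\<in>#U. f x) mod 3"
proof (induction U)
  case (add x U)
  show ?case
    unfolding image_mset_add_mset sum_mset.add_mset by (rule mod_add_cong[OF mod_mod_trivial add])
qed simp

text \<open>It suffices to look for short zero-sum subsequences among the residues of the weights.\<close>

lemma zero_sum_sub_residues:
  fixes wt :: "'x \<Rightarrow> nat \<times> nat"
  defines "red \<equiv> (\<lambda>x. (fst (wt x) mod 3, snd (wt x) mod 3))"
  assumes "mset vs \<subseteq># image_mset red X" "null3 vs"
  obtains U where "U \<subseteq># X" "size U = length vs" "zero_sum wt U"
proof -
  obtain U where U: "U \<subseteq># X" "image_mset red U = mset vs"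
    using sub_mset_of_image[OF assms(2)] by auto
  have "(\<Sum>v\<leftarrow>vs. f v) = (\<Sum>x\<in>#U. f (red x))" for f :: "nat \<times> nat \<Rightarrow> nat"
  proof -
    have "(\<Sum>v\<leftarrow>vs. f v) = sum_mset (image_mset f (mset vs))"
      by (simp only: sum_mset_sum_list flip: mset_map)
    also have "\<dots> = (\<Sum>x\<in>#U. f (red x))"
      by (simp only: U(2)[symmetric] multiset.map_comp comp_def)
    finally show ?thesis .
  qed
  from this[of fst] this[of snd] assms(3)
  have "(\<Sum>x\<in>#U. fst (wt x) mod 3) mod 3 = 0 \<and> (\<Sum>x\<in>#U. snd (wt x) mod 3) mod 3 = 0"
    by (simp only: null3_def red_def fst_conv snd_conv)
  then have "zero_sum wt U"
    by (simp only: sum_mset_mod3 zero_sum_def dvd_eq_mod_eq_0)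
  then show ?thesis
    using that U by (metis size_image_mset size_mset)
qed

text \<open>Without short zero-sum subsequences \<open>0\<close> does not occur, each of the four subgroups of order 3
  contributes at most one value, and no value occurs three times. By \<open>four_directions\<close> at
  most three values are left, so the length is at most 6. Length 6 forces the form \<open>x\<^sup>2y\<^sup>2z\<^sup>2\<close> with \<open>x + y + z \<noteq> 0\<close>.\<close>

lemma short_null3:
  assumes W: "set_mset W \<subseteq> set residues3"
    and no: "\<And>vs. mset vs \<subseteq># W \<Longrightarrow> length vs \<in> {1, 2, 3} \<Longrightarrow> \<not> null3 vs"
  shows "size W \<le> 6" and "size W = 6 \<Longrightarrow> \<not> zero_sum (\<lambda>v. v) W"
proof -
  have no1: "\<not> null3 [u]" if "u \<in># W" for u
    using no[of "[u]"] that by simp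
  have no2: "\<not> null3 [u, v]" if "u \<in># W" "v \<in># W" "u \<noteq> v" for u v
    using no[of "[u, v]"] that by (simp add: insert_subset_eq_iff in_diff_count)
  have no3: "\<not> null3 [u, v, x]" if "u \<in># W" "v \<in># W" "x \<in># W" "distinct [u, v, x]" for u v x
    using no[of "[u, v, x]"] that by (auto simp: insert_subset_eq_iff in_diff_count)
  have two: "count W v \<le> 2" for v
  proof (rule ccontr)
    assume "\<not> count W v \<le> 2"
    then have "mset [v, v, v] \<subseteq># W"
      by (auto simp: subseteq_mset_def)
    moreover have "null3 [v, v, v]"
    proof -
      have "(n + (n + n)) mod 3 = 0" for n :: nat by presburger
      then show ?thesis by (simp add: null3_def)
    qed
    ultimately show False using no[of "[v, v, v]"] by simp
  qed
  have dir: "\<exists>v\<in>{d, d'}. \<forall>x\<in>#W. x \<in> {d, d'} \<longrightarrow> x = v" if "d \<noteq> d'" "null3 [d, d']" for d d'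
    using no2[of d d'] that by (cases "d \<in># W") auto
  have opp: "null3 [(1, 0), (2, 0)]" "null3 [(0, 1), (0, 2)]" "null3 [(1, 1), (2, 2)]" "null3 [(1, 2), (2, 1)]"
    by (simp_all add: null3_def)
  obtain p where p: "p \<in> {(1, 0), (2, 0)}" "\<forall>x\<in>#W. x \<in> {(1, 0), (2, 0)} \<longrightarrow> x = p"
    using dir[OF _ opp(1)] by fastforce
  obtain q where q: "q \<in> {(0, 1), (0, 2)}" "\<forall>x\<in>#W. x \<in> {(0, 1), (0, 2)} \<longrightarrow> x = q"
    using dir[OF _ opp(2)] by fastforce
  obtain r where r: "r \<in> {(1, 1), (2, 2)}" "\<forall>x\<in>#W. x \<in> {(1, 1), (2, 2)} \<longrightarrow> x = r"
    using dir[OF _ opp(3)] by fastforce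
  obtain s where s: "s \<in> {(1, 2), (2, 1)}" "\<forall>x\<in>#W. x \<in> {(1, 2), (2, 1)} \<longrightarrow> x = s"
    using dir[OF _ opp(4)] by fastforce
  have sub: "set_mset W \<subseteq> {p, q, r, s}"
  proof
    fix x assume x: "x \<in># W"
    then have "x \<in> set residues3" "x \<noteq> (0, 0)" using W no1[of x] by (auto simp: null3_def)
    then have "x \<in> {(1, 0), (2, 0)} \<or> x \<in> {(0, 1), (0, 2)} \<or> x \<in> {(1, 1), (2, 2)} \<or> x \<in> {(1, 2), (2, 1)}"
      by (simp add: residues3_def) blast
    then show "x \<in> {p, q, r, s}" using p(2) q(2) r(2) s(2) x by blast
  qed
  have dist: "distinct [p, q, r, s]"
    using p(1) q(1) r(1) s(1) by (elim insertE emptyE) simp_all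
  have "\<not> {p, q, r, s} \<subseteq> set_mset W"
  proof
    assume "{p, q, r, s} \<subseteq> set_mset W"
    then have "p \<in># W" "q \<in># W" "r \<in># W" "s \<in># W" by simp_all
    moreover have "distinct [p, q, r]" "distinct [p, q, s]" "distinct [p, r, s]" "distinct [q, r, s]"
      using dist by simp_all
    ultimately show False
      using four_directions[OF p(1) q(1) r(1) s(1)] no3 by blast
  qed
  then have "set_mset W \<subset> {p, q, r, s}"
    using sub by auto
  then have card: "card (set_mset W) \<le> 3"
    using psubset_card_mono[of "{p, q, r, s}" "set_mset W"] dist by simp
  have size: "size W = (\<Sum>v\<in>set_mset W. count W v)"
    by (simp add: size_multiset_overloaded_eq)
  have le: "size W \<le> 2 * card (set_mset W)"
    using sum_bounded_above[of "set_mset W" "count W" 2] two size by simp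
  then show "size W \<le> 6" using card by simp
  assume 6: "size W = 6"
  then have "card (set_mset W) = 3" using le card by simp
  then obtain x y z where xyz: "set_mset W = {x, y, z}" "x \<noteq> y" "y \<noteq> z" "x \<noteq> z"
    by (auto simp: card_3_iff)
  have "count W x + count W y + count W z = 6"
    using 6 size xyz by simp
  then have "count W x = 2" "count W y = 2" "count W z = 2"
    using two[of x] two[of y] two[of z] by auto
  then have "W = {#x, x, y, y, z, z#}"
    using xyz by (intro multiset_eqI) (auto simp: not_in_iff)
  then have double: "(\<Sum>v\<in>#W. f v) = 2 * (f x + (f y + f z))" for f :: "nat \<times> nat \<Rightarrow> nat"
    by simp
  have "3 dvd 2 * n \<longleftrightarrow> n mod 3 = 0" for n :: nat by presburger
  then have "zero_sum (\<lambda>v. v) W \<longleftrightarrow> null3 [x, y, z]"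
    by (simp only: zero_sum_def double null3_def list.map sum_list.Cons sum_list.Nil add_0_right)
  then show "\<not> zero_sum (\<lambda>v. v) W"
    using no3[of x y z] xyz by simp
qed

lemma short_zero_sum:
  fixes wt :: "'x \<Rightarrow> nat \<times> nat"
  assumes "7 \<le> size X \<or> size X = 6 \<and> zero_sum wt X"
  obtains U where "U \<subseteq># X" "U \<noteq> {#}" "size U \<le> 3" "zero_sum wt U"
proof -
  define red where "red = (\<lambda>x. (fst (wt x) mod 3, snd (wt x) mod 3))"
  have "\<exists>vs. mset vs \<subseteq># image_mset red X \<and> length vs \<in> {1, 2, 3} \<and> null3 vs"
  proof (rule ccontr)
    assume no: "\<not> ?thesis"
    have "set_mset (image_mset red X) \<subseteq> set residues3"
      by (auto simp: red_def mod3_in_residues3)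
    note short = short_null3[OF this]
    have "size (image_mset red X) \<le> 6" by (rule short(1)) (use no in blast)
    then have "size X = 6" "zero_sum wt X" using assms by auto
    moreover have "\<not> zero_sum (\<lambda>v. v) (image_mset red X)"
      by (rule short(2)) (use no \<open>size X = 6\<close> in \<open>blast | simp\<close>)+
    moreover have "zero_sum wt X \<longleftrightarrow> zero_sum (\<lambda>v. v) (image_mset red X)"
      by (simp only: zero_sum_def red_def multiset.map_comp comp_def fst_conv snd_conv
          dvd_eq_mod_eq_0 sum_mset_mod3)
    ultimately show False by simp
  qed
  then obtain vs where vs: "mset vs \<subseteq># image_mset red X" "length vs \<in> {1, 2, 3}" "null3 vs"
    by auto
  obtain U where "U \<subseteq># X" "size U = length vs" "zero_sum wt U"
    by (rule zero_sum_sub_residues[OF vs(1)[unfolded red_def] vs(3)])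
  moreover have "U \<noteq> {#}" using calculation(2) vs(2) by auto
  ultimately show ?thesis using that[of U] vs(2) by auto
qed

lemma zero_sum_split2:
  assumes "zero_sum wt X" "6 \<le> size X"
  obtains U V where "X = U + V" "U \<noteq> {#}" "size U \<le> 3" "3 \<le> size V" "zero_sum wt U" "zero_sum wt V"
proof -
  obtain U where U: "U \<subseteq># X" "U \<noteq> {#}" "size U \<le> 3" "zero_sum wt U"
  proof (rule short_zero_sum)
    show "7 \<le> size X \<or> size X = 6 \<and> zero_sum wt X"
      using assms by (cases "size X = 6") auto
  qed
  then show ?thesis
    using that[of U "X - U"] assms zero_sum_diff[of wt X U] by (auto simp: size_Diff_submset)
qed

text \<open>Each of the first two pieces has length at most 3, so at least 6 and then 3 elements remain.\<close>

lemma zero_sum_split3: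
  assumes "zero_sum wt X" "9 \<le> size X"
  obtains U V W where "X = U + V + W" "U \<noteq> {#}" "V \<noteq> {#}" "W \<noteq> {#}"
    "zero_sum wt U" "zero_sum wt V" "zero_sum wt W"
proof -
  obtain U X' where U: "X = U + X'" "U \<noteq> {#}" "size U \<le> 3" "zero_sum wt U" "zero_sum wt X'"
  proof (rule zero_sum_split2)
    show "6 \<le> size X" using assms(2) by simp
  qed (use assms(1) in auto)
  obtain V W where "X' = V + W" "V \<noteq> {#}" "3 \<le> size W" "zero_sum wt V" "zero_sum wt W"
  proof (rule zero_sum_split2)
    show "6 \<le> size X'" using assms(2) U(1,3) by simp
  qed (use U in auto)
  moreover have "W \<noteq> {#}" using calculation(3) by auto
  ultimately show ?thesis using that[of U V W] U by (auto simp: add.assoc)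
qed

section \<open>Operators of order 3 on a graded ring\<close>

text \<open>\<open>H d\<close> is the set of homogeneous elements of degree \<open>d\<close>. The scalars, among them the cube
  root of unity \<open>w\<close> and \<open>t = 1/3\<close>, live in \<open>H 0\<close>.\<close>

locale cubic_grading =
  fixes H :: "nat \<Rightarrow> 'p::comm_ring_1 set" and w t :: 'p
  assumes H_zero: "0 \<in> H d"
    and H_add: "f \<in> H d \<Longrightarrow> g \<in> H d \<Longrightarrow> f + g \<in> H d"
    and H_mult: "f \<in> H i \<Longrightarrow> g \<in> H j \<Longrightarrow> f * g \<in> H (i + j)"
    and w_in: "w \<in> H 0" and t_in: "t \<in> H 0"
    and w_rel: "1 + w + w * w = 0" and t_rel: "3 * t = 1"
    and H_Suc: "f \<in> H (Suc d) \<Longrightarrow> f \<in> addspan {l * g | l g. l \<in> H 1 \<and> g \<in> H d}"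
begin

lemma H_scale: "s \<in> H 0 \<Longrightarrow> f \<in> H d \<Longrightarrow> s * f \<in> H d"
  using H_mult[of s 0 f d] by simp

lemma one_in: "1 \<in> H 0"
  using t_rel H_add[OF t_in H_add[OF t_in t_in]] by (simp add: algebra_simps)

lemma w_pow_in: "w ^ n \<in> H 0"
  by (induction n) (auto simp: one_in intro: H_scale w_in)

lemma w_cubed: "w ^ 3 = 1"
proof -
  have "w ^ 3 - 1 = (w - 1) * (1 + w + w * w)"
    by (simp add: algebra_simps power3_eq_cube)
  then show ?thesis by (simp add: w_rel)
qed

lemma w_pow_mod: "w ^ n = w ^ (n mod 3)"
proof -
  have "w ^ n = (w ^ 3) ^ (n div 3) * w ^ (n mod 3)"
    by (simp flip: power_mult power_add)
  then show ?thesis by (simp add: w_cubed)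
qed

lemma w_pow_cong: "n mod 3 = m mod 3 \<Longrightarrow> w ^ n = w ^ m"
  by (metis w_pow_mod)

lemma w_pow_dvd: "3 dvd n \<Longrightarrow> w ^ n = 1"
  using w_pow_cong[of n 0] by simp

lemma minus_one_eq: "- 1 = w + w * w"
  using minus_unique[of 1 "w + w * w"] w_rel by (simp add: add.assoc)

lemma character_sum: "t * (1 + w ^ n + w ^ (2 * n)) = (if 3 dvd n then 1 else 0)"
proof (cases "3 dvd n")
  case True
  then show ?thesis using t_rel by (simp add: w_pow_dvd mult.commute)
next
  case False
  then have "n mod 3 = 1 \<or> n mod 3 = 2" by presburger
  then have "w ^ n = w \<and> w ^ (2 * n) = w * w \<or> w ^ n = w * w \<and> w ^ (2 * n) = w"
  proof
    assume "n mod 3 = 1"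
    then have "n mod 3 = 1 mod 3" "(2 * n) mod 3 = 2 mod 3" by presburger+
    from w_pow_cong[OF this(1)] w_pow_cong[OF this(2)] show ?thesis by (simp add: power2_eq_square)
  next
    assume "n mod 3 = 2"
    then have "n mod 3 = 2 mod 3" "(2 * n) mod 3 = 1 mod 3" by presburger+
    from w_pow_cong[OF this(1)] w_pow_cong[OF this(2)] show ?thesis by (simp add: power2_eq_square)
  qed
  moreover have "1 + w * w + w = 0" using w_rel by (simp only: add.assoc add.commute[of w])
  ultimately have "1 + w ^ n + w ^ (2 * n) = 0" using w_rel by (elim disjE conjE) simp_all
  then show ?thesis using False by simp
qed

text \<open>The cube of \<open>g\<close> is the identity on homogeneous elements only: a substitution of \<open>n\<close> variables need not
  have finite order on polynomials which contain further variables.\<close>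

definition order3 :: "('p \<Rightarrow> 'p) \<Rightarrow> bool" where
  "order3 g \<longleftrightarrow> (\<forall>f h. g (f + h) = g f + g h) \<and> (\<forall>f h. g (f * h) = g f * g h) \<and>
    (\<forall>s\<in>H 0. g s = s) \<and> (\<forall>d. \<forall>f\<in>H d. g f \<in> H d \<and> g (g (g f)) = f)"

lemma
  assumes "order3 g"
  shows order3_add: "g (f + h) = g f + g h"
    and order3_mult: "g (f * h) = g f * g h"
    and order3_scalar: "s \<in> H 0 \<Longrightarrow> g s = s"
    and order3_in: "f \<in> H d \<Longrightarrow> g f \<in> H d"
    and order3_cube: "f \<in> H d \<Longrightarrow> g (g (g f)) = f"
  using assms unfolding order3_def by blast+

lemma order3_scale:
  assumes "order3 g" "s \<in> H 0"
  shows "g (s * f) = s * g f"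
  by (simp only: order3_mult[OF assms(1)] order3_scalar[OF assms])

lemma order3_zero:
  assumes "order3 g"
  shows "g 0 = 0"
proof -
  have "g 0 + g 0 = g 0 + 0" using order3_add[OF assms, of 0 0] by simp
  then show ?thesis by (rule add_left_imp_eq)
qed

text \<open>The projection onto the eigenspace of \<open>g\<close> for the eigenvalue \<open>w ^ k\<close>.\<close>

definition eigenpart :: "('p \<Rightarrow> 'p) \<Rightarrow> nat \<Rightarrow> 'p \<Rightarrow> 'p" where
  "eigenpart g k f = t * (f + w ^ (2 * k) * g f + w ^ k * g (g f))"

lemma eigenpart_in:
  assumes "order3 g" "f \<in> H d"
  shows "eigenpart g k f \<in> H d"
  unfolding eigenpart_def
  by (intro H_scale H_add t_in w_pow_in order3_in[OF assms(1)] assms(2))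

lemma
  assumes g: "order3 g"
  shows eigenpart_add: "eigenpart g k (f + h) = eigenpart g k f + eigenpart g k h"
    and eigenpart_zero: "eigenpart g k 0 = 0"
  by (simp_all add: eigenpart_def order3_add[OF g] order3_zero[OF g] algebra_simps)

lemma eigenpart_scale:
  assumes g: "order3 g" and "s \<in> H 0"
  shows "eigenpart g k (s * f) = s * eigenpart g k f"
  unfolding eigenpart_def order3_scale[OF assms] by (simp add: algebra_simps)

lemma eigenpart_eigen:
  assumes g: "order3 g" and f: "f \<in> H d"
  shows "g (eigenpart g k f) = w ^ k * eigenpart g k f"
proof -
  have "g (eigenpart g k f) = t * (g f + w ^ (2 * k) * g (g f) + w ^ k * f)"
    by (simp add: eigenpart_def order3_scale[OF g] order3_add[OF g] t_in w_pow_in order3_cube[OF g f])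
  also have "\<dots> = t * (w ^ (3 * k) * g f + w ^ (2 * k) * g (g f) + w ^ k * f)"
    by (simp add: w_pow_dvd)
  also have "\<dots> = w ^ k * eigenpart g k f"
  proof -
    have e: "3 * k = k + 2 * k" "2 * k = k + k" by simp_all
    have "w ^ (3 * k) = w ^ k * w ^ (2 * k)" by (simp only: e(1) power_add)
    moreover have "w ^ (2 * k) = w ^ k * w ^ k" by (simp only: e(2) power_add)
    ultimately show ?thesis by (simp add: eigenpart_def algebra_simps)
  qed
  finally show ?thesis .
qed

lemma eigenpart_decomp:
  assumes "order3 g"
  shows "f = (\<Sum>k<3. eigenpart g k f)"
proof -
  have sum3: "(\<Sum>k<3. F k) = F 0 + F 1 + F 2" for F :: "nat \<Rightarrow> 'p"
    by (simp add: eval_nat_numeral)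
  have w4: "w ^ (2 * 2) = w" using w_pow_cong[of "2 * 2" 1] by simp
  have "(\<Sum>k<3. eigenpart g k f) =
      3 * t * f + (1 + w + w * w) * (t * g f) + (1 + w + w * w) * (t * g (g f))"
    unfolding sum3 eigenpart_def w4 by (simp add: algebra_simps power2_eq_square)
  also have "\<dots> = f" by (simp add: w_rel t_rel)
  finally show ?thesis by simp
qed

text \<open>The condition \<open>3 dvd 2 * k + j\<close> says that \<open>j\<close> and \<open>k\<close> are congruent modulo 3.\<close>

lemma eigenpart_of_eigen:
  assumes g: "order3 g" and f: "g f = w ^ j * f"
  shows "eigenpart g k f = (if 3 dvd 2 * k + j then f else 0)"
proof -
  have "g (g f) = w ^ j * w ^ j * f"
    by (simp add: f order3_scale[OF g w_pow_in] mult.assoc)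
  then have "eigenpart g k f = t * (1 + w ^ (2 * k) * w ^ j + w ^ k * w ^ j * w ^ j) * f"
    by (simp add: eigenpart_def f algebra_simps)
  also have "w ^ k * w ^ j * w ^ j = w ^ (2 * (2 * k + j))"
  proof -
    have "(k + j + j) mod 3 = (2 * (2 * k + j)) mod 3" by presburger
    then show ?thesis by (metis w_pow_cong power_add)
  qed
  also have "w ^ (2 * k) * w ^ j = w ^ (2 * k + j)" by (simp add: power_add)
  finally show ?thesis by (simp only: character_sum) simp
qed

lemma eigenpart_commute:
  assumes g: "order3 g" and h: "order3 h" and gh: "h (g f) = g (h f)" "h (g (g f)) = g (g (h f))"
  shows "h (eigenpart g k f) = eigenpart g k (h f)"
  by (simp add: eigenpart_def order3_scale[OF h] order3_add[OF h] t_in w_pow_in gh)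

subsection \<open>Products of eigenvectors of degree 1\<close>

text \<open>A product is a multiset of linear forms that carry their exponents as labels. The labels are kept
  because the zero form is an eigenvector for every eigenvalue.\<close>

definition c_letters :: "('p \<Rightarrow> 'p) \<Rightarrow> ('p \<times> nat) set" where
  "c_letters c = {(l, j). l \<in> H 1 \<and> c l = w ^ j * l \<and> j < 3}"

abbreviation form :: "('p \<times> 'l) multiset \<Rightarrow> 'p" where
  "form X \<equiv> (\<Prod>x\<in>#X. fst x)"

definition c_type :: "('p \<Rightarrow> 'p) \<Rightarrow> nat multiset \<Rightarrow> 'p set" where
  "c_type c N = addspan {form Y | Y. set_mset Y \<subseteq> c_letters c \<and> image_mset snd Y = N}"

lemma form_in:
  assumes "\<And>x. x \<in># X \<Longrightarrow> fst x \<in> H 1"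
  shows "form X \<in> H (size X)"
  using assms
proof (induction X)
  case empty
  show ?case by (simp add: one_in)
next
  case (add x X)
  then show ?case using H_mult[of "fst x" 1 "form X" "size X"] by simp
qed

lemma eigen_form:
  assumes g: "order3 g" and "\<And>x. x \<in># X \<Longrightarrow> g (fst x) = w ^ e x * fst x"
  shows "g (form X) = w ^ (\<Sum>x\<in>#X. e x) * form X"
  using assms(2)
proof (induction X)
  case empty
  show ?case by (simp add: order3_scalar[OF g one_in])
next
  case (add x X)
  then show ?case by (simp add: order3_mult[OF g] power_add algebra_simps)
qed

lemma linear_addspan:
  assumes l: "l \<in> H 1" and c: "order3 c"
  shows "l \<in> addspan {form Y | Y. set_mset Y \<subseteq> c_letters c \<and> size Y = Suc 0}"
proof -
  have "eigenpart c k l \<in> {form Y | Y. set_mset Y \<subseteq> c_letters c \<and> size Y = Suc 0}" if "k < 3" for k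
    using that eigenpart_in[OF c l] eigenpart_eigen[OF c l]
    by (auto simp: c_letters_def intro!: exI[of _ "{#(eigenpart c k l, k)#}"])
  then have "(\<Sum>k<3. eigenpart c k l) \<in> addspan {form Y | Y. set_mset Y \<subseteq> c_letters c \<and> size Y = Suc 0}"
    by (intro addspan_sum addspan_base) auto
  then show ?thesis by (simp only: eigenpart_decomp[OF c, of l, symmetric])
qed

text \<open>Linear forms are sums of eigenvectors, so products of eigenvectors span every degree.\<close>

lemma homogeneous_in_span: "f \<in> H (Suc d) \<Longrightarrow> order3 c \<Longrightarrow>
    f \<in> addspan {form Y | Y. set_mset Y \<subseteq> c_letters c \<and> size Y = Suc d}"
  (is "_ \<Longrightarrow> _ \<Longrightarrow> _ \<in> addspan (?S (Suc d))")
proof (induction d arbitrary: f)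
  case 0
  then show ?case using linear_addspan by simp
next
  case (Suc d)
  have "f \<in> addspan {l * g | l g. l \<in> H 1 \<and> g \<in> H (Suc d)}" using H_Suc Suc.prems by blast
  then show ?case
  proof (rule addspan_subset)
    fix x assume "x \<in> {l * g | l g. l \<in> H 1 \<and> g \<in> H (Suc d)}"
    then obtain l g where x: "x = l * g" "l \<in> H 1" "g \<in> H (Suc d)" by blast
    have "l * g \<in> addspan (?S (Suc (Suc d)))"
    proof (rule addspan_mult[OF linear_addspan[OF x(2) Suc.prems(2)] Suc.IH[OF x(3) Suc.prems(2)]])
      fix x y assume "x \<in> {form Y | Y. set_mset Y \<subseteq> c_letters c \<and> size Y = Suc 0}" "y \<in> ?S (Suc d)"
      then obtain X Y where "x = form X" "y = form Y" "set_mset X \<subseteq> c_letters c" "set_mset Y \<subseteq> c_letters c"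
        "size X = Suc 0" "size Y = Suc d" by blast
      then show "x * y \<in> addspan (?S (Suc (Suc d)))"
        by (intro addspan_base CollectI exI[of _ "X + Y"]) auto
    qed
    then show "x \<in> addspan (?S (Suc (Suc d)))" by (simp add: x)
  qed
qed

lemma c_type_in:
  assumes "f \<in> c_type c N"
  shows "f \<in> H (size N)"
  using assms unfolding c_type_def
proof (rule addspan_closed)
  show "{form Y | Y. set_mset Y \<subseteq> c_letters c \<and> image_mset snd Y = N} \<subseteq> H (size N)"
  proof clarify
    fix Y assume Y: "set_mset Y \<subseteq> c_letters c" "N = image_mset snd Y"
    have "fst x \<in> H 1" if "x \<in># Y" for x
      using that Y(1) by (auto simp: c_letters_def)
    then show "form Y \<in> H (size (image_mset snd Y))"
      unfolding size_image_mset by (rule form_in)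
  qed
qed (auto intro: H_zero H_add)

lemma c_type_map:
  assumes g: "order3 g" and comm: "\<And>l. l \<in> H 1 \<Longrightarrow> c (g l) = g (c l)" and f: "f \<in> c_type c N"
  shows "g f \<in> c_type c N"
  using f unfolding c_type_def
proof (rule addspan_map)
  fix x assume "x \<in> {form Y | Y. set_mset Y \<subseteq> c_letters c \<and> image_mset snd Y = N}"
  then obtain Y where Y: "x = form Y" "set_mset Y \<subseteq> c_letters c" "image_mset snd Y = N" by blast
  let ?Y = "image_mset (\<lambda>(l, j). (g l, j)) Y"
  have "g (form Y) = form ?Y"
    by (induction Y) (auto simp: order3_scalar[OF g one_in] order3_mult[OF g])
  moreover have "set_mset ?Y \<subseteq> c_letters c"
    using Y(2) by (auto simp: c_letters_def comm order3_in[OF g] order3_scale[OF g w_pow_in])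
  moreover have "image_mset snd ?Y = N"
    by (simp add: Y(3)[symmetric] multiset.map_comp comp_def case_prod_unfold)
  ultimately show "g x \<in> addspan {form Y | Y. set_mset Y \<subseteq> c_letters c \<and> image_mset snd Y = N}"
    using Y(1) by (intro addspan_base) blast
qed (simp_all add: order3_zero[OF g] order3_add[OF g])

lemma c_type_scale:
  assumes s: "s \<in> H 0" and f: "f \<in> c_type c N" and N: "N \<noteq> {#}" and c: "order3 c"
  shows "s * f \<in> c_type c N"
  using f unfolding c_type_def
proof (rule addspan_map)
  fix x assume "x \<in> {form Y | Y. set_mset Y \<subseteq> c_letters c \<and> image_mset snd Y = N}"
  then obtain Y where Y: "x = form Y" "set_mset Y \<subseteq> c_letters c" "image_mset snd Y = N" by blast
  then obtain y Y' where Y': "Y = add_mset y Y'" using N by (cases Y) auto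
  then have "s * x = form (add_mset (s * fst y, snd y) Y')" by (simp add: Y(1) mult.assoc)
  moreover have "(s * fst y, snd y) \<in> c_letters c"
    using Y(2) by (auto simp: Y' c_letters_def order3_scale[OF c s] algebra_simps intro: H_scale s)
  ultimately show "s * x \<in> addspan {form Y | Y. set_mset Y \<subseteq> c_letters c \<and> image_mset snd Y = N}"
    using Y(2,3) by (intro addspan_base CollectI exI[of _ "add_mset (s * fst y, snd y) Y'"]) (auto simp: Y')
qed (simp_all add: algebra_simps)

lemma c_type_eigenpart:
  assumes g: "order3 g" "\<And>l. l \<in> H 1 \<Longrightarrow> c (g l) = g (c l)"
    and f: "f \<in> c_type c N" and N: "N \<noteq> {#}" and c: "order3 c"
  shows "eigenpart g k f \<in> c_type c N"
proof -
  have add: "x + y \<in> c_type c N" if "x \<in> c_type c N" "y \<in> c_type c N" for x y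
    using that by (simp add: c_type_def addspan_add)
  have map: "g x \<in> c_type c N" if "x \<in> c_type c N" for x
    by (rule c_type_map[OF g(1) _ that]) (rule g(2))
  show ?thesis
    unfolding eigenpart_def by (intro c_type_scale[OF _ _ N c] add map t_in w_pow_in f)
qed

end

section \<open>Semi-invariants modulo the Hilbert ideal\<close>

lemma same_character:
  fixes p q :: nat
  assumes "\<not> 3 dvd p" "\<not> 3 dvd q" "\<not> 3 dvd p + q"
  shows "p mod 3 = q mod 3"
  using assms by presburger

lemma other_character:
  fixes k n m :: nat
  assumes "3 dvd 2 * k + (n + m)" "3 dvd n"
  shows "m mod 3 = k mod 3"
proof -
  have "3 dvd 2 * k + m" using assms by (simp add: dvd_add_right_iff add.left_commute)
  then show ?thesis by presburger
qed

context cubic_grading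
begin

lemma span_of_eigenparts:
  assumes "order3 g" "\<And>k. eigenpart g k f \<in> S"
  shows "f \<in> addspan S"
proof -
  have "(\<Sum>k<3. eigenpart g k f) \<in> addspan S"
    by (intro addspan_sum addspan_base assms(2))
  then show ?thesis by (simp only: eigenpart_decomp[OF assms(1), of f, symmetric])
qed

definition fixed3 :: "('p \<Rightarrow> 'p) \<Rightarrow> ('p \<Rightarrow> 'p) \<Rightarrow> ('p \<Rightarrow> 'p) \<Rightarrow> nat \<Rightarrow> 'p set" where
  "fixed3 a b c d = {f \<in> H d. a f = f \<and> b f = f \<and> c f = f}"

definition decomposables :: "('p \<Rightarrow> 'p) \<Rightarrow> ('p \<Rightarrow> 'p) \<Rightarrow> ('p \<Rightarrow> 'p) \<Rightarrow> nat \<Rightarrow> 'p set" where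
  "decomposables a b c d = addspan {r * s | r s i j.
     r \<in> fixed3 a b c i \<and> 0 < i \<and> s \<in> fixed3 a b c j \<and> 0 < j \<and> i + j = d}"

lemma decomposables_mono:
  assumes "\<And>i. fixed3 a b c i \<subseteq> fixed3 a' b' c' i" "f \<in> decomposables a b c d"
  shows "f \<in> decomposables a' b' c' d"
  using assms(2) unfolding decomposables_def
  by (rule addspan_subset) (use assms(1) in \<open>blast intro: addspan_base\<close>)

end

text \<open>The commutation rules say that \<open>c\<close> is the commutator of \<open>a\<close> and \<open>b\<close> and is central.\<close>

locale heisenberg_action = cubic_grading H w t for H :: "nat \<Rightarrow> 'p::comm_ring_1 set" and w t +
  fixes a b c :: "'p \<Rightarrow> 'p"
  assumes a: "order3 a" and b: "order3 b" and c: "order3 c"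
    and comm_ab: "f \<in> H d \<Longrightarrow> a (b f) = b (a (c f))"
    and comm_ca: "f \<in> H d \<Longrightarrow> c (a f) = a (c f)"
    and comm_cb: "f \<in> H d \<Longrightarrow> c (b f) = b (c f)"
begin

definition ac_fixed :: "nat \<Rightarrow> 'p set" where
  "ac_fixed d = {f \<in> H d. a f = f \<and> c f = f}"

lemma ac_fixedD:
  assumes "f \<in> ac_fixed d"
  shows "f \<in> H d" "a f = f" "c f = f"
  using assms by (simp_all add: ac_fixed_def)

lemma ac_fixed_mult: "f \<in> ac_fixed i \<Longrightarrow> g \<in> ac_fixed j \<Longrightarrow> f * g \<in> ac_fixed (i + j)"
  by (simp add: ac_fixed_def order3_mult[OF a] order3_mult[OF c] H_mult)

lemma ac_fixed_scale: "s \<in> H 0 \<Longrightarrow> f \<in> ac_fixed d \<Longrightarrow> s * f \<in> ac_fixed d"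
  by (simp add: ac_fixed_def order3_scale[OF a] order3_scale[OF c] H_scale)

lemma ac_fixed_add: "f \<in> ac_fixed d \<Longrightarrow> g \<in> ac_fixed d \<Longrightarrow> f + g \<in> ac_fixed d"
  by (simp add: ac_fixed_def order3_add[OF a] order3_add[OF c] H_add)

lemma ac_fixed_b: "f \<in> ac_fixed d \<Longrightarrow> b f \<in> ac_fixed d"
  using comm_ab[of f d] comm_cb[of f d] order3_in[OF b, of f d] by (simp add: ac_fixed_def)

lemma ac_fixed_eigenpart: "f \<in> ac_fixed d \<Longrightarrow> eigenpart b k f \<in> ac_fixed d"
  unfolding eigenpart_def by (intro ac_fixed_scale ac_fixed_add ac_fixed_b t_in w_pow_in)

text \<open>The semi-invariants on which \<open>a\<close> and \<open>c\<close> act trivially and \<open>b\<close> by \<open>w ^ k\<close>; for \<open>k = 0\<close> these are the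
  invariants.\<close>

definition b_eigen :: "nat \<Rightarrow> nat \<Rightarrow> 'p set" where
  "b_eigen k d = {f \<in> ac_fixed d. b f = w ^ k * f}"

lemma ac_fixed_span:
  assumes "f \<in> ac_fixed d"
  shows "f \<in> addspan (\<Union>k. b_eigen k d)"
proof (rule span_of_eigenparts[OF b])
  fix k
  show "eigenpart b k f \<in> (\<Union>k. b_eigen k d)"
    using ac_fixed_eigenpart[OF assms] eigenpart_eigen[OF b ac_fixedD(1)[OF assms], of k]
    by (auto simp: b_eigen_def)
qed

lemma b_eigen_mult: "f \<in> b_eigen k i \<Longrightarrow> g \<in> b_eigen l j \<Longrightarrow> f * g \<in> b_eigen (k + l) (i + j)"
  by (simp add: b_eigen_def ac_fixed_mult order3_mult[OF b] power_add algebra_simps)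

lemma b_eigen_cong: "k mod 3 = l mod 3 \<Longrightarrow> b_eigen k d = b_eigen l d"
  using w_pow_cong[of k l] by (simp add: b_eigen_def)

lemma fixed3_eq: "fixed3 a b c d = b_eigen 0 d"
  by (auto simp: fixed3_def b_eigen_def ac_fixed_def)

text \<open>The degree \<open>d\<close> part of the ideal which the invariants of positive degree generate, cut down
  to the semi-invariants with character \<open>k\<close>.\<close>

definition hilbert_part :: "nat \<Rightarrow> nat \<Rightarrow> 'p set" where
  "hilbert_part k d = addspan {r * s | r s i j. r \<in> b_eigen 0 i \<and> 0 < i \<and> s \<in> b_eigen k j \<and> i + j = d}"

lemma hilbert_part_base:
  assumes "r \<in> b_eigen l i" "3 dvd l" "0 < i" "s \<in> b_eigen m j" "m mod 3 = k mod 3"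
  shows "r * s \<in> hilbert_part k (i + j)"
proof -
  have "r \<in> b_eigen 0 i" "s \<in> b_eigen k j"
    using assms b_eigen_cong[of l 0] b_eigen_cong[of m k] by auto
  then show ?thesis
    unfolding hilbert_part_def using assms(3) by (intro addspan_base) blast
qed

lemma hilbert_part_zero: "0 \<in> hilbert_part k d"
  by (simp add: hilbert_part_def addspan_zero)

lemma hilbert_part_add: "x \<in> hilbert_part k d \<Longrightarrow> y \<in> hilbert_part k d \<Longrightarrow> x + y \<in> hilbert_part k d"
  by (simp add: hilbert_part_def addspan_add)

lemma hilbert_part_scale:
  assumes "u \<in> H 0" "x \<in> hilbert_part k d"
  shows "u * x \<in> hilbert_part k d"
  using assms(2) unfolding hilbert_part_def
proof (rule addspan_map)
  fix x assume "x \<in> {r * s | r s i j. r \<in> b_eigen 0 i \<and> 0 < i \<and> s \<in> b_eigen k j \<and> i + j = d}"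
  then obtain r s i j where x: "x = r * s" "r \<in> b_eigen 0 i" "0 < i" "s \<in> b_eigen k j" "i + j = d"
    by blast
  have "u * s \<in> b_eigen k j"
    using x(4) ac_fixed_scale[OF assms(1), of s j] order3_scale[OF b assms(1), of s]
    by (simp add: b_eigen_def mult.left_commute)
  moreover have "u * x = r * (u * s)" by (simp add: x(1) mult.left_commute)
  ultimately show "u * x \<in> addspan {r * s | r s i j. r \<in> b_eigen 0 i \<and> 0 < i \<and> s \<in> b_eigen k j \<and> i + j = d}"
    using x(2,3,5) by (intro addspan_base) blast
qed (simp_all add: distrib_left)

lemma eigenpart_b_eigen: "f \<in> b_eigen j d \<Longrightarrow> eigenpart b k f = (if 3 dvd 2 * k + j then f else 0)"
  by (rule eigenpart_of_eigen[OF b]) (simp add: b_eigen_def)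

text \<open>Among three eigenvectors of \<open>b\<close> whose product is not invariant there is a subproduct that is
  invariant, and it can be pulled out as the factor that puts the product in the ideal.\<close>

lemma three_factors:
  assumes k: "\<not> 3 dvd k" and x: "x \<in> ac_fixed i" "0 < i" and y: "y \<in> ac_fixed j" "0 < j"
    and z: "z \<in> ac_fixed l" "0 < l"
  shows "eigenpart b k (x * y * z) \<in> hilbert_part k (i + j + l)"
proof -
  let ?S = "{u * v * s | u v s. u \<in> (\<Union>k. b_eigen k i) \<and> v \<in> (\<Union>k. b_eigen k j) \<and> s \<in> (\<Union>k. b_eigen k l)}"
  have "x * y \<in> addspan {u * v | u v. u \<in> (\<Union>k. b_eigen k i) \<and> v \<in> (\<Union>k. b_eigen k j)}"
    by (rule addspan_mult[OF ac_fixed_span[OF x(1)] ac_fixed_span[OF y(1)]], rule addspan_base) blast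
  then have "x * y * z \<in> addspan ?S"
    by (rule addspan_mult[OF _ ac_fixed_span[OF z(1)]]) (rule addspan_base, blast)
  then show ?thesis
    unfolding hilbert_part_def
  proof (rule addspan_map)
    fix f assume "f \<in> ?S"
    then obtain u v s p q r where f: "f = u * v * s"
      and u: "u \<in> b_eigen p i" and v: "v \<in> b_eigen q j" and s: "s \<in> b_eigen r l" by blast
    have uv: "u * v \<in> b_eigen (p + q) (i + j)" and vs: "v * s \<in> b_eigen (q + r) (j + l)"
      and us: "u * s \<in> b_eigen (p + r) (i + l)"
      by (intro b_eigen_mult u v s)+
    have "f \<in> b_eigen (p + q + r) (i + j + l)"
      unfolding f by (intro b_eigen_mult u v s)
    note F = eigenpart_b_eigen[OF this, of k]
    have "eigenpart b k f \<in> hilbert_part k (i + j + l)"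
    proof (cases "3 dvd 2 * k + (p + q + r)")
      case False
      then show ?thesis by (simp add: F hilbert_part_zero)
    next
      case True
      \<comment> \<open>If no partial product were invariant, the three characters would coincide and the
        product would be invariant.\<close>
      have "3 dvd p \<or> 3 dvd q \<or> 3 dvd r \<or> 3 dvd p + q \<or> 3 dvd p + r \<or> 3 dvd q + r"
      proof (rule ccontr)
        assume "\<not> ?thesis"
        then have "p mod 3 = r mod 3" "q mod 3 = r mod 3"
          using same_character by blast+
        then have "(p + q + r) mod 3 = (r + r + r) mod 3" by (intro mod_add_cong) simp_all
        then have "3 dvd p + q + r" by (simp add: dvd_eq_mod_eq_0) presburger
        then have "3 dvd 2 * k" using True by (simp only: dvd_add_left_iff)
        then show False using k by presburger
      qed
      then consider "3 dvd p" "(q + r) mod 3 = k mod 3" | "3 dvd q" "(p + r) mod 3 = k mod 3"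
        | "3 dvd r" "(p + q) mod 3 = k mod 3" | "3 dvd p + q" "r mod 3 = k mod 3"
        | "3 dvd p + r" "q mod 3 = k mod 3" | "3 dvd q + r" "p mod 3 = k mod 3"
        using True other_character[of k p "q + r"] other_character[of k q "p + r"]
          other_character[of k r "p + q"] other_character[of k "p + q" r]
          other_character[of k "p + r" q] other_character[of k "q + r" p]
        by (auto simp: ac_simps)
      then have "f \<in> hilbert_part k (i + j + l)"
      proof cases
        case 1
        show ?thesis using hilbert_part_base[OF u 1(1) x(2) vs 1(2)] by (simp add: f ac_simps)
      next
        case 2
        show ?thesis using hilbert_part_base[OF v 2(1) y(2) us 2(2)] by (simp add: f ac_simps)
      next
        case 3
        show ?thesis using hilbert_part_base[OF s 3(1) z(2) uv 3(2)] by (simp add: f ac_simps)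
      next
        case 4
        show ?thesis using hilbert_part_base[OF uv 4(1) _ s 4(2)] x(2) by (simp add: f ac_simps)
      next
        case 5
        show ?thesis using hilbert_part_base[OF us 5(1) _ v 5(2)] x(2) by (simp add: f ac_simps)
      next
        case 6
        show ?thesis using hilbert_part_base[OF vs 6(1) _ u 6(2)] y(2) by (simp add: f ac_simps)
      qed
      then show ?thesis using True by (simp add: F)
    qed
    then show "eigenpart b k f \<in> addspan {r * s | r s ia ja. r \<in> b_eigen 0 ia \<and> 0 < ia \<and> s \<in> b_eigen k ja \<and> ia + ja = i + j + l}"
      by (simp add: hilbert_part_def)
  qed (simp_all add: eigenpart_zero[OF b] eigenpart_add[OF b])
qed

text \<open>For eigenvectors \<open>u\<close>, \<open>v\<close> of \<open>b\<close> with product of character \<open>k\<close>, either one of them is invariant, or both have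
  character \<open>2 k\<close>. In the second case \<open>u * b v = w ^ (2 * k) * (u * v)\<close>. So modulo the ideal the application of
  \<open>b\<close> to the second factor amounts to multiplication by a unit.\<close>

lemma two_factors:
  assumes k: "\<not> 3 dvd k" and x: "x \<in> ac_fixed i" "0 < i" and y: "y \<in> ac_fixed j" "0 < j"
    and shifted: "eigenpart b k (x * b y) \<in> hilbert_part k (i + j)"
  shows "eigenpart b k (x * y) \<in> hilbert_part k (i + j)"
proof -
  \<comment> \<open>The factor \<open>w + w * w\<close> is \<open>- 1\<close>, written with scalars that are known to lie in \<open>H 0\<close>.\<close>
  let ?D = "\<lambda>x y. eigenpart b k (x * b y) + (w + w * w) * (w ^ (2 * k) * eigenpart b k (x * y))"
  have eigen: "?D u v \<in> hilbert_part k (i + j)" if u: "u \<in> b_eigen p i" and v: "v \<in> b_eigen q j" for u v p q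
  proof -
    have uv: "u * v \<in> b_eigen (p + q) (i + j)"
      by (intro b_eigen_mult u v)
    have "u * b v = w ^ q * (u * v)"
      using v by (simp add: b_eigen_def mult.left_commute)
    then have D: "eigenpart b k (u * b v) + (w + w * w) * (w ^ (2 * k) * eigenpart b k (u * v)) =
        (w ^ q - w ^ (2 * k)) * eigenpart b k (u * v)"
      by (simp add: eigenpart_scale[OF b w_pow_in] left_diff_distrib flip: minus_one_eq)
    have scalar: "w ^ q - w ^ (2 * k) \<in> H 0"
      using H_add[OF w_pow_in[of q] H_scale[OF H_add[OF w_in H_scale[OF w_in w_in]] w_pow_in[of "2 * k"]]]
      by (simp flip: minus_one_eq)
    show ?thesis
    proof (cases "3 dvd 2 * k + (p + q)")
      case False
      then show ?thesis
        unfolding D unfolding eigenpart_b_eigen[OF uv] by (simp add: hilbert_part_zero)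
    next
      case True
      have "3 dvd p \<or> 3 dvd q \<or> q mod 3 = (2 * k) mod 3"
      proof (rule ccontr)
        assume neg: "\<not> ?thesis"
        have "\<not> 3 dvd p + q"
        proof
          assume "3 dvd p + q"
          then have "3 dvd 2 * k" using True by (simp only: dvd_add_left_iff)
          then show False using k by presburger
        qed
        then have "p mod 3 = q mod 3" using neg same_character by blast
        then have "(2 * k + (p + q)) mod 3 = (2 * k + (q + q)) mod 3" by (intro mod_add_cong) simp_all
        then have "3 dvd 2 * k + (q + q)" using True by (simp only: dvd_eq_mod_eq_0)
        then have "q mod 3 = (2 * k) mod 3" by presburger
        then show False using neg by blast
      qed
      then consider "q mod 3 = (2 * k) mod 3" | "3 dvd p" "q mod 3 = k mod 3" | "3 dvd q" "p mod 3 = k mod 3"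
        using True other_character[of k p q] other_character[of k q p] by (auto simp: ac_simps)
      then show ?thesis
      proof cases
        case 1
        then show ?thesis using w_pow_cong[OF 1] D by (simp add: hilbert_part_zero)
      next
        case 2
        then have "u * v \<in> hilbert_part k (i + j)"
          using hilbert_part_base[OF u 2(1) x(2) v 2(2)] by simp
        then show ?thesis
          unfolding D unfolding eigenpart_b_eigen[OF uv] using True scalar by (simp add: hilbert_part_scale)
      next
        case 3
        then have "u * v \<in> hilbert_part k (i + j)"
          using hilbert_part_base[OF v 3(1) y(2) u 3(2)] by (simp add: ac_simps)
        then show ?thesis
          unfolding D unfolding eigenpart_b_eigen[OF uv] using True scalar by (simp add: hilbert_part_scale)
      qed
    qed
  qed
  have "?D u y \<in> hilbert_part k (i + j)" if u: "u \<in> b_eigen p i" for u p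
    unfolding hilbert_part_def
  proof (rule addspan_map[OF ac_fixed_span[OF y(1)], where F = "\<lambda>y. ?D u y"])
    fix v assume "v \<in> (\<Union>k. b_eigen k j)"
    then show "?D u v \<in> addspan {r * s | r s ia ja. r \<in> b_eigen 0 ia \<and> 0 < ia \<and> s \<in> b_eigen k ja \<and> ia + ja = i + j}"
      using eigen[OF u] by (auto simp: hilbert_part_def)
  qed (simp_all add: order3_zero[OF b] order3_add[OF b] eigenpart_zero[OF b] eigenpart_add[OF b] distrib_left)
  then have "?D x y \<in> hilbert_part k (i + j)"
    unfolding hilbert_part_def
    by (intro addspan_map[OF ac_fixed_span[OF x(1)], where F = "\<lambda>x. ?D x y"])
      (auto simp: eigenpart_zero[OF b] eigenpart_add[OF b] distrib_left distrib_right)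
  moreover have "(w + w * w) * eigenpart b k (x * b y) \<in> hilbert_part k (i + j)"
    by (intro hilbert_part_scale shifted H_add w_in H_scale)
  ultimately have "?D x y + (w + w * w) * eigenpart b k (x * b y) \<in> hilbert_part k (i + j)"
    by (rule hilbert_part_add)
  then have "(w + w * w) * (w ^ (2 * k) * eigenpart b k (x * y)) \<in> hilbert_part k (i + j)"
    by (simp flip: minus_one_eq)
  then have "((w + w * w) * w ^ k) * ((w + w * w) * (w ^ (2 * k) * eigenpart b k (x * y))) \<in> hilbert_part k (i + j)"
    by (rule hilbert_part_scale[rotated]) (intro H_add w_in H_scale w_pow_in)
  moreover have "((w + w * w) * w ^ k) * ((w + w * w) * (w ^ (2 * k) * f)) = f" for f
  proof -
    have "w ^ k * w ^ (2 * k) = 1" by (simp add: w_pow_dvd flip: power_add)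
    then have "w ^ k * (w ^ (2 * k) * f) = f" by (simp flip: mult.assoc)
    then show ?thesis by (simp flip: minus_one_eq)
  qed
  ultimately show ?thesis by simp
qed

section \<open>Semi-invariants of high degree\<close>

text \<open>Common eigenvectors of \<open>a\<close> and \<open>c\<close>, labelled with their weight. Since \<open>a b = b a c\<close>, the operator \<open>b\<close> adds the
  second component of the weight to the first.\<close>

definition letters :: "('p \<times> nat \<times> nat) set" where
  "letters = {(l, i, j). l \<in> H 1 \<and> a l = w ^ i * l \<and> c l = w ^ j * l \<and> j < 3}"

definition shift :: "'p \<times> nat \<times> nat \<Rightarrow> 'p \<times> nat \<times> nat" where
  "shift = (\<lambda>(l, i, j). (b l, i + j, j))"

lemma shift_letters: "x \<in> letters \<Longrightarrow> shift x \<in> letters"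
proof -
  assume "x \<in> letters"
  then obtain l i j where x: "x = (l, i, j)" "l \<in> H 1" "a l = w ^ i * l" "c l = w ^ j * l" "j < 3"
    by (auto simp: letters_def)
  have "a (b l) = w ^ (i + j) * b l"
    unfolding comm_ab[OF x(2)] x(4) order3_scale[OF a w_pow_in] x(3) order3_scale[OF b w_pow_in]
    by (simp add: power_add mult_ac)
  moreover have "c (b l) = w ^ j * b l"
    using comm_cb[OF x(2)] by (simp add: x(4) order3_scale[OF b w_pow_in])
  ultimately show ?thesis
    using x order3_in[OF b x(2)] by (simp add: letters_def shift_def)
qed

lemma in_image_mset: "x \<in># X \<Longrightarrow> f x \<in># image_mset f X"
  by simp

lemma form_shift: "form (image_mset shift X) = b (form X)"
  by (induction X) (auto simp: shift_def order3_scalar[OF b one_in] order3_mult[OF b])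

lemma zero_sum_shift: "zero_sum snd X \<Longrightarrow> zero_sum snd (image_mset shift X)"
proof -
  assume X: "zero_sum snd X"
  have "(\<Sum>x\<in>#X. fst (snd (shift x))) = (\<Sum>x\<in>#X. fst (snd x)) + (\<Sum>x\<in>#X. snd (snd x))"
    by (induction X) (auto simp: shift_def)
  moreover have "(\<Sum>x\<in>#X. snd (snd (shift x))) = (\<Sum>x\<in>#X. snd (snd x))"
    by (induction X) (auto simp: shift_def)
  ultimately show ?thesis
    using X by (simp add: zero_sum_def multiset.map_comp comp_def)
qed

lemma
  assumes X: "set_mset X \<subseteq> letters"
  shows letters_form_in: "form X \<in> H (size X)"
    and letters_form_a: "a (form X) = w ^ (\<Sum>x\<in>#X. fst (snd x)) * form X"
    and letters_form_c: "c (form X) = w ^ (\<Sum>x\<in>#X. snd (snd x)) * form X"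
proof -
  have x: "fst x \<in> H 1 \<and> a (fst x) = w ^ fst (snd x) * fst x \<and> c (fst x) = w ^ snd (snd x) * fst x"
    if "x \<in># X" for x
    using that X by (auto simp: letters_def)
  show "form X \<in> H (size X)" by (rule form_in) (use x in blast)
  show "a (form X) = w ^ (\<Sum>x\<in>#X. fst (snd x)) * form X"
    by (rule eigen_form[OF a]) (use x in blast)
  show "c (form X) = w ^ (\<Sum>x\<in>#X. snd (snd x)) * form X"
    by (rule eigen_form[OF c]) (use x in blast)
qed

lemma zero_sum_form: "set_mset X \<subseteq> letters \<Longrightarrow> zero_sum snd X \<Longrightarrow> form X \<in> ac_fixed (size X)"
  using letters_form_in[of X] letters_form_a[of X] letters_form_c[of X]
  by (simp add: ac_fixed_def zero_sum_def w_pow_dvd)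

lemma three_zero_sums:
  assumes k: "\<not> 3 dvd k" and X: "set_mset (U + V + W) \<subseteq> letters"
    and ne: "U \<noteq> {#}" "V \<noteq> {#}" "W \<noteq> {#}" and zs: "zero_sum snd U" "zero_sum snd V" "zero_sum snd W"
  shows "eigenpart b k (form (U + V + W)) \<in> hilbert_part k (size (U + V + W))"
proof -
  have "form U \<in> ac_fixed (size U)" "form V \<in> ac_fixed (size V)" "form W \<in> ac_fixed (size W)"
    by (rule zero_sum_form; use X zs in simp)+
  then show ?thesis
    using three_factors[OF k, of "form U" "size U" "form V" "size V" "form W" "size W"] ne
    by (simp add: nonempty_has_size)
qed

lemma nine_letters:
  assumes k: "\<not> 3 dvd k" and X: "set_mset X \<subseteq> letters" "zero_sum snd X" "9 \<le> size X"
  shows "eigenpart b k (form X) \<in> hilbert_part k (size X)"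
proof -
  obtain U V W where "X = U + V + W" "U \<noteq> {#}" "V \<noteq> {#}" "W \<noteq> {#}"
    "zero_sum snd U" "zero_sum snd V" "zero_sum snd W"
    using zero_sum_split3[OF X(2,3)] by blast
  then show ?thesis using three_zero_sums[OF k, of U V W] X(1) by simp
qed

text \<open>The removal of two letters of opposite weight leaves a zero-sum sequence of length 6, which splits
  once more.\<close>

lemma eight_letters_pair:
  assumes k: "\<not> 3 dvd k" and X: "set_mset X \<subseteq> letters" "zero_sum snd X" "size X = 8"
    and pq: "{#p, q#} \<subseteq># X" "zero_sum snd {#p, q#}"
  shows "eigenpart b k (form X) \<in> hilbert_part k 8"
proof -
  let ?Y = "X - {#p, q#}"
  have "zero_sum snd ?Y" by (rule zero_sum_diff[OF X(2) pq])
  then obtain U V where UV: "?Y = U + V" "U \<noteq> {#}" "3 \<le> size V" "zero_sum snd U" "zero_sum snd V"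
  proof (rule zero_sum_split2)
    show "6 \<le> size ?Y" using pq(1) X(3) by (simp add: size_Diff_submset)
  qed
  have "X = {#p, q#} + U + V"
    using subset_mset.add_diff_inverse[OF pq(1)] UV(1) by (simp add: add.assoc)
  moreover have "V \<noteq> {#}" using UV(3) by auto
  ultimately show ?thesis
    using three_zero_sums[OF k, of "{#p, q#}" U V] UV pq(2) X(1,3) by simp
qed

text \<open>Split the sequence into zero-sum pieces \<open>U\<close> and \<open>V\<close>. Some \<open>p\<close> in \<open>U\<close> and \<open>q\<close> in \<open>V\<close> have opposite \<open>c\<close>-weights:
  otherwise all eight \<open>c\<close>-weights would be equal and nonzero, and eight times a nonzero element of \<open>C\<^sub>3\<close>
  does not vanish. A power of \<open>b\<close> turns the weight of \<open>q\<close> into the negative of that of \<open>p\<close>, and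
  \<open>two_factors\<close> allows \<open>b\<close> to be applied to \<open>V\<close> alone.\<close>

lemma eight_letters:
  assumes k: "\<not> 3 dvd k" and X: "set_mset X \<subseteq> letters" "zero_sum snd X" "size X = 8"
    and c_wt: "\<And>x. x \<in># X \<Longrightarrow> snd (snd x) \<noteq> 0"
  shows "eigenpart b k (form X) \<in> hilbert_part k 8"
proof -
  obtain U V where UV: "X = U + V" "U \<noteq> {#}" "3 \<le> size V" "zero_sum snd U" "zero_sum snd V"
  proof (rule zero_sum_split2[OF X(2)])
    show "6 \<le> size X" by (simp add: X(3))
  qed
  have nz: "\<not> 3 dvd snd (snd x)" if "x \<in># X" for x
  proof -
    have "x \<in> letters" using X(1) that by blast
    then have "snd (snd x) < 3" by (auto simp: letters_def)
    then show ?thesis using c_wt[OF that] by (auto dest: dvd_imp_le)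
  qed
  have "\<exists>p q. p \<in># U \<and> q \<in># V \<and> 3 dvd snd (snd p) + snd (snd q)"
  proof (rule ccontr)
    assume no: "\<not> ?thesis"
    obtain q where q: "q \<in># V" using UV(3) by (cases V) auto
    obtain p where p: "p \<in># U" using UV(2) by (cases U) auto
    have eq: "snd (snd x) mod 3 = snd (snd y) mod 3" if "x \<in># U" "y \<in># V" for x y
    proof (rule same_character)
      show "\<not> 3 dvd snd (snd x) + snd (snd y)" using no that by blast
    qed (use that in \<open>simp_all add: nz UV(1)\<close>)
    have "snd (snd x) mod 3 = snd (snd p) mod 3" if "x \<in># X" for x
      using that eq[of x q] eq[of p q] eq[of p x] p q by (auto simp: UV(1))
    then have "image_mset (\<lambda>x. snd (snd x) mod 3) X = image_mset (\<lambda>x. snd (snd p) mod 3) X"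
      by (intro image_mset_cong)
    then have "(\<Sum>x\<in>#X. snd (snd x)) mod 3 = (\<Sum>x\<in>#X. snd (snd p) mod 3) mod 3"
      by (simp only: sum_mset_mod3[of "\<lambda>x. snd (snd x)" X, symmetric])
    also have "\<dots> = (8 * (snd (snd p) mod 3)) mod 3"
      by (simp only: sum_mset_constant X(3) of_nat_id of_nat_numeral)
    finally have "(\<Sum>x\<in>#X. snd (snd x)) mod 3 = (8 * (snd (snd p) mod 3)) mod 3" .
    moreover have "(\<Sum>x\<in>#X. snd (snd x)) mod 3 = 0"
      using X(2) by (simp add: zero_sum_def)
    ultimately have "(8 * snd (snd p)) mod 3 = 0" by (simp only: mod_mult_right_eq)
    then have "3 dvd snd (snd p)" by presburger
    then show False using nz[of p] p by (simp add: UV(1))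
  qed
  then obtain p q where p: "p \<in># U" and q: "q \<in># V" and pq: "3 dvd snd (snd p) + snd (snd q)" by blast
  have UV_fixed: "form U \<in> ac_fixed (size U)" "form V \<in> ac_fixed (size V)"
    by (rule zero_sum_form; use UV X(1) in simp)+
  have sizes: "0 < size U" "0 < size V" "size U + size V = 8"
    using UV X(3) by (auto simp: nonempty_has_size)
  have pair: "eigenpart b k (form U * form T) \<in> hilbert_part k 8"
    if T: "set_mset T \<subseteq> letters" "zero_sum snd T" "size T = size V" and z: "z \<in># T"
      and sum: "3 dvd fst (snd p) + fst (snd z)" "3 dvd snd (snd p) + snd (snd z)" for T z
  proof -
    have "{#p, z#} \<subseteq># U + T"
      using p z subset_mset.add_mono[of "{#p#}" U "{#z#}" T] by (simp add: add_mset_commute)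
    moreover have "zero_sum snd {#p, z#}" using sum by (simp add: zero_sum_def)
    moreover have "zero_sum snd (U + T)" using zero_sum_union[OF UV(4)] T(2) by blast
    moreover have "size (U + T) = 8" using T(3) sizes(3) by simp
    moreover have "set_mset (U + T) \<subseteq> letters" using T(1) X(1) by (simp add: UV(1))
    ultimately have "eigenpart b k (form (U + T)) \<in> hilbert_part k 8"
      by (intro eight_letters_pair[OF k])
    then show ?thesis by simp
  qed
  have letters_V: "set_mset V \<subseteq> letters" using X(1) by (simp add: UV(1))
  have letters_shift: "set_mset (image_mset shift T) \<subseteq> letters" if "set_mset T \<subseteq> letters" for T
    using that shift_letters by auto
  have shift: "eigenpart b k (form U * f) \<in> hilbert_part k 8"
    if "eigenpart b k (form U * b f) \<in> hilbert_part k 8" "f \<in> ac_fixed (size V)" for f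
    using two_factors[OF k UV_fixed(1) sizes(1) that(2) sizes(2)] that(1) by (simp add: sizes(3))
  obtain l i j where q_eq: "q = (l, i, j)" by (cases q)
  have "\<not> 3 dvd j" using nz[of q] q by (simp add: UV(1) q_eq)
  \<comment> \<open>Applying \<open>b\<close> to the second factor moves the weight of \<open>q\<close> to the negative of that of \<open>p\<close>.\<close>
  then have "3 dvd n \<or> 3 dvd n + j \<or> 3 dvd n + j + j" for n
    by presburger
  from this[of "fst (snd p) + i"]
  have "3 dvd fst (snd p) + i \<or> 3 dvd fst (snd p) + (i + j) \<or> 3 dvd fst (snd p) + (i + j + j)"
    by (simp only: add.assoc)
  then have "eigenpart b k (form U * form V) \<in> hilbert_part k 8"
  proof (elim disjE)
    assume "3 dvd fst (snd p) + i"
    then show ?thesis using pair[OF letters_V UV(5) _ q] pq by (simp add: q_eq)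
  next
    assume *: "3 dvd fst (snd p) + (i + j)"
    have "shift q \<in># image_mset shift V" using q by (rule in_image_mset)
    moreover have "3 dvd fst (snd p) + fst (snd (shift q))" "3 dvd snd (snd p) + snd (snd (shift q))"
      using pq * by (simp_all only: q_eq shift_def prod.case fst_conv snd_conv)
    ultimately have "eigenpart b k (form U * form (image_mset shift V)) \<in> hilbert_part k 8"
      by (rule pair[OF letters_shift[OF letters_V] zero_sum_shift[OF UV(5)] size_image_mset])
    then show ?thesis unfolding form_shift by (rule shift[OF _ UV_fixed(2)])
  next
    assume *: "3 dvd fst (snd p) + (i + j + j)"
    have "shift (shift q) \<in># image_mset shift (image_mset shift V)" using q by (intro in_image_mset)
    moreover have "3 dvd fst (snd p) + fst (snd (shift (shift q)))" "3 dvd snd (snd p) + snd (snd (shift (shift q)))"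
      using pq * by (simp_all only: q_eq shift_def prod.case fst_conv snd_conv)
    ultimately have "eigenpart b k (form U * form (image_mset shift (image_mset shift V))) \<in> hilbert_part k 8"
      by (rule pair[OF letters_shift[OF letters_shift[OF letters_V]] zero_sum_shift[OF zero_sum_shift[OF UV(5)]]
            HOL.trans[OF size_image_mset size_image_mset]])
    then have "eigenpart b k (form U * b (b (form V))) \<in> hilbert_part k 8"
      by (simp only: form_shift)
    then show ?thesis by (rule shift[OF shift[OF _ ac_fixed_b[OF UV_fixed(2)]] UV_fixed(2)])
  qed
  then show ?thesis by (simp add: UV(1))
qed

lemma c_type_letters:
  assumes "f \<in> c_type c N"
  shows "f \<in> addspan {form X | X. set_mset X \<subseteq> letters \<and> image_mset (\<lambda>x. snd (snd x)) X = N}"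
  using assms unfolding c_type_def
proof (rule addspan_subset)
  let ?S = "\<lambda>N. {form X | X. set_mset X \<subseteq> letters \<and> image_mset (\<lambda>x. snd (snd x)) X = N}"
  have "form Y \<in> addspan (?S (image_mset snd Y))" if "set_mset Y \<subseteq> c_letters c" for Y
    using that
  proof (induction Y)
    case empty
    show ?case by (rule addspan_base) (simp add: exI[of _ "{#}"])
  next
    case (add y Y)
    obtain l j where y: "y = (l, j)" "l \<in> H 1" "c l = w ^ j * l" "j < 3"
      using add.prems by (auto simp: c_letters_def)
    have "(eigenpart a i l, i, j) \<in> letters" for i
    proof -
      have "c (eigenpart a i l) = eigenpart a i (c l)"
        by (rule eigenpart_commute[OF a c])
          (simp_all add: comm_ca[OF y(2)] comm_ca[OF order3_in[OF a y(2)]])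
      then have "c (eigenpart a i l) = w ^ j * eigenpart a i l"
        by (simp add: y(3) eigenpart_scale[OF a w_pow_in])
      then show ?thesis
        using eigenpart_in[OF a y(2)] eigenpart_eigen[OF a y(2)] y(4) by (simp add: letters_def)
    qed
    then have "l \<in> addspan {l. \<exists>i. (l, i, j) \<in> letters}"
      by (intro span_of_eigenparts[OF a]) blast
    then have "l * form Y \<in> addspan (?S (image_mset snd (add_mset y Y)))"
    proof (rule addspan_mult[OF _ add.IH])
      show "set_mset Y \<subseteq> c_letters c" using add.prems by simp
      fix x z assume "x \<in> {l. \<exists>i. (l, i, j) \<in> letters}" "z \<in> ?S (image_mset snd Y)"
      then obtain i X where "(x, i, j) \<in> letters" "z = form X" "set_mset X \<subseteq> letters"
        "image_mset (\<lambda>x. snd (snd x)) X = image_mset snd Y" by blast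
      then show "x * z \<in> addspan (?S (image_mset snd (add_mset y Y)))"
        by (intro addspan_base CollectI exI[of _ "add_mset (x, i, j) X"]) (simp add: y(1))
    qed
    then show ?case by (simp add: y(1))
  qed
  then show "x \<in> addspan (?S N)"
    if "x \<in> {form Y | Y. set_mset Y \<subseteq> c_letters c \<and> image_mset snd Y = N}" for x
    using that by blast
qed

text \<open>The multisets of \<open>c\<close>-weights which \<open>nine_letters\<close> and \<open>eight_letters\<close> cover.\<close>

definition long_type :: "nat multiset \<Rightarrow> bool" where
  "long_type N \<longleftrightarrow> 3 dvd (\<Sum>j\<in>#N. j) \<and> (9 \<le> size N \<or> size N = 8 \<and> 0 \<notin># N)"

text \<open>The projection to the \<open>a\<close>-invariants followed by that to the character \<open>k\<close> fixes \<open>f\<close>, so it may be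
  applied to a spanning set of products of letters, where it leaves only zero-sum sequences.\<close>

lemma semi_invariant_in_hilbert_part:
  assumes k: "\<not> 3 dvd k" and f: "f \<in> c_type c N" "a f = f" "b f = w ^ k * f" and N: "long_type N"
  shows "f \<in> hilbert_part k (size N)"
proof -
  have "eigenpart b k (eigenpart a 0 f) \<in> hilbert_part k (size N)"
    unfolding hilbert_part_def
  proof (rule addspan_map[OF c_type_letters[OF f(1)]])
    fix x assume "x \<in> {form X | X. set_mset X \<subseteq> letters \<and> image_mset (\<lambda>x. snd (snd x)) X = N}"
    then obtain X where X: "x = form X" "set_mset X \<subseteq> letters" "image_mset (\<lambda>x. snd (snd x)) X = N" by blast
    have size: "size N = size X" by (simp flip: X(3))
    have "eigenpart b k (eigenpart a 0 x) \<in> hilbert_part k (size N)"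
    proof (cases "3 dvd (\<Sum>x\<in>#X. fst (snd x))")
      case False
      then have "eigenpart a 0 x = 0"
        using eigenpart_of_eigen[OF a letters_form_a[OF X(2)], of 0] by (simp add: X(1))
      then show ?thesis by (simp add: eigenpart_zero[OF b] hilbert_part_zero)
    next
      case True
      then have "eigenpart a 0 x = form X"
        using eigenpart_of_eigen[OF a letters_form_a[OF X(2)], of 0] by (simp add: X(1))
      moreover have "zero_sum snd X"
        using True N by (simp add: zero_sum_def long_type_def flip: X(3))
      moreover have "snd (snd x) \<noteq> 0" if "0 \<notin># N" "x \<in># X" for x
        using that X(3) by force
      ultimately show ?thesis
        using nine_letters[OF k X(2)] eight_letters[OF k X(2)] N by (auto simp: long_type_def size)
    qed
    then show "eigenpart b k (eigenpart a 0 x)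
        \<in> addspan {r * s | r s i j. r \<in> b_eigen 0 i \<and> 0 < i \<and> s \<in> b_eigen k j \<and> i + j = size N}"
      by (simp add: hilbert_part_def)
  qed (simp_all add: eigenpart_zero[OF a] eigenpart_zero[OF b] eigenpart_add[OF a] eigenpart_add[OF b])
  moreover have "3 dvd 2 * k + k" by simp
  ultimately show ?thesis
    using eigenpart_of_eigen[OF a, of f 0 0] eigenpart_of_eigen[OF b f(3), of k] f(2) by simp
qed

text \<open>Every factor \<open>s\<close> in \<open>h = \<Sum> r s\<close> has the character of \<open>h\<close>, so \<open>g s\<close> is again invariant.\<close>

lemma twisted_product:
  assumes k: "\<not> 3 dvd k" and h: "h \<in> c_type c N" "a h = h" "b h = w ^ k * h" and N: "long_type N"
    and g: "g \<in> H d" "0 < d" "a g = g" "c g = g" "b g = w ^ q * g" and q: "3 dvd q + k"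
  shows "g * h \<in> decomposables a b c (d + size N)"
  unfolding decomposables_def
proof (rule addspan_map[OF semi_invariant_in_hilbert_part[OF k h N, unfolded hilbert_part_def]])
  fix x assume "x \<in> {r * s | r s i j. r \<in> b_eigen 0 i \<and> 0 < i \<and> s \<in> b_eigen k j \<and> i + j = size N}"
  then obtain r s i j where x: "x = r * s" "r \<in> b_eigen 0 i" "0 < i" "s \<in> b_eigen k j" "i + j = size N" by blast
  have "g \<in> b_eigen q d" using g by (simp add: b_eigen_def ac_fixed_def)
  then have "g * s \<in> b_eigen (q + k) (d + j)" by (rule b_eigen_mult) (rule x(4))
  moreover have "b_eigen (q + k) (d + j) = b_eigen 0 (d + j)" using q by (intro b_eigen_cong) simp
  ultimately have "r \<in> fixed3 a b c i \<and> 0 < i \<and> g * s \<in> fixed3 a b c (d + j) \<and> 0 < d + j \<and> i + (d + j) = d + size N"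
    using x g(2) by (simp add: fixed3_eq)
  moreover have "g * x = r * (g * s)" by (simp add: x(1) mult.left_commute)
  ultimately show "g * x \<in> addspan {r * s | r s i j.
      r \<in> fixed3 a b c i \<and> 0 < i \<and> s \<in> fixed3 a b c j \<and> 0 < j \<and> i + j = d + size N}"
    by (intro addspan_base) blast
qed (simp_all add: distrib_left)

section \<open>Decomposing invariants of degree at least 10\<close>

lemma comm_ba:
  assumes "f \<in> H d"
  shows "b (a f) = a (b (c (c f)))"
proof -
  have "c (c f) \<in> H d" using assms by (intro order3_in[OF c])
  from comm_ab[OF this] show ?thesis by (simp add: order3_cube[OF c assms])
qed

lemma order3_comp:
  assumes g: "order3 g" and h: "order3 h" and cube: "\<And>d f. f \<in> H d \<Longrightarrow> g (h (g (h (g (h f))))) = f"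
  shows "order3 (\<lambda>f. g (h f))"
  unfolding order3_def
  using cube order3_add[OF g] order3_add[OF h] order3_mult[OF g] order3_mult[OF h]
    order3_scalar[OF g] order3_scalar[OF h] order3_in[OF g] order3_in[OF h] by simp

lemma order3_aa: "order3 (\<lambda>f. a (a f))"
  by (rule order3_comp[OF a a]) (simp add: order3_cube[OF a])

text \<open>The group of order 27 generated by \<open>a\<close>, \<open>b\<close>, \<open>c\<close> has exponent 3.\<close>

lemma
  shows order3_ab: "order3 (\<lambda>f. a (b f))"
    and order3_abb: "order3 (\<lambda>f. a (b (b f)))"
proof -
  have cubes: "a (b (a (b (a (b f))))) = f \<and> a (b (b (a (b (b (a (b (b f)))))))) = f" if f: "f \<in> H d" for f d
  proof -
  note [simp] = order3_in[OF a] order3_in[OF b] order3_in[OF c]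
    have rules: "a (b x) = b (a (c x))" "c (a x) = a (c x)" "c (b x) = b (c x)"
      "a (a (a x)) = x" "b (b (b x)) = x" "c (c (c x)) = x" if "x \<in> H d" for x
      using that by (rule comm_ab comm_ca comm_cb order3_cube[OF a] order3_cube[OF b] order3_cube[OF c])+
    show ?thesis by (simp add: rules f)
  qed
  show "order3 (\<lambda>f. a (b f))"
    by (rule order3_comp[OF a b]) (use cubes in blast)
  have bb: "order3 (\<lambda>f. b (b f))"
    by (rule order3_comp[OF b b]) (simp add: order3_cube[OF b])
  show "order3 (\<lambda>f. a (b (b f)))"
    by (rule order3_comp[OF a bb]) (use cubes in blast)
qed

text \<open>The statements above concern characters that are trivial on the first generator. The pairs
  \<open>(a, b)\<close>, \<open>(b, a\<^sup>2)\<close>, \<open>(a b\<^sup>2, b)\<close> and \<open>(a b, b)\<close> all have commutator \<open>c\<close>, and every character of the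
  group is trivial on the first member of one of them.\<close>

lemma action_b_aa: "heisenberg_action H w t b (\<lambda>f. a (a f)) c"
proof unfold_locales
  fix f d assume f: "f \<in> H d"
  note [simp] = order3_in[OF a] order3_in[OF b] order3_in[OF c]
  have ba: "b (a x) = a (b (c (c x)))" if "x \<in> H d" for x using that by (rule comm_ba)
  have ca: "c (a x) = a (c x)" if "x \<in> H d" for x using that by (rule comm_ca)
  have ccc: "c (c (c x)) = x" if "x \<in> H d" for x using that by (rule order3_cube[OF c])
  show "b (a (a f)) = a (a (b (c f)))" by (simp add: ba ca ccc f)
  show "c (a (a f)) = a (a (c f))" by (simp add: ca f)
qed (rule b order3_aa c comm_cb)+

lemma action_abb_b: "heisenberg_action H w t (\<lambda>f. a (b (b f))) b c"
proof unfold_locales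
  fix f d assume f: "f \<in> H d"
  note [simp] = order3_in[OF a] order3_in[OF b] order3_in[OF c]
  have rules: "a (b x) = b (a (c x))" "c (a x) = a (c x)" "c (b x) = b (c x)" if "x \<in> H d" for x
    using that by (rule comm_ab comm_ca comm_cb)+
  show "a (b (b (b f))) = b (a (b (b (c f))))" "c (a (b (b f))) = a (b (b (c f)))"
    by (simp_all add: rules f)
qed (rule b order3_abb c comm_cb)+

lemma action_ab_b: "heisenberg_action H w t (\<lambda>f. a (b f)) b c"
proof unfold_locales
  fix f d assume f: "f \<in> H d"
  note [simp] = order3_in[OF a] order3_in[OF b] order3_in[OF c]
  have rules: "a (b x) = b (a (c x))" "c (a x) = a (c x)" "c (b x) = b (c x)" if "x \<in> H d" for x
    using that by (rule comm_ab comm_ca comm_cb)+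
  show "a (b (b f)) = b (a (b (c f)))" "c (a (b f)) = a (b (c f))"
    by (simp_all add: rules f)
qed (rule b order3_ab c comm_cb)+

lemma c_type_fixed:
  assumes "f \<in> c_type c N" and N: "long_type N"
  shows "c f = f"
proof -
  have "c x = x" if x: "x \<in> {form Y | Y. set_mset Y \<subseteq> c_letters c \<and> image_mset snd Y = N}" for x
  proof -
    obtain Y where Y: "x = form Y" "set_mset Y \<subseteq> c_letters c" "image_mset snd Y = N" using x by blast
    have "c (form Y) = w ^ (\<Sum>y\<in>#Y. snd y) * form Y"
    proof (rule eigen_form[OF c])
      fix y assume "y \<in># Y"
      then have "y \<in> c_letters c" using Y(2) by blast
      then show "c (fst y) = w ^ snd y * fst y" by (auto simp: c_letters_def)
    qed
    then show ?thesis using N by (simp add: Y long_type_def w_pow_dvd)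
  qed
  then have "f \<in> {x. c x = x}"
    by (intro addspan_closed[OF assms(1)[unfolded c_type_def]])
      (auto simp: order3_zero[OF c] order3_add[OF c])
  then show ?thesis by simp
qed

text \<open>Depending on the character \<open>(r, s)\<close> of \<open>h\<close>, one of the four pairs of generators reduces the claim to
  \<open>twisted_product\<close>, unless \<open>g\<close> and \<open>h\<close> are themselves invariant.\<close>

lemma eigen_product_decomposable:
  assumes h: "h \<in> c_type c N" "a h = w ^ r * h" "b h = w ^ s * h" and N: "long_type N"
    and g: "g \<in> H d" "0 < d" "c g = g" "a g = w ^ p * g" "b g = w ^ q * g"
    and pr: "3 dvd p + r" and qs: "3 dvd q + s"
  shows "g * h \<in> decomposables a b c (d + size N)"
proof -
  have aw: "a (w ^ n * x) = w ^ n * a x" and bw: "b (w ^ n * x) = w ^ n * b x" for n x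
    by (rule order3_scale[OF a w_pow_in], rule order3_scale[OF b w_pow_in])
  have hH: "h \<in> H (size N)" by (rule c_type_in[OF h(1)])
  have ch: "c h = h" by (rule c_type_fixed[OF h(1) N])
  have collapse: "w ^ n * (w ^ m * x) = x" if "3 dvd n + m" for n m x
    using w_pow_dvd[OF that] by (simp add: power_add flip: mult.assoc)
  consider "3 dvd r" "3 dvd s" | "3 dvd r" "\<not> 3 dvd s" | "\<not> 3 dvd r" "3 dvd s"
    | "\<not> 3 dvd r" "\<not> 3 dvd s" "3 dvd r + s" | "\<not> 3 dvd r" "\<not> 3 dvd s" "3 dvd r + (s + s)"
  proof -
    have "3 dvd r + s \<or> 3 dvd r + (s + s)" if "\<not> 3 dvd r" "\<not> 3 dvd s" using that by presburger
    then show ?thesis using that by blast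
  qed
  then show ?thesis
  proof cases
    case 1
    then have "3 dvd p" "3 dvd q" using pr qs by (simp_all add: dvd_add_left_iff)
    then have "g \<in> fixed3 a b c d" "h \<in> fixed3 a b c (size N)"
      using g h hH ch 1 by (simp_all add: fixed3_def w_pow_dvd)
    moreover have "0 < size N" using N by (auto simp: long_type_def)
    ultimately show ?thesis
      unfolding decomposables_def using g(2) by (intro addspan_base) blast
  next
    case 2
    then have "3 dvd p" using pr by (simp add: dvd_add_left_iff)
    then have "a g = g" using g(4) by (simp add: w_pow_dvd)
    moreover have "a h = h" using h(2) 2 by (simp add: w_pow_dvd)
    ultimately show ?thesis
      using twisted_product[OF 2(2) h(1) _ h(3) N g(1,2) _ g(3,5) qs] by simp
  next
    case 3
    have "3 dvd q" using 3 qs by (simp add: dvd_add_left_iff)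
    then have "b g = g" "b h = h" using g(5) h(3) 3 by (simp_all add: w_pow_dvd)
    moreover have "a (a h) = w ^ (r + r) * h" "a (a g) = w ^ (p + p) * g"
      by (simp_all add: g(4) h(2) aw power_add mult.assoc)
    moreover have "\<not> 3 dvd r + r" "3 dvd (p + p) + (r + r)"
      using 3(1) pr by presburger+
    ultimately have "g * h \<in> decomposables b (\<lambda>f. a (a f)) c (d + size N)"
      using g h(1) N by (intro heisenberg_action.twisted_product[OF action_b_aa, of "r + r" h N g d "p + p"])
    then show ?thesis
    proof (rule decomposables_mono[rotated])
      show "fixed3 b (\<lambda>f. a (a f)) c i \<subseteq> fixed3 a b c i" for i
      proof
        fix f assume "f \<in> fixed3 b (\<lambda>f. a (a f)) c i"
        then have f: "f \<in> H i" "b f = f" "a (a f) = f" "c f = f" by (simp_all add: fixed3_def)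
        then have "a f = f" using order3_cube[OF a f(1)] by simp
        then show "f \<in> fixed3 a b c i" using f by (simp add: fixed3_def)
      qed
    qed
  next
    case 4
    have pq: "3 dvd p + q" using 4(3) pr qs by presburger
    have "a (b h) = h" "a (b g) = g"
      using 4(3) pq by (simp_all add: g(4,5) h(2,3) aw collapse add.commute)
    then have "g * h \<in> decomposables (\<lambda>f. a (b f)) b c (d + size N)"
      using g h N 4 qs by (intro heisenberg_action.twisted_product[OF action_ab_b, of s h N g d q])
    then show ?thesis
      by (rule decomposables_mono[rotated]) (auto simp: fixed3_def)
  next
    case 5
    have "3 dvd p + (q + q)" using 5(3) pr qs by presburger
    then have "a (b (b h)) = h" "a (b (b g)) = g"
      using 5(3) collapse[of "r" "s + s" h] collapse[of p "q + q" g]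
      by (simp_all only: g(4,5) h(2,3) aw bw) (simp_all add: power_add mult_ac)
    then have "g * h \<in> decomposables (\<lambda>f. a (b (b f))) b c (d + size N)"
      using g h N 5 qs by (intro heisenberg_action.twisted_product[OF action_abb_b, of s h N g d q])
    then show ?thesis
      by (rule decomposables_mono[rotated]) (auto simp: fixed3_def)
  qed
qed

text \<open>Remove a single factor fixed by \<open>c\<close> if there is one, or else two factors of opposite \<open>c\<close>-weight. If all
  \<open>c\<close>-weights agree and are nonzero, then the length is divisible by 3, hence at least 12, and any three
  factors will do.\<close>

lemma long_type_split:
  assumes Y: "\<And>y. y \<in># Y \<Longrightarrow> snd y < 3" and sum: "3 dvd (\<Sum>y\<in>#Y. snd y)" and size: "10 \<le> size Y"
  obtains Z where "Z \<subseteq># Y" "Z \<noteq> {#}" "3 dvd (\<Sum>y\<in>#Z. snd y)" "long_type (image_mset snd (Y - Z))"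
proof -
  note result = that
  have finish: thesis
    if Z: "Z \<subseteq># Y" "Z \<noteq> {#}" "3 dvd (\<Sum>y\<in>#Z. snd y)"
      and long: "9 \<le> size (Y - Z) \<or> size (Y - Z) = 8 \<and> (\<forall>y\<in>#Y. snd y \<noteq> 0)" for Z
  proof (rule result[OF Z])
    have "(\<Sum>y\<in>#Y. snd y) = (\<Sum>y\<in>#Z. snd y) + (\<Sum>y\<in>#Y - Z. snd y)"
      using arg_cong[OF subset_mset.add_diff_inverse[OF Z(1)], of "\<lambda>X. \<Sum>y\<in>#X. snd y"] by simp
    then have "3 dvd (\<Sum>y\<in>#Y - Z. snd y)"
      using sum Z(3) by (simp add: dvd_add_right_iff)
    then show "long_type (image_mset snd (Y - Z))"
      using long in_diffD[of _ Y Z] by (fastforce simp: long_type_def)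
  qed
  show thesis
  proof (cases "\<exists>y\<in>#Y. snd y = 0")
    case True
    then obtain y where "y \<in># Y" "snd y = 0" by blast
    moreover have "9 \<le> size (Y - {#y#})" using size calculation(1) by (simp add: size_Diff_singleton)
    ultimately show thesis by (intro finish[of "{#y#}"]) simp_all
  next
    case False
    then have nz: "snd y = 1 \<or> snd y = 2" if "y \<in># Y" for y
      using Y[OF that] that by (auto simp: less_Suc_eq numeral_3_eq_3)
    show thesis
    proof (cases "\<exists>y\<in>#Y. \<exists>z\<in>#Y. snd y \<noteq> snd z")
      case True
      then obtain y z where yz: "y \<in># Y" "z \<in># Y" "snd y \<noteq> snd z" by blast
      then have "{#y, z#} \<subseteq># Y" by (auto simp: insert_subset_eq_iff in_diff_count)
      moreover have "snd y + snd z = 3" using nz[OF yz(1)] nz[OF yz(2)] yz(3) by auto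
      ultimately show thesis
        using size False by (intro finish[of "{#y, z#}"]) (auto simp: size_Diff_submset)
    next
      case same: False
      obtain y where y: "y \<in># Y" using size by (cases Y) auto
      have const: "(\<Sum>y\<in>#Z. snd y) = size Z * snd y" if "Z \<subseteq># Y" for Z
      proof -
        have "image_mset snd Z = image_mset (\<lambda>_. snd y) Z"
          using same y mset_subset_eqD[OF that] by (intro image_mset_cong) blast
        then show ?thesis by (simp add: sum_mset_constant)
      qed
      have "3 dvd size Y * snd y" using sum const[of Y] by simp
      then have "3 dvd size Y" using nz[OF y] by auto presburger
      then have "12 \<le> size Y" using size by presburger
      moreover obtain Z where Z: "Z \<subseteq># Y" "size Z = 3"
      proof -
        obtain y1 Y1 where 1: "Y = add_mset y1 Y1" using size by (cases Y) auto
        obtain y2 Y2 where 2: "Y1 = add_mset y2 Y2" using size 1 by (cases Y1) auto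
        obtain y3 Y3 where 3: "Y2 = add_mset y3 Y3" using size 1 2 by (cases Y2) auto
        show thesis by (rule that[of "{#y1, y2, y3#}"]) (simp_all add: 1 2 3)
      qed
      ultimately show thesis
        using const[OF Z(1)] Z by (intro finish[of Z]) (auto simp: size_Diff_submset)
    qed
  qed
qed

text \<open>On elements fixed by \<open>c\<close> the operators \<open>a\<close> and \<open>b\<close> commute, so their eigenprojections can be composed.\<close>

lemma joint_eigenpart:
  assumes u: "u \<in> H n" "c u = u"
  shows "c (eigenpart a p (eigenpart b q u)) = eigenpart a p (eigenpart b q u)"
    and "a (eigenpart a p (eigenpart b q u)) = w ^ p * eigenpart a p (eigenpart b q u)"
    and "b (eigenpart a p (eigenpart b q u)) = w ^ q * eigenpart a p (eigenpart b q u)"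
proof -
  let ?u = "eigenpart b q u"
  have v: "?u \<in> H n" by (rule eigenpart_in[OF b u(1)])
  have "c ?u = eigenpart b q (c u)"
    by (rule eigenpart_commute[OF b c]) (simp_all add: comm_cb[OF u(1)] comm_cb[OF order3_in[OF b u(1)]])
  then have cv: "c ?u = ?u" by (simp add: u(2))
  have cav: "c (a ?u) = a ?u" using comm_ca[OF v] cv by simp
  have "c (eigenpart a p ?u) = eigenpart a p (c ?u)"
    by (rule eigenpart_commute[OF a c]) (simp_all add: comm_ca[OF v] comm_ca[OF order3_in[OF a v]])
  moreover have "b (eigenpart a p ?u) = eigenpart a p (b ?u)"
  proof (rule eigenpart_commute[OF a b])
    show "b (a ?u) = a (b ?u)" using comm_ab[OF v] cv by simp
    then show "b (a (a ?u)) = a (a (b ?u))"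
      using comm_ab[OF order3_in[OF a v]] cav by simp
  qed
  moreover have "eigenpart a p (b ?u) = w ^ q * eigenpart a p ?u"
    by (simp add: eigenpart_eigen[OF b u(1)] eigenpart_scale[OF a w_pow_in])
  ultimately show "c (eigenpart a p ?u) = eigenpart a p ?u" "b (eigenpart a p ?u) = w ^ q * eigenpart a p ?u"
    using cv by simp_all
  show "a (eigenpart a p ?u) = w ^ p * eigenpart a p ?u" by (rule eigenpart_eigen[OF a v])
qed

definition reynolds :: "'p \<Rightarrow> 'p" where
  "reynolds f = eigenpart a 0 (eigenpart b 0 (eigenpart c 0 f))"

lemma reynolds_add: "reynolds (f + g) = reynolds f + reynolds g"
  by (simp add: reynolds_def eigenpart_add[OF a] eigenpart_add[OF b] eigenpart_add[OF c])

lemma reynolds_zero: "reynolds 0 = 0"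
  by (simp add: reynolds_def eigenpart_zero[OF a] eigenpart_zero[OF b] eigenpart_zero[OF c])

lemma reynolds_scale: "s \<in> H 0 \<Longrightarrow> reynolds (s * f) = s * reynolds f"
  by (simp add: reynolds_def eigenpart_scale[OF a] eigenpart_scale[OF b] eigenpart_scale[OF c])

lemma reynolds_of_fixed: "f \<in> fixed3 a b c d \<Longrightarrow> reynolds f = f"
  using eigenpart_of_eigen[OF a, of f 0 0] eigenpart_of_eigen[OF b, of f 0 0]
    eigenpart_of_eigen[OF c, of f 0 0] by (simp add: reynolds_def fixed3_def)

lemma reynolds_fixed:
  assumes "f \<in> H d"
  shows "reynolds f \<in> fixed3 a b c d"
  using joint_eigenpart[OF eigenpart_in[OF c assms], of 0 0 0] eigenpart_eigen[OF c assms, of 0]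
    eigenpart_in[OF a eigenpart_in[OF b eigenpart_in[OF c assms]]]
  by (simp add: reynolds_def fixed3_def)

text \<open>The Reynolds operator fixes \<open>f\<close>, so it may be applied to products of eigenvectors of \<open>c\<close>. Once both parts
  from \<open>long_type_split\<close> are expanded into semi-invariants, it acts on each product as the identity or as zero.\<close>

theorem invariant_decomposable:
  assumes f: "f \<in> fixed3 a b c d" and d: "10 \<le> d"
  shows "f \<in> decomposables a b c d"
proof -
  obtain d' where d': "d = Suc d'" using d by (cases d) auto
  have "f \<in> addspan {form Y | Y. set_mset Y \<subseteq> c_letters c \<and> size Y = d}"
    using f homogeneous_in_span[of f d' c] c by (simp add: d' fixed3_def)
  then have "reynolds f \<in> decomposables a b c d"
    unfolding decomposables_def
  proof (rule addspan_map[where F = reynolds, OF _ reynolds_zero reynolds_add])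
    let ?D = "{r * s | r s i j. r \<in> fixed3 a b c i \<and> 0 < i \<and> s \<in> fixed3 a b c j \<and> 0 < j \<and> i + j = d}"
    fix x assume "x \<in> {form Y | Y. set_mset Y \<subseteq> c_letters c \<and> size Y = d}"
    then obtain Y where Y: "x = form Y" "set_mset Y \<subseteq> c_letters c" "size Y = d" by blast
    have letter: "fst y \<in> H 1 \<and> c (fst y) = w ^ snd y * fst y \<and> snd y < 3" if "y \<in># Y" for y
    proof -
      have "y \<in> c_letters c" using that Y(2) by blast
      then show ?thesis by (auto simp: c_letters_def)
    qed
    have c_form: "c (form Z) = w ^ (\<Sum>y\<in>#Z. snd y) * form Z" if "Z \<subseteq># Y" for Z
      by (rule eigen_form[OF c]) (use letter mset_subset_eqD[OF that] in blast)
    show "reynolds x \<in> addspan ?D"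
    proof (cases "3 dvd (\<Sum>y\<in>#Y. snd y)")
      case False
      then have "eigenpart c 0 x = 0"
        using eigenpart_of_eigen[OF c c_form[of Y], of 0] by (simp add: Y(1))
      then show ?thesis
        by (simp add: reynolds_def eigenpart_zero[OF a] eigenpart_zero[OF b] addspan_zero)
    next
      case True
      have "snd y < 3" if "y \<in># Y" for y using letter[OF that] by blast
      from long_type_split[OF this True] obtain Z where Z: "Z \<subseteq># Y" "Z \<noteq> {#}" "3 dvd (\<Sum>y\<in>#Z. snd y)"
        and long: "long_type (image_mset snd (Y - Z))" using d Y(3) by blast
      define N where "N = image_mset snd (Y - Z)"
      have N: "N \<noteq> {#}" "long_type N" using long by (auto simp: N_def long_type_def)
      have size_N: "size Z + size N = d"
        using Z(1) Y(3) size_mset_mono[OF Z(1)] by (simp add: N_def size_Diff_submset)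
      let ?G = "{g \<in> H (size Z). c g = g \<and> (\<exists>p q. a g = w ^ p * g \<and> b g = w ^ q * g)}"
      let ?K = "{h \<in> c_type c N. \<exists>r s. a h = w ^ r * h \<and> b h = w ^ s * h}"
      have g: "form Z \<in> addspan ?G"
      proof -
        have Z_in: "form Z \<in> H (size Z)"
          by (rule form_in) (use letter mset_subset_eqD[OF Z(1)] in blast)
        have "c (form Z) = form Z" using c_form[OF Z(1)] Z(3) by (simp add: w_pow_dvd)
        then have "eigenpart a p (eigenpart b q (form Z)) \<in> ?G" for p q
          using joint_eigenpart[OF Z_in] eigenpart_in[OF a eigenpart_in[OF b Z_in]] by blast
        then have "eigenpart b q (form Z) \<in> addspan ?G" for q
          by (rule span_of_eigenparts[OF a])
        then show ?thesis
          using span_of_eigenparts[OF b, of _ "addspan ?G"] by (simp only: addspan_addspan)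
      qed
      have h: "form (Y - Z) \<in> addspan ?K"
      proof -
        have "set_mset (Y - Z) \<subseteq> c_letters c" using Y(2) by (auto dest: in_diffD)
        then have type: "form (Y - Z) \<in> c_type c N"
          unfolding c_type_def N_def by (intro addspan_base) blast
        have "c (form (Y - Z)) = form (Y - Z)"
          using c_form[OF diff_subset_eq_self] long by (simp add: long_type_def w_pow_dvd)
        moreover have "eigenpart b q x \<in> c_type c N" "eigenpart a q x \<in> c_type c N" if "x \<in> c_type c N" for q x
        proof -
          show "eigenpart b q x \<in> c_type c N"
            by (rule c_type_eigenpart[OF b _ that N(1) c]) (rule comm_cb)
          show "eigenpart a q x \<in> c_type c N"
            by (rule c_type_eigenpart[OF a _ that N(1) c]) (rule comm_ca)
        qed
        ultimately have "eigenpart a p (eigenpart b q (form (Y - Z))) \<in> ?K" for p q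
          using joint_eigenpart[OF c_type_in[OF type]] type by blast
        then have "eigenpart b q (form (Y - Z)) \<in> addspan ?K" for q
          by (rule span_of_eigenparts[OF a])
        then show ?thesis
          using span_of_eigenparts[OF b, of _ "addspan ?K"] by (simp only: addspan_addspan)
      qed
      have "form Z * form (Y - Z) = x"
        using arg_cong[OF subset_mset.add_diff_inverse[OF Z(1)], of form] by (simp add: Y(1))
      moreover have "form Z * form (Y - Z) \<in> addspan {g * h | g h. g \<in> ?G \<and> h \<in> ?K}"
        by (rule addspan_mult[OF g h], rule addspan_base) blast
      ultimately have "x \<in> addspan {g * h | g h. g \<in> ?G \<and> h \<in> ?K}" by simp
      then show ?thesis
      proof (rule addspan_map[where F = reynolds, OF _ reynolds_zero reynolds_add])
        fix y assume "y \<in> {g * h | g h. g \<in> ?G \<and> h \<in> ?K}"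
        then obtain g h p q r s where y: "y = g * h" and g: "g \<in> H (size Z)" "c g = g" "a g = w ^ p * g" "b g = w ^ q * g"
          and h: "h \<in> c_type c N" "a h = w ^ r * h" "b h = w ^ s * h" by blast
        have a_y: "a y = w ^ (p + r) * y" and b_y: "b y = w ^ (q + s) * y"
          by (simp_all add: y order3_mult[OF a] order3_mult[OF b] g h power_add mult_ac)
        have c_y: "c y = w ^ 0 * y"
          by (simp add: y order3_mult[OF c] g c_type_fixed[OF h(1) N(2)])
        show "reynolds y \<in> addspan ?D"
        proof (cases "3 dvd p + r \<and> 3 dvd q + s")
          case True
          then have "y \<in> addspan ?D"
            using eigen_product_decomposable[OF h N(2) g(1) _ g(2-4)] Z(2) size_N
            by (simp add: y decomposables_def nonempty_has_size)
          then show ?thesis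
            using True eigenpart_of_eigen[OF c c_y, of 0] eigenpart_of_eigen[OF b b_y, of 0]
              eigenpart_of_eigen[OF a a_y, of 0] by (simp add: reynolds_def)
        next
          case False
          then have "reynolds y = 0"
            using eigenpart_of_eigen[OF c c_y, of 0] eigenpart_of_eigen[OF b b_y, of 0]
              eigenpart_of_eigen[OF a a_y, of 0] by (auto simp: reynolds_def eigenpart_zero[OF a])
          then show ?thesis by (simp add: addspan_zero)
        qed
      qed
    qed
  qed
  then show ?thesis by (simp only: reynolds_of_fixed[OF f])
qed

end

section \<open>Substitution in polynomials\<close>

abbreviation mkeys :: "('i \<Rightarrow>\<^sub>0 'a::zero) \<Rightarrow> 'i set" where "mkeys \<equiv> Poly_Mapping.keys"
abbreviation mcoeff :: "('i \<Rightarrow>\<^sub>0 'a::zero) \<Rightarrow> 'i \<Rightarrow> 'a" where "mcoeff \<equiv> Poly_Mapping.lookup"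
abbreviation mterm :: "'i \<Rightarrow> 'a::zero \<Rightarrow> 'i \<Rightarrow>\<^sub>0 'a" where "mterm \<equiv> Poly_Mapping.single"

lemma sum_of_terms:
  fixes f :: "'i \<Rightarrow>\<^sub>0 'a::comm_monoid_add"
  shows "(\<Sum>m\<in>mkeys f. mterm m (mcoeff f m)) = f"
  by (rule poly_mapping_eqI)
    (simp add: lookup_sum lookup_single when_def in_keys_iff)

lemma mpoly_induct [case_names mterm add]:
  fixes f :: "'i \<Rightarrow>\<^sub>0 'a::comm_monoid_add"
  assumes "\<And>m v. P (mterm m v)" "\<And>f g. P f \<Longrightarrow> P g \<Longrightarrow> P (f + g)"
  shows "P f"
proof -
  have zero: "P 0" using assms(1)[of undefined 0] by simp
  have "P (\<Sum>m\<in>M. mterm m (mcoeff f m))" if "finite M" for M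
    using that by (induction M rule: finite_induct) (auto intro: assms zero)
  from this[OF finite_keys[of f]] show ?thesis by (simp add: sum_of_terms)
qed

definition monomial_at :: "(nat \<Rightarrow> 'b::comm_ring_1) \<Rightarrow> (nat \<Rightarrow>\<^sub>0 nat) \<Rightarrow> 'b" where
  "monomial_at s m = (\<Prod>i\<in>mkeys m. s i ^ mcoeff m i)"

lemma monomial_at_superset:
  assumes "finite A" "mkeys m \<subseteq> A"
  shows "monomial_at s m = (\<Prod>i\<in>A. s i ^ mcoeff m i)"
  unfolding monomial_at_def
  by (rule prod.mono_neutral_left) (use assms in \<open>auto simp: in_keys_iff\<close>)

lemma monomial_at_add: "monomial_at s (m + m') = monomial_at s m * monomial_at s m'"
proof -
  let ?A = "mkeys m \<union> mkeys m'"
  have "monomial_at s (m + m') = (\<Prod>i\<in>?A. s i ^ mcoeff (m + m') i)"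
    by (rule monomial_at_superset) (simp, rule Poly_Mapping.keys_add)
  also have "\<dots> = (\<Prod>i\<in>?A. s i ^ mcoeff m i) * (\<Prod>i\<in>?A. s i ^ mcoeff m' i)"
    by (simp add: lookup_add power_add prod.distrib)
  also have "\<dots> = monomial_at s m * monomial_at s m'"
    by (subst (1 2) monomial_at_superset[of ?A]) auto
  finally show ?thesis .
qed

lemma monomial_at_0: "monomial_at s 0 = 1"
  by (simp add: monomial_at_def)

lemma monomial_at_single: "monomial_at s (mterm i k) = s i ^ k"
  by (subst monomial_at_superset[of "{i}"]) auto

lemma monom_degree_superset:
  assumes "finite A" "mkeys m \<subseteq> A"
  shows "monom_degree m = (\<Sum>i\<in>A. mcoeff m i)"
  unfolding monom_degree_def
  by (rule sum.mono_neutral_left) (use assms in \<open>auto simp: in_keys_iff\<close>)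

lemma monom_degree_add: "monom_degree (m + m') = monom_degree m + monom_degree m'"
proof -
  let ?A = "mkeys m \<union> mkeys m'"
  have "monom_degree (m + m') = (\<Sum>i\<in>?A. mcoeff (m + m') i)"
    by (rule monom_degree_superset) (simp, rule Poly_Mapping.keys_add)
  also have "\<dots> = (\<Sum>i\<in>?A. mcoeff m i) + (\<Sum>i\<in>?A. mcoeff m' i)"
    by (simp add: lookup_add sum.distrib)
  also have "\<dots> = monom_degree m + monom_degree m'"
    by (subst (1 2) monom_degree_superset[of ?A]) auto
  finally show ?thesis .
qed

lemma monom_degree_single: "monom_degree (mterm i k) = k"
  by (subst monom_degree_superset[of "{i}"]) auto

lemma monom_degree_0: "monom_degree 0 = 0"
  by (simp add: monom_degree_def)

definition insertion :: "('a::comm_ring_1 \<Rightarrow> 'b::comm_ring_1) \<Rightarrow> (nat \<Rightarrow> 'b) \<Rightarrow> 'a mpoly \<Rightarrow> 'b" where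
  "insertion h s f = (\<Sum>m\<in>mkeys f. h (mcoeff f m) * monomial_at s m)"

context
  fixes h :: "'a::comm_ring_1 \<Rightarrow> 'b::comm_ring_1"
  assumes h: "comm_ring_hom h"
begin

interpretation comm_ring_hom h by (rule h)

lemma insertion_superset:
  assumes "finite A" "mkeys f \<subseteq> A"
  shows "insertion h s f = (\<Sum>m\<in>A. h (mcoeff f m) * monomial_at s m)"
  unfolding insertion_def
  by (rule sum.mono_neutral_left) (use assms in \<open>auto simp: in_keys_iff\<close>)

lemma insertion_term: "insertion h s (mterm m v) = h v * monomial_at s m"
  by (subst insertion_superset[of "{m}"]) auto

lemma insertion_add: "insertion h s (f + g) = insertion h s f + insertion h s g"
proof -
  let ?A = "mkeys f \<union> mkeys g"
  have "insertion h s (f + g) = (\<Sum>m\<in>?A. h (mcoeff (f + g) m) * monomial_at s m)"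
    by (rule insertion_superset) (simp, rule Poly_Mapping.keys_add)
  also have "\<dots> = (\<Sum>m\<in>?A. h (mcoeff f m) * monomial_at s m) + (\<Sum>m\<in>?A. h (mcoeff g m) * monomial_at s m)"
    by (simp add: lookup_add hom_add distrib_right sum.distrib)
  also have "\<dots> = insertion h s f + insertion h s g"
    by (subst (1 2) insertion_superset[of ?A]) auto
  finally show ?thesis .
qed

lemma insertion_mult: "insertion h s (f * g) = insertion h s f * insertion h s g"
proof (induction f rule: mpoly_induct)
  case (mterm m v)
  show ?case
  proof (induction g rule: mpoly_induct)
    case (mterm m' v')
    show ?case by (simp add: mult_single insertion_term monomial_at_add hom_mult mult_ac)
  next
    case (add f g)
    then show ?case by (simp add: insertion_add distrib_left)
  qed
next
  case (add f g)
  then show ?case by (simp add: insertion_add distrib_right)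
qed

lemma insertion_mconst: "insertion h s (mconst v) = h v"
  by (simp add: mconst_def insertion_term monomial_at_0)

lemma insertion_mvar: "insertion h s (mvar i) = s i"
  by (simp add: mvar_def insertion_term monomial_at_single)

lemma comm_ring_hom_insertion: "comm_ring_hom (insertion h s)"
proof -
  have "insertion h s 0 = 0" "insertion h s 1 = 1"
    by (simp_all add: insertion_def monomial_at_0)
  then show ?thesis
    by unfold_locales (simp_all add: insertion_add insertion_mult)
qed

end

lemma comm_ring_hom_mconst: "comm_ring_hom (mconst :: 'a::comm_ring_1 \<Rightarrow> 'a mpoly)"
  by unfold_locales (simp_all add: mconst_def single_add mult_single)

lemma mterm_eq: "mterm m v = mconst v * monomial_at mvar m"
proof -
  have "monomial_at mvar m = mterm m (1 :: 'a)"
  proof -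
    have power: "mvar i ^ k = mterm (mterm i k) (1 :: 'a)" for i k
      by (induction k) (simp_all add: mvar_def mult_single single_add[symmetric])
    have "(\<Prod>i\<in>A. mterm (mterm i (mcoeff m i)) (1 :: 'a)) = mterm (\<Sum>i\<in>A. mterm i (mcoeff m i)) 1" if "finite A" for A
      using that by (induction A) (simp_all add: mult_single)
    then show ?thesis
      by (simp add: monomial_at_def power sum_of_terms)
  qed
  then show ?thesis by (simp add: mconst_def mult_single)
qed

text \<open>The universal property of the polynomial ring, for the variables below \<open>n\<close>.\<close>

lemma hom_eq_on_mpoly_ring:
  assumes "comm_ring_hom F" "comm_ring_hom G" and const: "\<And>v. F (mconst v) = G (mconst v)"
    and var: "\<And>i. i < n \<Longrightarrow> F (mvar i) = G (mvar i)" and f: "f \<in> mpoly_ring n"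
  shows "F f = G f"
proof -
  interpret F: comm_ring_hom F by fact
  interpret G: comm_ring_hom G by fact
  have "F (mterm m v) = G (mterm m v)" if "m \<in> mkeys f" for m v
  proof -
    have "F (mvar i ^ mcoeff m i) = G (mvar i ^ mcoeff m i)" if "i \<in> mkeys m" for i
    proof -
      have "i < n" using f \<open>m \<in> mkeys f\<close> that by (auto simp: mpoly_ring_def)
      then show ?thesis by (simp only: F.hom_power G.hom_power var)
    qed
    then have "F (monomial_at mvar m) = G (monomial_at mvar m)"
      by (simp add: monomial_at_def F.hom_prod G.hom_prod)
    then show ?thesis by (simp add: mterm_eq F.hom_mult G.hom_mult const)
  qed
  then have "F (\<Sum>m\<in>mkeys f. mterm m (mcoeff f m)) = G (\<Sum>m\<in>mkeys f. mterm m (mcoeff f m))"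
    unfolding F.hom_sum G.hom_sum by (intro sum.cong refl) blast
  then show ?thesis by (simp only: sum_of_terms)
qed

section \<open>Homogeneous components\<close>

definition hom_part :: "nat \<Rightarrow> nat \<Rightarrow> 'a::comm_ring_1 mpoly set" where
  "hom_part n d = {f \<in> mpoly_ring n. \<forall>m\<in>mkeys f. monom_degree m = d}"

lemma hom_partI: "(\<And>m. m \<in> mkeys f \<Longrightarrow> mkeys m \<subseteq> {..<n} \<and> monom_degree m = d) \<Longrightarrow> f \<in> hom_part n d"
  by (auto simp: hom_part_def mpoly_ring_def)

lemma hom_partD: "f \<in> hom_part n d \<Longrightarrow> m \<in> mkeys f \<Longrightarrow> mkeys m \<subseteq> {..<n} \<and> monom_degree m = d"
  by (auto simp: hom_part_def mpoly_ring_def)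

lemma hom_part_zero: "0 \<in> hom_part n d"
  by (rule hom_partI) simp

lemma hom_part_add:
  assumes "f \<in> hom_part n d" "g \<in> hom_part n d"
  shows "f + g \<in> hom_part n d"
proof (rule hom_partI)
  fix m assume "m \<in> mkeys (f + g)"
  then have "m \<in> mkeys f \<or> m \<in> mkeys g" using Poly_Mapping.keys_add[of f g] by blast
  then show "mkeys m \<subseteq> {..<n} \<and> monom_degree m = d"
    using hom_partD[OF assms(1)] hom_partD[OF assms(2)] by blast
qed

lemma hom_part_sum: "(\<And>i. i \<in> A \<Longrightarrow> f i \<in> hom_part n d) \<Longrightarrow> sum f A \<in> hom_part n d"
  by (induction A rule: infinite_finite_induct) (auto intro: hom_part_zero hom_part_add)

lemma hom_part_mult:
  assumes "f \<in> hom_part n i" "g \<in> hom_part n j"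
  shows "f * g \<in> hom_part n (i + j)"
proof (rule hom_partI)
  fix m assume "m \<in> mkeys (f * g)"
  then obtain p q where m: "m = p + q" "p \<in> mkeys f" "q \<in> mkeys g" using keys_mult[of f g] by auto
  then show "mkeys m \<subseteq> {..<n} \<and> monom_degree m = i + j"
    using hom_partD[OF assms(1) m(2)] hom_partD[OF assms(2) m(3)] Poly_Mapping.keys_add[of p q]
    by (auto simp: monom_degree_add)
qed

lemma hom_part_mconst: "mconst v \<in> hom_part n 0"
  by (rule hom_partI) (auto simp: mconst_def monom_degree_0 split: if_splits)

lemma hom_part_one: "1 \<in> hom_part n 0"
  using hom_part_mconst[of 1 n] by (simp add: mconst_def)

lemma hom_part_0_D: "f \<in> hom_part n 0 \<Longrightarrow> f = mconst (mcoeff f 0)"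
proof (rule poly_mapping_eqI)
  fix m assume f: "f \<in> hom_part n 0"
  show "mcoeff f m = mcoeff (mconst (mcoeff f 0)) m"
  proof (cases "m = 0")
    case False
    then obtain i where "i \<in> mkeys m" by (metis keys_eq_empty ex_in_conv)
    then have "monom_degree m \<noteq> 0"
      by (auto simp: monom_degree_def in_keys_iff)
    then have "m \<notin> mkeys f" using hom_partD[OF f] by auto
    then show ?thesis using False by (simp add: mconst_def lookup_single in_keys_iff)
  qed (simp add: mconst_def)
qed

lemma hom_part_power: "f \<in> hom_part n d \<Longrightarrow> f ^ k \<in> hom_part n (k * d)"
  by (induction k) (auto simp: hom_part_one intro: hom_part_mult)

lemma hom_part_prod: "(\<And>i. i \<in> A \<Longrightarrow> f i \<in> hom_part n (e i)) \<Longrightarrow> prod f A \<in> hom_part n (sum e A)"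
  by (induction A rule: infinite_finite_induct) (auto simp: hom_part_one intro: hom_part_mult)

lemma hom_part_mterm: "mkeys m \<subseteq> {..<n} \<Longrightarrow> mterm m v \<in> hom_part n (monom_degree m)"
  by (rule hom_partI) (auto split: if_splits)

lemma hom_part_mvar: "i < n \<Longrightarrow> mvar i \<in> hom_part n 1"
  using hom_part_mterm[of "mterm i 1" n 1] by (simp add: mvar_def monom_degree_single)

lemma hom_part_Suc:
  assumes f: "f \<in> hom_part n (Suc d)"
  shows "f \<in> addspan {l * g | l g. l \<in> hom_part n 1 \<and> g \<in> hom_part n d}"
proof -
  have "mterm m v \<in> {l * g | l g. l \<in> hom_part n 1 \<and> g \<in> hom_part n d}"
    if m: "m \<in> mkeys f" for m and v :: 'a
  proof -
    have deg: "mkeys m \<subseteq> {..<n}" "monom_degree m = Suc d" using hom_partD[OF f m] by auto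
    then have "mkeys m \<noteq> {}" by (auto simp: monom_degree_def)
    then obtain i where i: "i \<in> mkeys m" by blast
    define m' where "m' = m - mterm i 1"
    have m': "m = mterm i 1 + m'"
      using i by (intro poly_mapping_eqI) (auto simp: m'_def lookup_add lookup_minus lookup_single when_def in_keys_iff)
    have "mkeys m' \<subseteq> mkeys m"
      by (auto simp: m'_def in_keys_iff lookup_minus)
    moreover have "monom_degree m' = d"
      using deg(2) monom_degree_add[of "mterm i 1" m'] unfolding m'[symmetric] monom_degree_single by simp
    ultimately have "mterm m' v \<in> hom_part n d"
      using deg(1) hom_part_mterm[of m' n v] by blast
    moreover have "mterm m v = mvar i * mterm m' v"
      by (subst m') (simp add: mvar_def mult_single)
    moreover have "mvar i \<in> hom_part n 1" using i deg(1) by (intro hom_part_mvar) auto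
    ultimately show ?thesis by blast
  qed
  then have "(\<Sum>m\<in>mkeys f. mterm m (mcoeff f m)) \<in> addspan {l * g | l g. l \<in> hom_part n 1 \<and> g \<in> hom_part n d}"
    by (intro addspan_sum addspan_base) blast
  then show ?thesis by (simp only: sum_of_terms)
qed

lemma insertion_hom_part:
  assumes s: "\<And>i. i < n \<Longrightarrow> s i \<in> hom_part n 1" and f: "f \<in> hom_part n d"
  shows "insertion mconst s f \<in> hom_part n d"
  unfolding insertion_def
proof (rule hom_part_sum)
  fix m assume "m \<in> mkeys f"
  then have m: "mkeys m \<subseteq> {..<n}" "monom_degree m = d" using hom_partD[OF f] by auto
  have "monomial_at s m \<in> hom_part n (\<Sum>i\<in>mkeys m. mcoeff m i)"
    unfolding monomial_at_def
  proof (rule hom_part_prod)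
    fix i assume "i \<in> mkeys m"
    then show "s i ^ mcoeff m i \<in> hom_part n (mcoeff m i)"
      using hom_part_power[OF s, of i "mcoeff m i"] m(1) by auto
  qed
  then show "mconst (mcoeff f m) * monomial_at s m \<in> hom_part n d"
    using hom_part_mult[OF hom_part_mconst] m(2) by (fastforce simp: monom_degree_def)
qed

definition component :: "nat \<Rightarrow> 'a::comm_ring_1 mpoly \<Rightarrow> 'a mpoly" where
  "component d f = (\<Sum>m\<in>{m \<in> mkeys f. monom_degree m = d}. mterm m (mcoeff f m))"

lemma lookup_component: "mcoeff (component d f) m = (if monom_degree m = d then mcoeff f m else 0)"
  by (simp add: component_def lookup_sum lookup_single when_def in_keys_iff)

lemma component_add: "component d (f + g) = component d f + component d g"
  by (rule poly_mapping_eqI) (simp add: lookup_component lookup_add)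

lemma component_sum: "component d (sum f A) = (\<Sum>i\<in>A. component d (f i))"
  by (rule poly_mapping_eqI) (simp add: lookup_component lookup_sum)

lemma component_in: "f \<in> mpoly_ring n \<Longrightarrow> component d f \<in> hom_part n d"
  by (rule hom_partI) (auto simp: in_keys_iff lookup_component mpoly_ring_def split: if_splits)

lemma component_hom_part: "f \<in> hom_part n e \<Longrightarrow> component d f = (if d = e then f else 0)"
  using hom_partD[of f n e]
  by (intro poly_mapping_eqI) (auto simp: lookup_component in_keys_iff)

lemma total_degree_bound: "m \<in> mkeys f \<Longrightarrow> monom_degree m \<le> total_degree f"
  by (simp add: total_degree_def)

lemma component_decomp: "f = (\<Sum>d\<le>total_degree f. component d f)"
proof (rule poly_mapping_eqI)
  fix m
  show "mcoeff f m = mcoeff (\<Sum>d\<le>total_degree f. component d f) m"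
    using total_degree_bound[of m f]
    by (cases "m \<in> mkeys f") (auto simp: lookup_sum lookup_component in_keys_iff)
qed

lemma hom_part_total_degree:
  assumes "f \<in> hom_part n d" "f \<noteq> 0"
  shows "total_degree f = d"
proof -
  have "mkeys f \<noteq> {}" using assms(2) by simp
  moreover have "monom_degree ` mkeys f = (\<lambda>_. d) ` mkeys f"
    using hom_partD[OF assms(1)] by (intro image_cong) auto
  ultimately have "monom_degree ` mkeys f = {d}" by (simp only: image_constant_conv if_False)
  then show ?thesis by (simp add: total_degree_def)
qed

lemma homogeneous_iff: "f \<in> mpoly_ring n \<Longrightarrow> homogeneous f \<longleftrightarrow> (\<exists>d. f \<in> hom_part n d)"
  by (simp add: homogeneous_def hom_part_def)

lemma homogeneous_hom_part:
  assumes "f \<in> mpoly_ring n" "homogeneous f"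
  shows "f \<in> hom_part n (total_degree f)"
  using assms hom_part_total_degree hom_part_zero homogeneous_iff by metis

lemma component_mult: "component d (f * g) = (\<Sum>i\<le>d. component i f * component (d - i) g)"
proof -
  have prod: "component d (f * g) = (\<Sum>i\<le>d. component i f * component (d - i) g)"
    if "f = mterm m v" "g = mterm m' v'" for f g :: "'a mpoly" and m m' v v'
  proof -
    have comp: "component i (mterm m v) = (if i = monom_degree m then mterm m v else 0)" for i m and v :: 'a
      by (rule poly_mapping_eqI) (simp add: lookup_component lookup_single when_def)
    have "(\<Sum>i\<le>d. component i f * component (d - i) g) =
        (\<Sum>i\<le>d. if monom_degree m = i then mterm m v * component (d - monom_degree m) g else 0)"
      by (intro sum.cong refl) (auto simp: that(1) comp)
    also have "\<dots> = component d (f * g)"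
      unfolding that mult_single comp by (auto simp: mult_single monom_degree_add)
    finally show ?thesis ..
  qed
  show ?thesis
  proof (induction f rule: mpoly_induct)
    case (mterm m v)
    show ?case
      by (induction g rule: mpoly_induct) (simp_all add: prod component_add distrib_left sum.distrib)
  next
    case (add f h)
    then show ?case by (simp add: distrib_right component_add sum.distrib)
  qed
qed

section \<open>The action of a linear group on polynomials\<close>

abbreviation linear_form :: "nat \<Rightarrow> 'a::comm_ring_1 mat \<Rightarrow> nat \<Rightarrow> 'a mpoly" where
  "linear_form n M i \<equiv> (\<Sum>j<n. mconst (M $$ (i, j)) * mvar j)"

lemma mpoly_act_eq: "mpoly_act n M = insertion mconst (linear_form n M)"
  by (rule ext) (simp add: mpoly_act_def insertion_def monomial_at_def)

lemma comm_ring_hom_act: "comm_ring_hom (mpoly_act n M)"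
  unfolding mpoly_act_eq by (rule comm_ring_hom_insertion[OF comm_ring_hom_mconst])

lemma mpoly_act_mconst: "mpoly_act n M (mconst v) = mconst v"
  unfolding mpoly_act_eq by (rule insertion_mconst[OF comm_ring_hom_mconst])

lemma mpoly_act_mvar: "mpoly_act n M (mvar i) = linear_form n M i"
  unfolding mpoly_act_eq by (rule insertion_mvar[OF comm_ring_hom_mconst])

lemma mpoly_act_hom_part:
  assumes "f \<in> hom_part n d"
  shows "mpoly_act n M f \<in> hom_part n d"
  unfolding mpoly_act_eq
proof (rule insertion_hom_part[OF _ assms])
  fix i
  show "linear_form n M i \<in> hom_part n 1"
    using hom_part_mult[OF hom_part_mconst hom_part_mvar] by (intro hom_part_sum) fastforce
qed

text \<open>Substitution is a right action: the matrix that acts first is the left factor.\<close>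

lemma mpoly_act_comp:
  assumes M: "M \<in> carrier_mat n n" and N: "N \<in> carrier_mat n n" and f: "f \<in> mpoly_ring n"
  shows "mpoly_act n N (mpoly_act n M f) = mpoly_act n (M * N) f"
proof (rule hom_eq_on_mpoly_ring[OF _ _ _ _ f])
  interpret N: comm_ring_hom "mpoly_act n N" by (rule comm_ring_hom_act)
  interpret M: comm_ring_hom "mpoly_act n M" by (rule comm_ring_hom_act)
  show "comm_ring_hom (\<lambda>f. mpoly_act n N (mpoly_act n M f))"
    by unfold_locales (simp_all add: M.hom_add N.hom_add M.hom_mult N.hom_mult)
  interpret C: comm_ring_hom "mconst :: 'a \<Rightarrow> 'a mpoly" by (rule comm_ring_hom_mconst)
  fix i assume i: "i < n"
  have "mpoly_act n N (mpoly_act n M (mvar i)) =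
      (\<Sum>j<n. \<Sum>k<n. mconst (M $$ (i, j)) * (mconst (N $$ (j, k)) * mvar k))"
    by (simp add: mpoly_act_mvar N.hom_sum N.hom_mult mpoly_act_mconst sum_distrib_left)
  also have "\<dots> = (\<Sum>k<n. \<Sum>j<n. mconst (M $$ (i, j)) * (mconst (N $$ (j, k)) * mvar k))"
    by (rule sum.swap)
  also have "\<dots> = (\<Sum>k<n. mconst ((M * N) $$ (i, k)) * mvar k)"
  proof (rule sum.cong[OF HOL.refl])
    fix k assume k: "k \<in> {..<n}"
    have "(M * N) $$ (i, k) = (\<Sum>j<n. M $$ (i, j) * N $$ (j, k))"
      using M N i k by (auto simp: scalar_prod_def atLeast0LessThan intro!: sum.cong)
    then show "(\<Sum>j<n. mconst (M $$ (i, j)) * (mconst (N $$ (j, k)) * mvar k)) =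
        mconst ((M * N) $$ (i, k)) * mvar k"
      by (simp add: C.hom_sum C.hom_mult sum_distrib_right mult.assoc)
  qed
  finally show "mpoly_act n N (mpoly_act n M (mvar i)) = mpoly_act n (M * N) (mvar i)"
    by (simp add: mpoly_act_mvar)
qed (simp_all add: comm_ring_hom_act mpoly_act_mconst)

lemma mpoly_act_one:
  assumes "f \<in> mpoly_ring n"
  shows "mpoly_act n (1\<^sub>m n) f = f"
proof (rule hom_eq_on_mpoly_ring[OF _ _ _ _ assms, where G = "\<lambda>f. f"])
  fix i assume i: "i < n"
  have "(\<Sum>j<n. mconst (1\<^sub>m n $$ (i, j)) * mvar j) = (\<Sum>j<n. if i = j then mvar j else 0 :: 'a mpoly)"
    using i by (intro sum.cong refl) (auto simp: mconst_def)
  then show "mpoly_act n (1\<^sub>m n) (mvar i) = (mvar i :: 'a mpoly)"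
    using i by (simp add: mpoly_act_mvar)
qed (auto simp: comm_ring_hom_act mpoly_act_mconst intro: comm_ring_hom.intro, unfold_locales, auto)

lemma mpoly_ring_mconst: "mconst v \<in> mpoly_ring n"
  using hom_part_mconst[of v n] by (simp add: hom_part_def)

lemma mpoly_ring_add: "f \<in> mpoly_ring n \<Longrightarrow> g \<in> mpoly_ring n \<Longrightarrow> f + g \<in> mpoly_ring n"
  using Poly_Mapping.keys_add[of f g] unfolding mpoly_ring_def by blast

lemma mpoly_ring_sum: "(\<And>i. i \<in> A \<Longrightarrow> f i \<in> mpoly_ring n) \<Longrightarrow> sum f A \<in> mpoly_ring n"
  using hom_part_zero[of n 0]
  by (induction A rule: infinite_finite_induct) (auto intro: mpoly_ring_add simp: hom_part_def)

lemma hom_part_mpoly_ring: "f \<in> hom_part n d \<Longrightarrow> f \<in> mpoly_ring n"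
  by (simp add: hom_part_def)

lemma mpoly_ring_mult:
  assumes f: "f \<in> mpoly_ring n" and g: "g \<in> mpoly_ring n"
  shows "f * g \<in> mpoly_ring n"
proof -
  have "(\<Sum>d\<le>total_degree f. component d f) * (\<Sum>e\<le>total_degree g. component e g) \<in> mpoly_ring n"
    unfolding sum_product
    by (intro mpoly_ring_sum hom_part_mpoly_ring[OF hom_part_mult[OF component_in[OF f] component_in[OF g]]])
  then show ?thesis by (simp only: component_decomp[symmetric])
qed

lemma component_act:
  assumes f: "f \<in> mpoly_ring n"
  shows "component d (mpoly_act n M f) = mpoly_act n M (component d f)"
proof -
  interpret comm_ring_hom "mpoly_act n M" by (rule comm_ring_hom_act)
  have "component d (mpoly_act n M f) = component d (mpoly_act n M (\<Sum>e\<le>total_degree f. component e f))"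
    by (simp only: component_decomp[symmetric])
  also have "\<dots> = (\<Sum>e\<le>total_degree f. component d (mpoly_act n M (component e f)))"
    by (simp only: hom_sum component_sum)
  also have "\<dots> = (\<Sum>e\<le>total_degree f. if d = e then mpoly_act n M (component e f) else 0)"
    by (intro sum.cong HOL.refl component_hom_part[OF mpoly_act_hom_part[OF component_in[OF f]]])
  also have "\<dots> = mpoly_act n M (component d f)"
  proof (cases "d \<le> total_degree f")
    case False
    have "component d f = 0"
      using False total_degree_bound[of _ f]
      by (intro poly_mapping_eqI) (fastforce simp: lookup_component in_keys_iff)
    then show ?thesis using False by simp
  qed simp
  finally show ?thesis .
qed

section \<open>Representations of the Heisenberg group\<close>

locale heisenberg_rep =
  fixes n :: nat and \<rho> :: "heis_gen word set \<Rightarrow> 'a::field mat"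
  assumes rep: "\<rho> \<in> representations heisenberg3 n"
begin

definition act :: "heis_gen word \<Rightarrow> 'a mpoly \<Rightarrow> 'a mpoly" where
  "act u = mpoly_act n (\<rho> (word_class heis_relations u))"

lemma rep_carrier: "\<rho> (word_class heis_relations u) \<in> carrier_mat n n"
proof -
  have "word_class heis_relations u \<in> carrier heisenberg3"
    by (simp add: heisenberg3_def presented_group_carrier)
  then show ?thesis
    using rep by (auto simp: representations_def hom_def units_of_def Units_def ring_mat_simps)
qed

lemma act_append:
  assumes "f \<in> mpoly_ring n"
  shows "act (u @ v) f = act v (act u f)"
proof -
  have "word_class heis_relations u \<in> carrier heisenberg3" for u
    by (simp add: heisenberg3_def presented_group_carrier)
  then have "\<rho> (word_class heis_relations u \<otimes>\<^bsub>heisenberg3\<^esub> word_class heis_relations v) =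
      \<rho> (word_class heis_relations u) * \<rho> (word_class heis_relations v)"
    using rep by (auto simp: representations_def hom_def units_of_def ring_mat_simps)
  then have "\<rho> (word_class heis_relations (u @ v)) =
      \<rho> (word_class heis_relations u) * \<rho> (word_class heis_relations v)"
    by (simp add: heisenberg3_def presented_group_mult)
  then show ?thesis
    by (simp add: act_def mpoly_act_comp[OF rep_carrier rep_carrier assms])
qed

lemma act_Nil:
  assumes "f \<in> mpoly_ring n"
  shows "act [] f = f"
proof -
  interpret G: group heisenberg3 by (rule group_heisenberg3)
  interpret R: ring "ring_mat TYPE('a) n ()" by (rule ring_mat)
  have "\<rho> \<in> hom heisenberg3 (units_of (ring_mat TYPE('a) n ()))"
    using rep by (simp add: representations_def)
  then have "group_hom heisenberg3 (units_of (ring_mat TYPE('a) n ())) \<rho>"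
    using R.units_group group_heisenberg3 by (simp add: group_hom_def group_hom_axioms_def)
  then have "\<rho> \<one>\<^bsub>heisenberg3\<^esub> = \<one>\<^bsub>units_of (ring_mat TYPE('a) n ())\<^esub>"
    by (rule group_hom.hom_one)
  then have "\<rho> (word_class heis_relations []) = 1\<^sub>m n"
    by (simp add: units_of_def ring_mat_simps heisenberg3_def presented_group_one)
  then show ?thesis by (simp add: act_def mpoly_act_one[OF assms])
qed

lemma act_eq: "word_eq heis_relations u v \<Longrightarrow> act u = act v"
  by (simp add: act_def flip: word_class_eq_iff)

lemma comm_ring_hom_act_word: "comm_ring_hom (act u)"
  unfolding act_def by (rule comm_ring_hom_act)

lemma act_hom_part: "f \<in> hom_part n d \<Longrightarrow> act u f \<in> hom_part n d"
  unfolding act_def by (rule mpoly_act_hom_part)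

lemma act_mpoly_ring:
  assumes "f \<in> mpoly_ring n"
  shows "act u f \<in> mpoly_ring n"
proof -
  interpret comm_ring_hom "act u" by (rule comm_ring_hom_act_word)
  have "act u (\<Sum>d\<le>total_degree f. component d f) \<in> mpoly_ring n"
    unfolding hom_sum
    by (intro mpoly_ring_sum hom_part_mpoly_ring[OF act_hom_part[OF component_in[OF assms]]])
  then show ?thesis by (simp only: component_decomp[symmetric])
qed

abbreviation gen :: "heis_gen \<Rightarrow> 'a mpoly \<Rightarrow> 'a mpoly" where
  "gen x \<equiv> act [(x, True)]"

lemma act_Cons: "f \<in> mpoly_ring n \<Longrightarrow> act (l # u) f = act u (act [l] f)"
  using act_append[of f "[l]" u] by simp

lemma act_cancel:
  assumes "f \<in> mpoly_ring n"
  shows "act [(x, False)] (gen x f) = f"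
proof -
  have "word_eq heis_relations [(x, True), (x, False)] []"
    using word_eq.cancel[of heis_relations x True] by simp
  from act_eq[OF this] show ?thesis
    using act_Cons[OF assms, of "(x, True)" "[(x, False)]"] act_Nil[OF assms] by simp
qed

lemma gen_cubed:
  assumes "f \<in> mpoly_ring n"
  shows "gen x (gen x (gen x f)) = f"
proof -
  have "([(x, True), (x, True), (x, True)], []) \<in> heis_relations"
    by (cases x) (simp_all add: heis_relations_def Let_def)
  then have "act [(x, True), (x, True), (x, True)] = act []"
    by (intro act_eq word_eq.relation)
  then have "act [(x, True), (x, True), (x, True)] f = f" using assms by (simp add: act_Nil)
  then show ?thesis
    using assms by (simp add: act_Cons[of _ _ "_ # _"] act_mpoly_ring)
qed

lemma gen_commutator:
  assumes "([(x, False), (y, False), (x, True), (y, True)], v) \<in> heis_relations" "f \<in> mpoly_ring n"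
  shows "gen y (gen x f) = act v (gen x (gen y f))"
proof -
  let ?g = "gen x (gen y f)"
  have "act [(x, False), (y, False), (x, True), (y, True)] = act v"
    by (intro act_eq word_eq.relation assms(1))
  then have "act v ?g = act [(x, False), (y, False), (x, True), (y, True)] ?g" by simp
  also have "\<dots> = gen y (gen x f)"
    using assms(2) by (simp add: act_Cons[of _ _ "_ # _"] act_mpoly_ring act_cancel)
  finally show ?thesis ..
qed

lemma gen_ba:
  "f \<in> mpoly_ring n \<Longrightarrow> gen Gen_b (gen Gen_a f) = gen Gen_c (gen Gen_a (gen Gen_b f))"
  by (rule gen_commutator) (simp_all add: heis_relations_def Let_def)

lemma gen_ca: "f \<in> mpoly_ring n \<Longrightarrow> gen Gen_c (gen Gen_a f) = gen Gen_a (gen Gen_c f)"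
  using gen_commutator[of Gen_a Gen_c "[]" f]
  by (simp add: heis_relations_def Let_def act_Nil act_mpoly_ring)

lemma gen_cb: "f \<in> mpoly_ring n \<Longrightarrow> gen Gen_c (gen Gen_b f) = gen Gen_b (gen Gen_c f)"
  using gen_commutator[of Gen_b Gen_c "[]" f]
  by (simp add: heis_relations_def Let_def act_Nil act_mpoly_ring)

text \<open>A polynomial fixed by the generators is fixed by their inverses, and so by every word.\<close>

lemma invariants_eq:
  "invariants heisenberg3 n \<rho> = {f \<in> mpoly_ring n. \<forall>x. gen x f = f}"
proof (intro equalityI subsetI)
  fix f assume "f \<in> invariants heisenberg3 n \<rho>"
  then show "f \<in> {f \<in> mpoly_ring n. \<forall>x. gen x f = f}"
    by (auto simp: invariants_def act_def heisenberg3_def presented_group_carrier)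
next
  fix f assume f: "f \<in> {f \<in> mpoly_ring n. \<forall>x. gen x f = f}"
  have letter: "act [l] f = f" for l
    using f act_cancel[of f "fst l"] by (cases l; cases "snd l") auto
  have "act u f = f" for u
  proof (induction u)
    case Nil
    show ?case using f by (simp add: act_Nil)
  next
    case (Cons l u)
    then show ?case using f letter by (simp add: act_Cons[of f l u])
  qed
  then show "f \<in> invariants heisenberg3 n \<rho>"
    using f by (auto simp: invariants_def act_def heisenberg3_def presented_group_carrier)
qed

definition inv_part :: "nat \<Rightarrow> 'a mpoly set" where
  "inv_part d = {f \<in> hom_part n d. \<forall>x. gen x f = f}"

lemma inv_part_invariants: "f \<in> inv_part d \<Longrightarrow> f \<in> invariants heisenberg3 n \<rho>"
  by (simp add: inv_part_def invariants_eq hom_part_def)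

lemma component_inv_part:
  assumes "f \<in> invariants heisenberg3 n \<rho>"
  shows "component d f \<in> inv_part d"
proof -
  have f: "f \<in> mpoly_ring n" "gen x f = f" for x using assms by (simp_all add: invariants_eq)
  have "gen x (component d f) = component d (gen x f)" for x
    unfolding act_def by (rule component_act[OF f(1), symmetric])
  then have "gen x (component d f) = component d f" for x by (simp only: f(2))
  then show ?thesis using component_in[OF f(1)] by (simp add: inv_part_def)
qed

end

section \<open>Descent from the extension by a cube root of unity\<close>

lemma generated_algebra_sum:
  "(\<And>i. i \<in> A \<Longrightarrow> f i \<in> generated_algebra S) \<Longrightarrow> sum f A \<in> generated_algebra S"
  using generated_algebra.const[of 0 S]
  by (induction A rule: infinite_finite_induct) (auto simp: mconst_def intro: generated_algebra.add)

lemma hom_part_minus: "f \<in> hom_part n d \<Longrightarrow> - f \<in> hom_part n d"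
  by (simp add: hom_part_def mpoly_ring_def)

lemma hom_part_diff:
  assumes "f \<in> hom_part n d" "g \<in> hom_part n d"
  shows "f - g \<in> hom_part n d"
  using hom_part_add[OF assms(1) hom_part_minus[OF assms(2)]] by simp

locale nonmodular_heisenberg_rep = heisenberg_rep n \<rho> for n and \<rho> :: "heis_gen word set \<Rightarrow> 'a::field mat" +
  assumes three: "(3 :: 'a) \<noteq> 0"
begin

definition eis_part :: "nat \<Rightarrow> 'a mpoly eis set" where
  "eis_part d = {Eis p q | p q. p \<in> hom_part n d \<and> q \<in> hom_part n d}"

abbreviation third :: "'a mpoly" where "third \<equiv> mconst (1 / 3)"

lemma three_third: "3 * third = (1 :: 'a mpoly)"
proof -
  interpret C: comm_ring_hom "mconst :: 'a \<Rightarrow> 'a mpoly" by (rule comm_ring_hom_mconst)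
  have "3 * third = mconst (3 * (1 / 3 :: 'a))"
    by (simp only: C.hom_mult C.hom_numeral)
  also have "3 * (1 / 3 :: 'a) = 1" using three by simp
  finally show ?thesis by (simp only: C.hom_one)
qed

lemma gen_mconst: "s \<in> hom_part n 0 \<Longrightarrow> gen x s = s"
  by (metis hom_part_0_D act_def mpoly_act_mconst)

sublocale eis: cubic_grading eis_part omega "eis_of third"
proof unfold_locales
  fix d
  show "0 \<in> eis_part d" by (auto simp: eis_part_def zero_eis_def hom_part_zero)
  show "f + g \<in> eis_part d" if "f \<in> eis_part d" "g \<in> eis_part d" for f g
    using that by (auto simp: eis_part_def plus_eis_def intro: hom_part_add)
  show "f * g \<in> eis_part (i + j)" if "f \<in> eis_part i" "g \<in> eis_part j" for f g i j
    using that by (auto simp: eis_part_def times_eis_def intro!: hom_part_add hom_part_diff hom_part_mult)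
  show "omega \<in> eis_part 0"
    by (auto simp: eis_part_def omega_def hom_part_zero hom_part_one)
  show "eis_of third \<in> eis_part 0"
    by (auto simp: eis_part_def eis_of_def hom_part_zero hom_part_mconst)
  show "1 + omega + omega * omega = (0 :: 'a mpoly eis)" by (rule omega_relation)
  show "3 * eis_of third = (1 :: 'a mpoly eis)"
  proof -
    have "(3 :: 'a mpoly eis) = 1 + 1 + 1" by simp
    also have "\<dots> = eis_of 3" by (simp add: eis_of_def one_eis_def plus_eis_def)
    finally show ?thesis by (simp only: eis_of_mult[symmetric] three_third eis_of_1)
  qed
  fix f assume "f \<in> eis_part (Suc d)"
  then obtain p q where f: "f = Eis p q" "p \<in> hom_part n (Suc d)" "q \<in> hom_part n (Suc d)"
    by (auto simp: eis_part_def)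
  let ?S = "{l * g | l g. l \<in> hom_part n 1 \<and> g \<in> hom_part n d} :: 'a mpoly set"
  let ?T = "{l * g | l g. l \<in> eis_part 1 \<and> g \<in> eis_part d}"
  have "Eis p 0 \<in> addspan ?T"
  proof (rule addspan_map[OF hom_part_Suc[OF f(2)], where F = "\<lambda>p. Eis p 0"])
    fix x assume "x \<in> ?S"
    then obtain l g where "x = l * g" "l \<in> hom_part n 1" "g \<in> hom_part n d" by blast
    then have "Eis x 0 = Eis l 0 * Eis g 0" "Eis l 0 \<in> eis_part 1" "Eis g 0 \<in> eis_part d"
      by (auto simp: times_eis_def eis_part_def hom_part_zero)
    then show "Eis x 0 \<in> addspan ?T" by (intro addspan_base) blast
  qed (simp_all add: zero_eis_def plus_eis_def)
  moreover have "Eis 0 q \<in> addspan ?T"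
  proof (rule addspan_map[OF hom_part_Suc[OF f(3)], where F = "\<lambda>q. Eis 0 q"])
    fix x assume "x \<in> ?S"
    then obtain l g where "x = l * g" "l \<in> hom_part n 1" "g \<in> hom_part n d" by blast
    then have "Eis 0 x = Eis l 0 * Eis 0 g" "Eis l 0 \<in> eis_part 1" "Eis 0 g \<in> eis_part d"
      by (auto simp: times_eis_def eis_part_def hom_part_zero)
    then show "Eis 0 x \<in> addspan ?T" by (intro addspan_base) blast
  qed (simp_all add: zero_eis_def plus_eis_def)
  moreover have "f = Eis p 0 + Eis 0 q" by (simp add: f plus_eis_def)
  ultimately show "f \<in> addspan ?T" by (simp add: addspan_add)
qed

abbreviation eis_gen :: "heis_gen \<Rightarrow> 'a mpoly eis \<Rightarrow> 'a mpoly eis" where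
  "eis_gen x \<equiv> map_eis (gen x)"

lemma order3_eis_gen: "eis.order3 (eis_gen x)"
proof -
  interpret comm_ring_hom "gen x" by (rule comm_ring_hom_act_word)
  have minus: "gen x (p - q) = gen x p - gen x q" for p q
    using hom_add[of "p - q" q] by (simp add: algebra_simps)
  have "eis_gen x (f + g) = eis_gen x f + eis_gen x g" for f g
    by (cases f; cases g) (simp add: plus_eis_def hom_add)
  moreover have "eis_gen x (f * g) = eis_gen x f * eis_gen x g" for f g
    by (cases f; cases g) (simp add: times_eis_def hom_add hom_mult minus)
  moreover have "eis_gen x s = s" if "s \<in> eis_part 0" for s
    using that by (auto simp: eis_part_def gen_mconst)
  moreover have "eis_gen x f \<in> eis_part d \<and> eis_gen x (eis_gen x (eis_gen x f)) = f" if "f \<in> eis_part d" for f d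
    using that by (auto simp: eis_part_def act_hom_part gen_cubed hom_part_mpoly_ring)
  ultimately show ?thesis unfolding eis.order3_def by blast
qed

text \<open>The roles of \<open>a\<close> and \<open>b\<close> are exchanged because substitution reverses the order of products.\<close>

sublocale eis: heisenberg_action eis_part omega "eis_of third" "eis_gen Gen_b" "eis_gen Gen_a" "eis_gen Gen_c"
proof unfold_locales
  fix f d assume "f \<in> eis_part d"
  then obtain p q where f: "f = Eis p q" "p \<in> mpoly_ring n" "q \<in> mpoly_ring n"
    by (auto simp: eis_part_def hom_part_mpoly_ring)
  show "eis_gen Gen_b (eis_gen Gen_a f) = eis_gen Gen_a (eis_gen Gen_b (eis_gen Gen_c f))"
    using f by (simp add: gen_ba gen_ca gen_cb act_mpoly_ring)
  show "eis_gen Gen_c (eis_gen Gen_b f) = eis_gen Gen_b (eis_gen Gen_c f)"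
    "eis_gen Gen_c (eis_gen Gen_a f) = eis_gen Gen_a (eis_gen Gen_c f)"
    using f by (simp_all add: gen_ca gen_cb)
qed (rule order3_eis_gen)+

lemma eis_fixed: "f \<in> eis.fixed3 (eis_gen Gen_b) (eis_gen Gen_a) (eis_gen Gen_c) d \<longleftrightarrow>
    ratpart f \<in> inv_part d \<and> omegapart f \<in> inv_part d"
proof -
  have all: "(\<forall>x. P x) \<longleftrightarrow> P Gen_a \<and> P Gen_b \<and> P Gen_c" for P
    by (metis heis_gen.exhaust)
  show ?thesis
    by (cases f) (auto simp: eis.fixed3_def eis_part_def inv_part_def all)
qed

text \<open>Take the part free of \<open>\<omega>\<close> in a decomposition over the extension.\<close>

lemma inv_part_decomposable:
  assumes f: "f \<in> inv_part d" and d: "10 \<le> d"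
  shows "f \<in> addspan {r * s | r s i j. r \<in> inv_part i \<and> 0 < i \<and> s \<in> inv_part j \<and> 0 < j \<and> i + j = d}"
    (is "_ \<in> addspan ?S")
proof -
  have "0 \<in> inv_part d"
  proof -
    have "gen x 0 = 0" for x
    proof -
      interpret comm_ring_hom "gen x" by (rule comm_ring_hom_act_word)
      show ?thesis by simp
    qed
    then show ?thesis by (simp add: inv_part_def hom_part_zero)
  qed
  then have "eis_of f \<in> eis.fixed3 (eis_gen Gen_b) (eis_gen Gen_a) (eis_gen Gen_c) d"
    using f by (simp add: eis_fixed eis_of_def)
  then have "eis_of f \<in> eis.decomposables (eis_gen Gen_b) (eis_gen Gen_a) (eis_gen Gen_c) d"
    using d by (rule eis.invariant_decomposable)
  then have "ratpart (eis_of f) \<in> addspan ?S"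
    unfolding eis.decomposables_def
  proof (rule addspan_map)
    fix x assume "x \<in> {r * s | r s i j. r \<in> eis.fixed3 (eis_gen Gen_b) (eis_gen Gen_a) (eis_gen Gen_c) i \<and> 0 < i \<and>
        s \<in> eis.fixed3 (eis_gen Gen_b) (eis_gen Gen_a) (eis_gen Gen_c) j \<and> 0 < j \<and> i + j = d}"
    then obtain r s i j where x: "x = r * s" "ratpart r \<in> inv_part i" "omegapart r \<in> inv_part i" "0 < i"
      "ratpart s \<in> inv_part j" "omegapart s \<in> inv_part j" "0 < j" "i + j = d"
      by (auto simp: eis_fixed)
    have "- omegapart r \<in> inv_part i"
    proof -
      have "gen x (- g) = - gen x g" for x g
      proof -
        interpret comm_ring_hom "gen x" by (rule comm_ring_hom_act_word)
        show ?thesis using hom_add[of "- g" g] by (simp add: eq_neg_iff_add_eq_0)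
      qed
      then show ?thesis using x(3) by (simp add: inv_part_def hom_part_minus)
    qed
    then have "ratpart r * ratpart s \<in> ?S" "(- omegapart r) * omegapart s \<in> ?S"
      using x by blast+
    then have "ratpart r * ratpart s + (- omegapart r) * omegapart s \<in> addspan ?S"
      by (intro addspan_add addspan_base)
    then show "ratpart x \<in> addspan ?S" by (simp add: x(1) times_eis_def)
  qed (simp_all add: zero_eis_def plus_eis_def)
  then show ?thesis by (simp add: eis_of_def)
qed

definition low_invariants :: "nat \<Rightarrow> 'a mpoly set" where
  "low_invariants D = (\<Union>d\<le>D. inv_part d)"

lemma inv_part_generated: "f \<in> inv_part d \<Longrightarrow> f \<in> generated_algebra (low_invariants 9)"
proof (induction d arbitrary: f rule: less_induct)
  case (less d)
  show ?case
  proof (cases "d \<le> 9")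
    case True
    then show ?thesis using less.prems by (intro generated_algebra.base) (auto simp: low_invariants_def)
  next
    case False
    then have "f \<in> addspan {r * s | r s i j. r \<in> inv_part i \<and> 0 < i \<and> s \<in> inv_part j \<and> 0 < j \<and> i + j = d}"
      using less.prems by (intro inv_part_decomposable) auto
    then show ?thesis
    proof (rule addspan_closed)
      show "0 \<in> generated_algebra (low_invariants 9)"
        using generated_algebra.const[of 0] by (simp add: mconst_def)
      show "{r * s | r s i j. r \<in> inv_part i \<and> 0 < i \<and> s \<in> inv_part j \<and> 0 < j \<and> i + j = d}
          \<subseteq> generated_algebra (low_invariants 9)"
      proof clarify
        fix r s i j assume "r \<in> inv_part i" "0 < i" "s \<in> inv_part j" "0 < j" "d = i + j"
        then show "r * s \<in> generated_algebra (low_invariants 9)"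
          by (intro generated_algebra.mult less.IH[of i] less.IH[of j]) simp_all
      qed
    qed (rule generated_algebra.add)
  qed
qed

end

section \<open>Minimal homogeneous generating sets\<close>

context heisenberg_rep
begin

abbreviation inv_ring :: "'a mpoly set" where "inv_ring \<equiv> invariants heisenberg3 n \<rho>"

lemma generated_algebra_invariants:
  assumes "S \<subseteq> inv_ring"
  shows "generated_algebra S \<subseteq> inv_ring"
proof
  fix f assume "f \<in> generated_algebra S"
  then show "f \<in> inv_ring"
  proof induction
    case (const v)
    show ?case by (simp add: invariants_def mpoly_ring_mconst mpoly_act_mconst)
  next
    case (base f)
    then show ?case using assms by blast
  next
    case (add f g)
    then show ?case
      by (simp add: invariants_def mpoly_ring_add mpoly_act_eq insertion_add[OF comm_ring_hom_mconst])
  next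
    case (mult f g)
    then show ?case
      by (simp add: invariants_def mpoly_ring_mult mpoly_act_eq insertion_mult[OF comm_ring_hom_mconst])
  qed
qed

end

lemma generated_algebra_mono:
  assumes "S \<subseteq> generated_algebra T"
  shows "generated_algebra S \<subseteq> generated_algebra T"
proof
  fix f assume "f \<in> generated_algebra S"
  then show "f \<in> generated_algebra T"
    by induction (use assms in \<open>auto intro: generated_algebra.intros\<close>)
qed

text \<open>In a homogeneous generating set only the generators of degree at most \<open>D\<close> contribute to the
  components of degree at most \<open>D\<close>.\<close>

lemma component_generated:
  assumes S: "S \<subseteq> mpoly_ring n" "\<And>s. s \<in> S \<Longrightarrow> homogeneous s" and f: "f \<in> generated_algebra S" and d: "d \<le> D"
  shows "component d f \<in> generated_algebra {s \<in> S. total_degree s \<le> D}" (is "_ \<in> ?G")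
proof -
  have zero: "0 \<in> ?G" using generated_algebra.const[of 0] by (simp add: mconst_def)
  from f d show ?thesis
  proof (induction arbitrary: d)
    case (const v)
    show ?case
      using component_hom_part[OF hom_part_mconst[of v n], of d] zero
      by (cases "d = 0") (auto intro: generated_algebra.const)
  next
    case (base s)
    then have "s \<in> hom_part n (total_degree s)" using S homogeneous_hom_part by blast
    from component_hom_part[OF this, of d] show ?case
      using base zero generated_algebra.base[of s "{s \<in> S. total_degree s \<le> D}"] by simp
  next
    case (add f g)
    then show ?case by (simp add: component_add generated_algebra.add)
  next
    case (mult f g)
    then show ?case
      unfolding component_mult by (intro generated_algebra_sum generated_algebra.mult) auto
  qed
qed

context nonmodular_heisenberg_rep
begin

lemma invariants_low:
  assumes "\<And>d. inv_part d \<subseteq> generated_algebra S"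
  shows "inv_ring \<subseteq> generated_algebra S"
proof
  fix f assume "f \<in> inv_ring"
  then have "(\<Sum>d\<le>total_degree f. component d f) \<in> generated_algebra S"
    using assms component_inv_part by (intro generated_algebra_sum) blast
  then show "f \<in> generated_algebra S" by (simp only: component_decomp[symmetric])
qed

lemma inv_ring_generated: "inv_ring \<subseteq> generated_algebra (low_invariants 9)"
  by (rule invariants_low) (use inv_part_generated in blast)

text \<open>The members of \<open>S\<close> of degree at most \<open>D\<close> generate the components of degree at most \<open>D\<close>, which generate
  everything; by minimality there are no other members.\<close>

lemma minimal_generators_degree:
  assumes S: "minimal_homogeneous_generators inv_ring S" and D: "inv_ring \<subseteq> generated_algebra (low_invariants D)"
    and s: "s \<in> S"
  shows "total_degree s \<le> D"
proof -
  let ?T = "{s \<in> S. total_degree s \<le> D}"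
  have S': "S \<subseteq> inv_ring" "\<And>s. s \<in> S \<Longrightarrow> homogeneous s" "generated_algebra S = inv_ring"
    "\<And>T. T \<subset> S \<Longrightarrow> generated_algebra T \<noteq> inv_ring"
    using S by (auto simp: minimal_homogeneous_generators_def)
  have S_ring: "S \<subseteq> mpoly_ring n" using S'(1) by (auto simp: invariants_def)
  have "low_invariants D \<subseteq> generated_algebra ?T"
  proof
    fix f assume "f \<in> low_invariants D"
    then obtain d where d: "d \<le> D" "f \<in> inv_part d" by (auto simp: low_invariants_def)
    then have "component d f \<in> generated_algebra ?T"
      using S'(3) inv_part_invariants by (intro component_generated[OF S_ring S'(2)]) auto
    moreover have "component d f = f"
      using d(2) component_hom_part[of f n d d] by (simp add: inv_part_def)
    ultimately show "f \<in> generated_algebra ?T" by simp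
  qed
  then have "inv_ring \<subseteq> generated_algebra ?T" using D generated_algebra_mono by blast
  moreover have "generated_algebra ?T \<subseteq> inv_ring"
    using S'(1) by (intro generated_algebra_invariants) blast
  ultimately have "\<not> ?T \<subset> S" using S'(4) by blast
  then show ?thesis using s by blast
qed

lemma generated_by_bounded_degree:
  assumes S: "minimal_homogeneous_generators inv_ring S" and D: "\<And>s. s \<in> S \<Longrightarrow> total_degree s \<le> D"
  shows "inv_ring \<subseteq> generated_algebra (low_invariants D)"
proof -
  have "S \<subseteq> low_invariants D"
  proof
    fix s assume s: "s \<in> S"
    then have inv: "s \<in> inv_ring" and "homogeneous s"
      using S by (auto simp: minimal_homogeneous_generators_def)
    then have "s \<in> hom_part n (total_degree s)"
      by (intro homogeneous_hom_part) (auto simp: invariants_def)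
    then have "s \<in> inv_part (total_degree s)" using inv by (simp add: inv_part_def invariants_eq)
    then show "s \<in> low_invariants D" using D[OF s] by (auto simp: low_invariants_def)
  qed
  then have "generated_algebra S \<subseteq> generated_algebra (low_invariants D)"
    by (intro generated_algebra_mono) (auto intro: generated_algebra.base)
  then show ?thesis using S by (simp add: minimal_homogeneous_generators_def)
qed

abbreviation max_degree :: "'a mpoly set \<Rightarrow> enat" where
  "max_degree S \<equiv> (SUP f\<in>S. enat (total_degree f))"

lemma max_degree_le:
  assumes "minimal_homogeneous_generators inv_ring S" "minimal_homogeneous_generators inv_ring T"
  shows "max_degree S \<le> max_degree T"
proof (cases "max_degree T")
  case (enat D)
  have "total_degree f \<le> D" if "f \<in> T" for f
    using SUP_upper[of f T "\<lambda>f. enat (total_degree f)"] that enat by simp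
  then have "inv_ring \<subseteq> generated_algebra (low_invariants D)"
    by (rule generated_by_bounded_degree[OF assms(2)])
  then show ?thesis
    unfolding enat using minimal_generators_degree[OF assms(1)] by (intro SUP_least) simp
qed simp

text \<open>By \<open>max_degree_le\<close> all minimal homogeneous generating sets have the same maximal degree, so the
  description defining the Noether number is proper.\<close>

lemma noether_number_rep_eq:
  assumes "minimal_homogeneous_generators inv_ring S"
  shows "noether_number_rep heisenberg3 n \<rho> = max_degree S"
  unfolding noether_number_rep_def
  using assms max_degree_le by (intro the_equality) (blast intro: antisym)+

lemma finite_monomials: "finite {m :: nat \<Rightarrow>\<^sub>0 nat. mkeys m \<subseteq> {..<n} \<and> monom_degree m \<le> D}"
proof -
  have "mcoeff m i \<le> monom_degree m" for m :: "nat \<Rightarrow>\<^sub>0 nat" and i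
  proof (cases "i \<in> mkeys m")
    case True
    then show ?thesis unfolding monom_degree_def by (intro member_le_sum) auto
  qed (simp add: in_keys_iff)
  then have "mcoeff ` {m :: nat \<Rightarrow>\<^sub>0 nat. mkeys m \<subseteq> {..<n} \<and> monom_degree m \<le> D}
      \<subseteq> {f. \<forall>i. (i \<in> {..<n} \<longrightarrow> f i \<in> {..D}) \<and> (i \<notin> {..<n} \<longrightarrow> f i = 0)}"
    by (auto simp: in_keys_iff intro: order_trans)
  moreover have "finite {f :: nat \<Rightarrow> nat. \<forall>i. (i \<in> {..<n} \<longrightarrow> f i \<in> {..D}) \<and> (i \<notin> {..<n} \<longrightarrow> f i = 0)}"
    by (rule finite_set_of_finite_funs) simp_all
  ultimately have "finite (mcoeff ` {m :: nat \<Rightarrow>\<^sub>0 nat. mkeys m \<subseteq> {..<n} \<and> monom_degree m \<le> D})"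
    by (rule finite_subset)
  then show ?thesis
    by (rule finite_imageD) (auto intro!: inj_onI poly_mapping_eqI)
qed

text \<open>The Reynolds operator of the extension maps polynomials without \<open>\<omega>\<close> to such polynomials.
  \<open>ratpart\<close> only changes the type.\<close>

definition orbit_mean :: "'a mpoly \<Rightarrow> 'a mpoly" where
  "orbit_mean f = ratpart (eis.reynolds (eis_of f))"

lemma orbit_mean_inv_part:
  assumes "f \<in> hom_part n d"
  shows "orbit_mean f \<in> inv_part d"
proof -
  have "eis_of f \<in> eis_part d" using assms by (auto simp: eis_part_def eis_of_def hom_part_zero)
  then show ?thesis using eis.reynolds_fixed eis_fixed by (simp add: orbit_mean_def)
qed

lemma orbit_mean_of_invariant:
  assumes "f \<in> inv_part d"
  shows "orbit_mean f = f"
proof -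
  have "gen x 0 = 0" for x
    using order3_eis_gen[of x] eis.order3_zero[of "eis_gen x"] by (simp add: zero_eis_def)
  then have "eis_of f \<in> eis.fixed3 (eis_gen Gen_b) (eis_gen Gen_a) (eis_gen Gen_c) d"
    using assms by (simp add: eis_fixed eis_of_def inv_part_def hom_part_zero)
  then show ?thesis by (simp add: orbit_mean_def eis.reynolds_of_fixed) (simp add: eis_of_def)
qed

lemma orbit_mean_add: "orbit_mean (f + g) = orbit_mean f + orbit_mean g"
  by (simp add: orbit_mean_def eis_of_add eis.reynolds_add) (simp add: plus_eis_def)

lemma orbit_mean_zero: "orbit_mean 0 = 0"
  by (simp add: orbit_mean_def eis_of_0 eis.reynolds_zero) (simp add: zero_eis_def)

lemma orbit_mean_scale: "orbit_mean (mconst v * f) = mconst v * orbit_mean f"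
proof -
  have "eis_of (mconst v) \<in> eis_part 0"
    by (auto simp: eis_part_def eis_of_def hom_part_zero hom_part_mconst)
  then show ?thesis
    by (simp add: orbit_mean_def eis_of_mult eis.reynolds_scale) (simp add: eis_of_def times_eis_def)
qed

lemma orbit_mean_sum: "orbit_mean (sum f A) = (\<Sum>i\<in>A. orbit_mean (f i))"
  by (induction A rule: infinite_finite_induct) (simp_all add: orbit_mean_zero orbit_mean_add)

text \<open>The orbit means of the finitely many monomials of degree at most 9 span the invariants of degree at
  most 9 and hence generate. A generating subset of least size is minimal.\<close>

lemma minimal_generators_exist: "\<exists>S. minimal_homogeneous_generators inv_ring S"
proof -
  define B where "B = (\<lambda>m. orbit_mean (mterm m 1)) ` {m. mkeys m \<subseteq> {..<n} \<and> monom_degree m \<le> 9}"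
  have B_part: "\<exists>d. f \<in> inv_part d" if "f \<in> B" for f
    using that orbit_mean_inv_part[OF hom_part_mterm] unfolding B_def by blast
  have B_sub: "B \<subseteq> inv_ring" using B_part inv_part_invariants by blast
  have "low_invariants 9 \<subseteq> generated_algebra B"
  proof
    fix f assume "f \<in> low_invariants 9"
    then obtain d where d: "d \<le> 9" "f \<in> inv_part d" by (auto simp: low_invariants_def)
    then have f: "f \<in> hom_part n d" by (simp add: inv_part_def)
    have "f = orbit_mean (\<Sum>m\<in>mkeys f. mterm m (mcoeff f m))"
      by (simp only: sum_of_terms orbit_mean_of_invariant[OF d(2)])
    also have "\<dots> = (\<Sum>m\<in>mkeys f. mconst (mcoeff f m) * orbit_mean (mterm m 1))"
      unfolding orbit_mean_sum
    proof (rule sum.cong[OF HOL.refl])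
      fix m
      have "mterm m (mcoeff f m) = mconst (mcoeff f m) * mterm m 1"
        by (simp add: mconst_def mult_single)
      then show "orbit_mean (mterm m (mcoeff f m)) = mconst (mcoeff f m) * orbit_mean (mterm m 1)"
        by (simp only: orbit_mean_scale)
    qed
    also have "\<dots> \<in> generated_algebra B"
      using hom_partD[OF f] d(1)
      by (intro generated_algebra_sum generated_algebra.mult generated_algebra.const generated_algebra.base)
        (auto simp: B_def)
    finally show "f \<in> generated_algebra B" .
  qed
  then have "inv_ring \<subseteq> generated_algebra B"
    using inv_ring_generated generated_algebra_mono by blast
  then have B: "generated_algebra B = inv_ring"
    using generated_algebra_invariants[OF B_sub] by blast
  have "finite B" unfolding B_def by (intro finite_imageI finite_monomials)
  define S where "S = arg_min_on card {S. S \<subseteq> B \<and> generated_algebra S = inv_ring}"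
  have fin: "finite {S. S \<subseteq> B \<and> generated_algebra S = inv_ring}"
    using \<open>finite B\<close> by simp
  moreover have ne: "{S. S \<subseteq> B \<and> generated_algebra S = inv_ring} \<noteq> {}" using B by blast
  ultimately have "S \<in> {S. S \<subseteq> B \<and> generated_algebra S = inv_ring}"
    unfolding S_def by (rule arg_min_if_finite)
  then have S: "S \<subseteq> B" "generated_algebra S = inv_ring" by simp_all
  have "generated_algebra T \<noteq> inv_ring" if "T \<subset> S" for T
  proof
    assume "generated_algebra T = inv_ring"
    then have "card S \<le> card T"
      using that S(1) arg_min_least[OF fin ne, of T card] by (auto simp: S_def)
    moreover have "card T < card S"
      using that S(1) \<open>finite B\<close> by (intro psubset_card_mono) (auto intro: finite_subset)
    ultimately show False by simp
  qed
  moreover have "homogeneous f" if "f \<in> S" for f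
    using that S(1) B_part[of f] homogeneous_iff[of f n]
    by (auto simp: inv_part_def dest: hom_part_mpoly_ring)
  ultimately have "minimal_homogeneous_generators inv_ring S"
    using S B_sub by (auto simp: minimal_homogeneous_generators_def)
  then show ?thesis ..
qed

lemma noether_number_rep_le_9: "noether_number_rep heisenberg3 n \<rho> \<le> 9"
proof -
  obtain S where S: "minimal_homogeneous_generators inv_ring S" using minimal_generators_exist ..
  have "max_degree S \<le> enat 9"
    using minimal_generators_degree[OF S inv_ring_generated] by (intro SUP_least) simp
  then show ?thesis by (simp add: noether_number_rep_eq[OF S] numeral_eq_enat)
qed

lemma noether_number_rep_ge:
  assumes "\<not> inv_ring \<subseteq> generated_algebra (low_invariants D)"
  shows "enat (Suc D) \<le> noether_number_rep heisenberg3 n \<rho>"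
proof -
  obtain S where S: "minimal_homogeneous_generators inv_ring S" using minimal_generators_exist ..
  obtain s where s: "s \<in> S" "D < total_degree s"
    using generated_by_bounded_degree[OF S] assms not_le by blast
  then have "enat (Suc D) \<le> enat (total_degree s)" by simp
  also have "\<dots> \<le> max_degree S" using s(1) by (rule SUP_upper)
  finally show ?thesis by (simp add: noether_number_rep_eq[OF S])
qed

end

section \<open>A permutation representation with an indecomposable invariant of degree 9\<close>

text \<open>The point \<open>3 * j + k\<close> with \<open>j, k < 3\<close> is the pair \<open>(j, k)\<close>: \<open>b\<close> increases \<open>j\<close>, \<open>c\<close> decreases \<open>k\<close>, and \<open>a\<close> adds \<open>j\<close>
  to \<open>k\<close>. The words act from the right, that is with \<open>fold\<close>, so that their matrices multiply in the order of the words.\<close>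

fun point_perm :: "heis_gen \<Rightarrow> nat \<Rightarrow> nat" where
  "point_perm Gen_a r = 3 * (r div 3) + (r mod 3 + r div 3) mod 3"
| "point_perm Gen_b r = (r + 3) mod 9"
| "point_perm Gen_c r = 3 * (r div 3) + (r mod 3 + 2) mod 3"

fun letter_perm :: "heis_gen \<times> bool \<Rightarrow> nat \<Rightarrow> nat" where
  "letter_perm (x, True) r = point_perm x r"
| "letter_perm (x, False) r = point_perm x (point_perm x r)"

lemma less_9_cases: "r < 9 \<Longrightarrow> r \<in> {0, 1, 2, 3, 4, 5, 6, 7, 8 :: nat}"
  by auto

lemma point_perm_less: "r < 9 \<Longrightarrow> point_perm x r < 9"
  by (cases x) (auto dest!: less_9_cases)

lemma word_perm_less: "r < 9 \<Longrightarrow> fold letter_perm u r < 9"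
proof (induction u arbitrary: r)
  case (Cons l u)
  obtain x s where "l = (x, s)" by (cases l)
  then have "letter_perm l r < 9" using Cons.prems point_perm_less by (cases s) simp_all
  then show ?case using Cons.IH by simp
qed simp

lemma word_eq_perm:
  assumes "word_eq heis_relations u v" "r < 9"
  shows "fold letter_perm u r = fold letter_perm v r"
  using assms
proof (induction arbitrary: r)
  case (append u u' v v')
  then show ?case using word_perm_less by simp
next
  case (cancel x s)
  then show ?case
    by (cases x; cases s) (auto dest!: less_9_cases)
next
  case (relation u v)
  then show ?case
    by (auto simp: heis_relations_def Let_def dest!: less_9_cases)
qed auto

definition perm_mat :: "heis_gen word \<Rightarrow> 'a::field mat" where
  "perm_mat u = mat 9 9 (\<lambda>(r, s). if s = fold letter_perm u r then 1 else 0)"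

lemma perm_mat_carrier: "perm_mat u \<in> carrier_mat 9 9"
  by (simp add: perm_mat_def)

lemma perm_mat_append: "perm_mat (u @ v) = perm_mat u * (perm_mat v :: 'a::field mat)"
proof (rule eq_matI)
  fix r t assume "r < dim_row (perm_mat u * (perm_mat v :: 'a mat))" "t < dim_col (perm_mat u * (perm_mat v :: 'a mat))"
  then have rt: "r < 9" "t < 9" by (simp_all add: perm_mat_def)
  have "(perm_mat u * perm_mat v) $$ (r, t) =
      (\<Sum>s<9. (if s = fold letter_perm u r then 1 else 0) * (if t = fold letter_perm v s then 1 else (0 :: 'a)))"
    using rt by (auto simp: perm_mat_def scalar_prod_def atLeast0LessThan intro!: sum.cong)
  also have "\<dots> = (\<Sum>s<9. if s = fold letter_perm u r then (if t = fold letter_perm v s then 1 else 0) else (0 :: 'a))"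
    by (intro sum.cong) auto
  also have "\<dots> = perm_mat (u @ v) $$ (r, t)"
    using rt word_perm_less[of r u] by (simp add: perm_mat_def)
  finally show "perm_mat (u @ v) $$ (r, t) = (perm_mat u * perm_mat v :: 'a mat) $$ (r, t)" ..
qed (simp_all add: perm_mat_def)

lemma perm_mat_Nil: "perm_mat [] = 1\<^sub>m 9"
  by (rule eq_matI) (auto simp: perm_mat_def)

lemma perm_mat_cong: "word_eq heis_relations u v \<Longrightarrow> perm_mat u = perm_mat v"
  by (rule eq_matI) (simp_all add: perm_mat_def word_eq_perm)

definition perm_rep :: "heis_gen word set \<Rightarrow> 'a::field mat" where
  "perm_rep X = perm_mat (SOME u. X = word_class heis_relations u)"

lemma perm_rep_class: "perm_rep (word_class heis_relations u) = perm_mat u"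
proof -
  have "word_class heis_relations u = word_class heis_relations (SOME v. word_class heis_relations u = word_class heis_relations v)"
    by (rule someI[of _ u]) simp
  then have "word_eq heis_relations u (SOME v. word_class heis_relations u = word_class heis_relations v)"
    by (simp only: word_class_eq_iff)
  then show ?thesis unfolding perm_rep_def by (rule perm_mat_cong[symmetric])
qed

lemma perm_rep_representation: "(perm_rep :: heis_gen word set \<Rightarrow> 'a::field mat) \<in> representations heisenberg3 9"
proof -
  have "perm_mat u \<in> Units (ring_mat TYPE('a) 9 ())" for u
  proof -
    define v where "v = rev (map (\<lambda>(x, s). (x, \<not> s)) u)"
    have "perm_mat v * perm_mat u = (1\<^sub>m 9 :: 'a mat)"
      using perm_mat_cong[OF word_eq_left_inverse[of heis_relations u]]
      by (simp add: v_def perm_mat_append perm_mat_Nil)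
    moreover have "rev (map (\<lambda>(x, s). (x, \<not> s)) v) = u"
      by (simp add: v_def rev_map comp_def case_prod_unfold)
    then have "perm_mat u * perm_mat v = (1\<^sub>m 9 :: 'a mat)"
      using perm_mat_cong[OF word_eq_left_inverse[of heis_relations v]]
      by (simp add: perm_mat_append perm_mat_Nil)
    ultimately show ?thesis
      using perm_mat_carrier[of u] perm_mat_carrier[of v] by (auto simp: Units_def ring_mat_simps)
  qed
  then show ?thesis
    by (auto simp: representations_def hom_def units_of_def heisenberg3_def presented_group_carrier
        presented_group_mult perm_rep_class perm_mat_append ring_mat_simps)
qed

subsection \<open>Restriction to a three-dimensional subrepresentation\<close>

locale char_not_3 =
  fixes F :: "'a::field itself"
  assumes three_nonzero: "(3 :: 'a) \<noteq> 0"
begin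

sublocale nonmodular_heisenberg_rep 9 "perm_rep :: heis_gen word set \<Rightarrow> 'a mat"
  by unfold_locales (rule perm_rep_representation, rule three_nonzero)

lemma gen_mvar:
  assumes "r < 9"
  shows "gen x (mvar r) = mvar (point_perm x r)"
proof -
  have "gen x (mvar r) = (\<Sum>s<9. mconst (if s = point_perm x r then 1 else 0) * (mvar s :: 'a mpoly))"
    using assms by (auto simp: act_def perm_rep_class mpoly_act_mvar perm_mat_def intro!: sum.cong)
  also have "\<dots> = (\<Sum>s<9. if s = point_perm x r then mvar s else 0)"
    by (intro sum.cong) (auto simp: mconst_def)
  also have "\<dots> = mvar (point_perm x r)"
    using point_perm_less[OF assms] by simp
  finally show ?thesis .
qed

definition coeff_eis :: "'a \<Rightarrow> 'a poly eis" where "coeff_eis v = eis_of [:v:]"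

lemma comm_ring_hom_coeff_eis: "comm_ring_hom coeff_eis"
  by unfold_locales
    (simp_all add: coeff_eis_def eis_of_def zero_eis_def one_eis_def plus_eis_def times_eis_def one_pCons)

text \<open>Coordinates live in \<open>'a poly eis\<close>, which contains \<open>\<omega>\<close> and an element transcendental over the field. The
  vector with entries \<open>x \<omega>\<^sup>k\<close>, \<open>y \<omega>\<^sup>k\<close>, \<open>z \<omega>\<^sup>k\<close> at the points \<open>(0, k)\<close>, \<open>(1, k)\<close>, \<open>(2, k)\<close> is
  an eigenvector of \<open>c\<close>; these vectors form a three-dimensional subrepresentation.\<close>

definition point :: "'a poly eis \<Rightarrow> 'a poly eis \<Rightarrow> 'a poly eis \<Rightarrow> nat \<Rightarrow> 'a poly eis" where
  "point x y z r = (if r div 3 = 0 then x else if r div 3 = 1 then y else z) * omega ^ (r mod 3)"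

definition value_at :: "'a poly eis \<Rightarrow> 'a poly eis \<Rightarrow> 'a poly eis \<Rightarrow> 'a mpoly \<Rightarrow> 'a poly eis" where
  "value_at x y z = insertion coeff_eis (point x y z)"

lemma comm_ring_hom_value_at: "comm_ring_hom (value_at x y z)"
  unfolding value_at_def by (rule comm_ring_hom_insertion[OF comm_ring_hom_coeff_eis])

sublocale E: cubic_grading "\<lambda>_. UNIV" "omega :: 'a poly eis" "coeff_eis (1 / 3)"
proof unfold_locales
  interpret comm_ring_hom coeff_eis by (rule comm_ring_hom_coeff_eis)
  have "3 * coeff_eis (1 / 3) = coeff_eis (3 * (1 / 3))" by (simp only: hom_mult hom_numeral)
  then show "3 * coeff_eis (1 / 3) = 1" using three_nonzero by simp
  fix f :: "'a poly eis"
  have "f = 1 * f" by simp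
  then show "f \<in> addspan {l * g | l g. l \<in> UNIV \<and> g \<in> UNIV}" by (intro addspan_base) blast
qed (simp_all add: omega_relation)

lemma value_at_gen:
  assumes "f \<in> mpoly_ring 9"
  shows "value_at x y z (gen Gen_a f) = value_at x (omega * y) (omega ^ 2 * z) f"
    and "value_at x y z (gen Gen_b f) = value_at y z x f"
    and "value_at x y z (gen Gen_c f) = value_at (omega ^ 2 * x) (omega ^ 2 * y) (omega ^ 2 * z) f"
proof -
  have *: "value_at x y z (gen g f) = value_at x' y' z' f"
    if "\<And>r. r < 9 \<Longrightarrow> point x y z (point_perm g r) = point x' y' z' r" for g x' y' z'
  proof (rule hom_eq_on_mpoly_ring[OF _ comm_ring_hom_value_at _ _ assms])
    interpret V: comm_ring_hom "value_at x y z" by (rule comm_ring_hom_value_at)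
    interpret G: comm_ring_hom "gen g" by (rule comm_ring_hom_act_word)
    show "comm_ring_hom (\<lambda>f. value_at x y z (gen g f))"
      by unfold_locales (simp_all add: V.hom_add V.hom_mult G.hom_add G.hom_mult)
    show "value_at x y z (gen g (mconst v)) = value_at x' y' z' (mconst v)" for v
      by (simp add: act_def mpoly_act_mconst value_at_def insertion_mconst[OF comm_ring_hom_coeff_eis])
    show "value_at x y z (gen g (mvar r)) = value_at x' y' z' (mvar r)" if "r < 9" for r
      using that \<open>\<And>r. r < 9 \<Longrightarrow> point x y z (point_perm g r) = point x' y' z' r\<close>
      by (simp add: gen_mvar value_at_def insertion_mvar[OF comm_ring_hom_coeff_eis])
  qed
  have add: "omega ^ ((i + j) mod 3) = omega ^ j * (omega ^ i :: 'a poly eis)" for i j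
    by (simp only: E.w_pow_mod[symmetric] power_add mult.commute)
  show "value_at x y z (gen Gen_a f) = value_at x (omega * y) (omega ^ 2 * z) f"
  proof (rule *)
    fix r :: nat assume "r < 9"
    then have "r div 3 = 0 \<or> r div 3 = 1 \<or> r div 3 = 2" by auto
    moreover have "point_perm Gen_a r div 3 = r div 3" "point_perm Gen_a r mod 3 = (r mod 3 + r div 3) mod 3"
      by simp_all
    ultimately show "point x y z (point_perm Gen_a r) = point x (omega * y) (omega ^ 2 * z) r"
      by (elim disjE) (simp_all only: point_def add, simp_all add: mult_ac)
  qed
  show "value_at x y z (gen Gen_b f) = value_at y z x f"
    by (rule *) (auto dest!: less_9_cases simp: point_def)
  show "value_at x y z (gen Gen_c f) = value_at (omega ^ 2 * x) (omega ^ 2 * y) (omega ^ 2 * z) f"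
  proof (rule *)
    fix r :: nat
    have "point_perm Gen_c r div 3 = r div 3" "point_perm Gen_c r mod 3 = (r mod 3 + 2) mod 3"
      by simp_all
    then show "point x y z (point_perm Gen_c r) = point (omega ^ 2 * x) (omega ^ 2 * y) (omega ^ 2 * z) r"
      by (simp only: point_def add) (simp add: mult_ac)
  qed
qed

lemma value_at_mconst: "value_at x y z (mconst v) = coeff_eis v"
  unfolding value_at_def by (rule insertion_mconst[OF comm_ring_hom_coeff_eis])

lemma value_at_mvar: "value_at x y z (mvar r) = point x y z r"
  unfolding value_at_def by (rule insertion_mvar[OF comm_ring_hom_coeff_eis])

text \<open>The two divisibilities say that \<open>i\<close>, \<open>j\<close> and \<open>k\<close> are congruent modulo 3. If they were distinct, their sum
  would be at least \<open>0 + 3 + 6\<close>.\<close>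

lemma two_equal_exponents:
  fixes i j k :: nat
  assumes "3 dvd j + 2 * k" "3 dvd i + j + k" "i + j + k \<le> 8"
  shows "i = j \<or> j = k \<or> i = k"
proof -
  have less: "p + 3 \<le> q" if "p < q" "p mod 3 = q mod 3" for p q :: nat
  proof -
    have "3 dvd q - p" using mod_eq_dvd_iff_nat[of p q 3] that by simp
    then have "3 \<le> q - p" using that(1) by (intro dvd_imp_le) simp_all
    then show ?thesis by simp
  qed
  have gap: "p = q \<or> p + 3 \<le> q \<or> q + 3 \<le> p" if "p mod 3 = q mod 3" for p q :: nat
    using less[of p q] less[of q p] that by (cases p q rule: linorder_cases) simp_all
  have jk: "j mod 3 = k mod 3" using assms(1) other_character[of k 0 j] by (simp add: add.commute)
  have ik: "i mod 3 = k mod 3"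
  proof -
    have "(i + j + k) mod 3 = (i + k + k) mod 3" using jk by (intro mod_add_cong) simp_all
    then have "3 dvd i + k + k" using assms(2) by (simp only: dvd_eq_mod_eq_0)
    then have "3 dvd 2 * k + (0 + i)" by (simp only: mult_2 add_0 add_ac)
    then show ?thesis by (rule other_character) simp
  qed
  have "i mod 3 = j mod 3" using ik jk by simp
  from gap[OF this] gap[OF ik] gap[OF jk] show ?thesis using assms(3) by (elim disjE) simp_all
qed

lemma cyclic_sum_symmetric:
  fixes x y z :: "'b::comm_ring_1"
  assumes "i = j \<or> j = k \<or> i = k"
  shows "x ^ i * y ^ j * z ^ k + y ^ i * z ^ j * x ^ k + z ^ i * x ^ j * y ^ k =
    x ^ i * z ^ j * y ^ k + z ^ i * y ^ j * x ^ k + y ^ i * x ^ j * z ^ k"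
  using assms by (elim disjE) (simp_all add: ac_simps)

lemma value_at_term:
  assumes "mkeys m \<subseteq> {..<9}"
  obtains C i j k where "i + j + k = monom_degree m"
    and "\<And>x y z. value_at x y z (mterm m v) = C * (x ^ i * y ^ j * z ^ k)"
proof
  define e where "e = mcoeff m"
  have nine: "(\<Sum>r<9. g r) = g 0 + g 1 + g 2 + g 3 + g 4 + g 5 + g 6 + g 7 + g 8" for g :: "nat \<Rightarrow> nat"
    by (simp add: eval_nat_numeral)
  have nine': "(\<Prod>r<9. g r) = g 0 * g 1 * g 2 * g 3 * g 4 * g 5 * g 6 * g 7 * g 8" for g :: "nat \<Rightarrow> 'a poly eis"
    by (simp add: eval_nat_numeral)
  show "(e 0 + e 1 + e 2) + (e 3 + e 4 + e 5) + (e 6 + e 7 + e 8) = monom_degree m"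
    using monom_degree_superset[of "{..<9}" m] assms by (simp add: nine e_def)
  fix x y z
  have point_values: "point x y z 0 = x" "point x y z 1 = x * omega" "point x y z 2 = x * omega ^ 2"
    "point x y z 3 = y" "point x y z 4 = y * omega" "point x y z 5 = y * omega ^ 2"
    "point x y z 6 = z" "point x y z 7 = z * omega" "point x y z 8 = z * omega ^ 2"
    by (simp_all add: point_def)
  have "value_at x y z (mterm m v) = coeff_eis v * monomial_at (point x y z) m"
    unfolding value_at_def by (rule insertion_term[OF comm_ring_hom_coeff_eis])
  also have "monomial_at (point x y z) m = (\<Prod>r<9. point x y z r ^ e r)"
    unfolding e_def by (rule monomial_at_superset) (use assms in auto)
  also have "\<dots> = omega ^ (e 1 + e 4 + e 7 + 2 * (e 2 + e 5 + e 8)) *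
      (x ^ (e 0 + e 1 + e 2) * y ^ (e 3 + e 4 + e 5) * z ^ (e 6 + e 7 + e 8))"
    unfolding nine' point_values power_mult_distrib power_mult[symmetric] distrib_left power_add
    by (simp only: mult_ac)
  finally show "value_at x y z (mterm m v) = coeff_eis v * omega ^ (e 1 + e 4 + e 7 + 2 * (e 2 + e 5 + e 8)) *
      (x ^ (e 0 + e 1 + e 2) * y ^ (e 3 + e 4 + e 5) * z ^ (e 6 + e 7 + e 8))"
    by (simp only: mult.assoc)
qed

text \<open>Averaging over \<open>a\<close> and \<open>c\<close> removes all monomials except those covered by \<open>two_equal_exponents\<close>. Averaging
  over \<open>b\<close> replaces the others by their cyclic sums, which are symmetric by \<open>cyclic_sum_symmetric\<close>.\<close>

lemma value_at_symmetric:
  assumes f: "f \<in> inv_part d" and d: "d \<le> 8"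
  shows "value_at x y z f = value_at x z y f"
proof -
  let ?t = "coeff_eis (1 / 3)"
  have f': "f \<in> hom_part 9 d" "f \<in> mpoly_ring 9" "gen g f = f" for g
    using f by (auto simp: inv_part_def hom_part_def)
  define M :: "nat \<times> nat \<times> nat \<Rightarrow> 'a poly eis \<Rightarrow> 'a poly eis \<Rightarrow> 'a poly eis \<Rightarrow> 'a poly eis"
    where "M = (\<lambda>(i, j, k) x y z. x ^ i * y ^ j * z ^ k)"
  have "\<exists>p. fst (snd p) + fst (snd (snd p)) + snd (snd (snd p)) = d \<and>
      (\<forall>x y z. value_at x y z (mterm m (mcoeff f m)) = fst p * M (snd p) x y z)" if m: "m \<in> mkeys f" for m
  proof -
    obtain C i j k where "i + j + k = monom_degree m"
      "\<And>x y z. value_at x y z (mterm m (mcoeff f m)) = C * (x ^ i * y ^ j * z ^ k)"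
    proof (rule value_at_term[where v = "mcoeff f m"])
      show "mkeys m \<subseteq> {..<9}" using hom_partD[OF f'(1) m] by blast
    qed (rule that)
    then show ?thesis
      using hom_partD[OF f'(1) m] by (intro exI[of _ "(C, i, j, k)"]) (simp add: M_def)
  qed
  then have "\<forall>m\<in>mkeys f. \<exists>p. fst (snd p) + fst (snd (snd p)) + snd (snd (snd p)) = d \<and>
      (\<forall>x y z. value_at x y z (mterm m (mcoeff f m)) = fst p * M (snd p) x y z)"
    by blast
  from bchoice[OF this] obtain p where p: "\<forall>m\<in>mkeys f. fst (snd (p m)) + fst (snd (snd (p m))) + snd (snd (snd (p m))) = d \<and>
      (\<forall>x y z. value_at x y z (mterm m (mcoeff f m)) = fst (p m) * M (snd (p m)) x y z)"
    by blast
  define C where "C m = fst (p m)" for m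
  define q where "q m = snd (p m)" for m
  have q: "fst (q m) + fst (snd (q m)) + snd (snd (q m)) = d"
    and C: "value_at x y z (mterm m (mcoeff f m)) = C m * M (q m) x y z" if "m \<in> mkeys f" for m x y z
    using p that by (simp_all add: C_def q_def)
  have expand: "value_at x y z f = (\<Sum>m\<in>mkeys f. C m * M (q m) x y z)" for x y z
  proof -
    interpret comm_ring_hom "value_at x y z" by (rule comm_ring_hom_value_at)
    have "value_at x y z (\<Sum>m\<in>mkeys f. mterm m (mcoeff f m)) = (\<Sum>m\<in>mkeys f. C m * M (q m) x y z)"
      unfolding hom_sum by (rule sum.cong[OF HOL.refl C])
    then show ?thesis by (simp only: sum_of_terms)
  qed
  have mean: "u = ?t * (u + u + u)" for u
    using E.t_rel by (simp add: algebra_simps)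
  define good where "good m \<longleftrightarrow> 3 dvd fst (snd (q m)) + 2 * snd (snd (q m)) \<and> 3 dvd d" for m
  have filtered: "value_at x y z f = (\<Sum>m\<in>mkeys f. if good m then C m * M (q m) x y z else 0)" for x y z
  proof -
    define K where "K m = fst (snd (q m)) + 2 * snd (snd (q m))" for m
    have Ma: "M (q m) x (omega * y) (omega ^ 2 * z) = omega ^ K m * M (q m) x y z" for m x y z
    proof -
      obtain i j k where ijk: "q m = (i, j, k)" by (cases "q m")
      show ?thesis
        unfolding M_def K_def ijk prod.case fst_conv snd_conv power_mult_distrib power_mult[symmetric] power_add
        by (simp only: mult_ac)
    qed
    have inv: "value_at x (omega * y) (omega ^ 2 * z) f = value_at x y z f" for x y z
      using value_at_gen(1)[OF f'(2), of x y z] by (simp only: f'(3))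
    have a_filter: "value_at x y z f = (\<Sum>m\<in>mkeys f. if 3 dvd K m then C m * M (q m) x y z else 0)"
    proof -
      have "value_at x y z f = ?t * (value_at x y z f + value_at x (omega * y) (omega ^ 2 * z) f +
          value_at x (omega * (omega * y)) (omega ^ 2 * (omega ^ 2 * z)) f)"
        unfolding inv by (rule mean)
      also have "\<dots> = ?t * (\<Sum>m\<in>mkeys f. C m * M (q m) x y z + C m * (omega ^ K m * M (q m) x y z) +
          C m * (omega ^ K m * (omega ^ K m * M (q m) x y z)))"
        by (simp only: expand Ma sum.distrib)
      also have "\<dots> = (\<Sum>m\<in>mkeys f. ?t * (1 + omega ^ K m + omega ^ (2 * K m)) * (C m * M (q m) x y z))"
        unfolding sum_distrib_left
      proof (rule sum.cong[OF HOL.refl])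
        fix m
        have "omega ^ (2 * K m) = omega ^ K m * (omega ^ K m :: 'a poly eis)"
          by (simp only: mult_2 power_add)
        then show "?t * (C m * M (q m) x y z + C m * (omega ^ K m * M (q m) x y z) +
            C m * (omega ^ K m * (omega ^ K m * M (q m) x y z))) =
            ?t * (1 + omega ^ K m + omega ^ (2 * K m)) * (C m * M (q m) x y z)"
          by (simp add: algebra_simps)
      qed
      also have "\<dots> = (\<Sum>m\<in>mkeys f. if 3 dvd K m then C m * M (q m) x y z else 0)"
        unfolding E.character_sum by (intro sum.cong HOL.refl) simp
      finally show ?thesis .
    qed
    have "3 dvd d \<or> value_at x y z f = 0"
    proof (rule disjCI)
      assume nz: "value_at x y z f \<noteq> 0"
      have "M (q m) (omega ^ 2 * x) (omega ^ 2 * y) (omega ^ 2 * z) = omega ^ (2 * d) * M (q m) x y z" if "m \<in> mkeys f" for m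
      proof -
        obtain i j k where ijk: "q m = (i, j, k)" by (cases "q m")
        have d: "2 * d = 2 * i + (2 * j + 2 * k)" using q[OF that] by (simp add: ijk)
        show ?thesis
          unfolding M_def ijk prod.case d power_mult_distrib power_mult[symmetric] power_add
          by (simp only: mult_ac)
      qed
      then have "value_at (omega ^ 2 * x) (omega ^ 2 * y) (omega ^ 2 * z) f = omega ^ (2 * d) * value_at x y z f"
        unfolding expand sum_distrib_left by (intro sum.cong) (simp_all add: mult_ac)
      then have fix1: "omega ^ (2 * d) * value_at x y z f = value_at x y z f"
        using value_at_gen(3)[OF f'(2), of x y z] by (simp only: f'(3))
      have "omega ^ (2 * (2 * d)) = omega ^ (2 * d) * (omega ^ (2 * d) :: 'a poly eis)"
        by (simp only: mult_2[of "2 * d"] power_add)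
      then have fix2: "omega ^ (2 * (2 * d)) * value_at x y z f = value_at x y z f"
        by (simp only: mult.assoc fix1)
      have "?t * (1 + omega ^ (2 * d) + omega ^ (2 * (2 * d))) * value_at x y z f =
          ?t * (value_at x y z f + omega ^ (2 * d) * value_at x y z f + omega ^ (2 * (2 * d)) * value_at x y z f)"
        by (simp only: distrib_left distrib_right mult.assoc mult_1_left mult_1_right)
      also have "\<dots> = value_at x y z f"
        unfolding fix1 fix2 by (rule mean[symmetric])
      finally have "?t * (1 + omega ^ (2 * d) + omega ^ (2 * (2 * d))) * value_at x y z f = value_at x y z f" .
      then have "3 dvd 2 * d" using nz unfolding E.character_sum by (auto split: if_splits)
      then show "3 dvd d" by presburger
    qed
    then show ?thesis
    proof
      assume "3 dvd d"
      then show ?thesis using a_filter by (simp add: good_def K_def)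
    next
      assume "value_at x y z f = 0"
      then show ?thesis using a_filter by (cases "3 dvd d") (simp_all add: good_def K_def)
    qed
  qed
  have turn: "value_at y z x f = value_at x y z f" for x y z
    using value_at_gen(2)[OF f'(2), of x y z] by (simp only: f'(3))
  have cyc: "value_at x y z f = ?t * (value_at x y z f + value_at y z x f + value_at z x y f)" for x y z
    unfolding turn[of x y z] turn[of z x y, symmetric] by (rule mean)
  have sum_eq: "value_at x y z f + value_at y z x f + value_at z x y f =
      (\<Sum>m\<in>mkeys f. if good m then C m * (M (q m) x y z + M (q m) y z x + M (q m) z x y) else 0)" for x y z
    unfolding filtered sum.distrib[symmetric] by (intro sum.cong HOL.refl) (simp add: distrib_left)
  have sym: "M (q m) x y z + M (q m) y z x + M (q m) z x y = M (q m) x z y + M (q m) z y x + M (q m) y x z"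
    if "m \<in> mkeys f" "good m" for m
  proof -
    obtain i j k where ijk: "q m = (i, j, k)" by (cases "q m")
    have "i = j \<or> j = k \<or> i = k"
      by (rule two_equal_exponents) (use that q[OF that(1)] d in \<open>simp_all add: ijk good_def\<close>)
    then show ?thesis unfolding ijk M_def prod.case by (rule cyclic_sum_symmetric)
  qed
  have "value_at x y z f = ?t * (value_at x y z f + value_at y z x f + value_at z x y f)" by (rule cyc)
  also have "value_at x y z f + value_at y z x f + value_at z x y f =
      value_at x z y f + value_at z y x f + value_at y x z f"
    unfolding sum_eq by (intro sum.cong HOL.refl) (simp add: sym)
  also have "?t * (value_at x z y f + value_at z y x f + value_at y x z f) = value_at x z y f"
    by (rule cyc[symmetric])
  finally show ?thesis .
qed

text \<open>The product of the variables of one fibre \<open>{(j, k) | k < 3}\<close> is fixed by \<open>a\<close> and \<open>c\<close>, while \<open>b\<close> permutes the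
  three products cyclically. So the polynomials \<open>fibre j\<close> take the place of the cubes of the coordinates.\<close>

definition fibre :: "nat \<Rightarrow> 'a mpoly" where
  "fibre j = mvar (3 * j) * mvar (3 * j + 1) * mvar (3 * j + 2)"

definition cyclic_invariant :: "'a mpoly" where
  "cyclic_invariant = fibre 0 ^ 2 * fibre 1 + fibre 1 ^ 2 * fibre 2 + fibre 2 ^ 2 * fibre 0"

lemma cyclic_invariant_in: "cyclic_invariant \<in> inv_ring"
proof -
  have ring: "fibre j \<in> mpoly_ring 9" if "j < 3" for j
    unfolding fibre_def using that
    by (intro mpoly_ring_mult hom_part_mpoly_ring[OF hom_part_mvar]) auto
  have "gen x (fibre j) = fibre (if x = Gen_b then (j + 1) mod 3 else j)" if "j < 3" for x j
  proof -
    interpret comm_ring_hom "gen x" by (rule comm_ring_hom_act_word)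
    have "gen x (fibre j) = mvar (point_perm x (3 * j)) * mvar (point_perm x (3 * j + 1)) * mvar (point_perm x (3 * j + 2))"
      using that by (simp add: fibre_def hom_mult gen_mvar)
    moreover have "j = 0 \<or> j = 1 \<or> j = 2" using that by auto
    ultimately show ?thesis
      by (cases x) (auto simp: fibre_def mult_ac numeral_2_eq_2)
  qed
  note gen_fibre = this
  have "gen x cyclic_invariant = cyclic_invariant" for x
  proof -
    interpret comm_ring_hom "gen x" by (rule comm_ring_hom_act_word)
    have "(0 + 1) mod 3 = (1 :: nat)" "(1 + 1) mod 3 = (2 :: nat)" "(2 + 1) mod 3 = (0 :: nat)"
      by simp_all
    then have "gen x (fibre 0) = fibre (if x = Gen_b then 1 else 0)"
      "gen x (fibre 1) = fibre (if x = Gen_b then 2 else 1)" "gen x (fibre 2) = fibre (if x = Gen_b then 0 else 2)"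
      using gen_fibre[of 0 x] gen_fibre[of 1 x] gen_fibre[of 2 x] by (simp_all only: simp_thms)
    then show ?thesis
      unfolding cyclic_invariant_def hom_add hom_mult power2_eq_square by (simp add: add_ac)
  qed
  moreover have "cyclic_invariant \<in> mpoly_ring 9"
    unfolding cyclic_invariant_def power2_eq_square
    by (intro mpoly_ring_add mpoly_ring_mult ring) simp_all
  ultimately show ?thesis by (simp add: invariants_eq)
qed

lemma value_at_cyclic_invariant:
  "value_at x y z cyclic_invariant = x ^ 6 * y ^ 3 + y ^ 6 * z ^ 3 + z ^ 6 * x ^ 3"
proof -
  interpret comm_ring_hom "value_at x y z" by (rule comm_ring_hom_value_at)
  have w: "u * omega * (u * omega ^ 2) = u ^ 2" for u :: "'a poly eis"
  proof -
    have "u * omega * (u * omega ^ 2) = u ^ 2 * omega ^ 3"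
      by (simp add: power2_eq_square power3_eq_cube mult_ac)
    then show ?thesis by (simp add: E.w_cubed)
  qed
  have "value_at x y z (fibre 0) = x ^ 3" "value_at x y z (fibre 1) = y ^ 3" "value_at x y z (fibre 2) = z ^ 3"
    using w[of x] w[of y] w[of z]
    by (simp_all add: fibre_def hom_mult value_at_mvar point_def power2_eq_square power3_eq_cube mult.assoc)
  then show ?thesis
    by (simp add: cyclic_invariant_def hom_add hom_mult hom_power flip: power_mult)
qed

text \<open>The symmetric functions in \<open>y\<close> and \<open>z\<close> form an algebra. At \<open>(1, X, 0)\<close> and \<open>(1, 0, X)\<close> the invariant of degree 9
  takes the values \<open>X ^ 3\<close> and \<open>X ^ 6\<close>.\<close>

lemma cyclic_invariant_indecomposable: "\<not> inv_ring \<subseteq> generated_algebra (low_invariants 8)"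
proof
  assume "inv_ring \<subseteq> generated_algebra (low_invariants 8)"
  then have "cyclic_invariant \<in> generated_algebra (low_invariants 8)" using cyclic_invariant_in by blast
  then have sym: "value_at x y z cyclic_invariant = value_at x z y cyclic_invariant" for x y z
  proof induction
    case (const v)
    show ?case by (simp add: value_at_mconst)
  next
    case (base f)
    then show ?case by (auto simp: low_invariants_def intro: value_at_symmetric)
  next
    case (add f g)
    interpret V: comm_ring_hom "value_at x y z" by (rule comm_ring_hom_value_at)
    interpret W: comm_ring_hom "value_at x z y" by (rule comm_ring_hom_value_at)
    show ?case using add.IH by (simp add: V.hom_add W.hom_add)
  next
    case (mult f g)
    interpret V: comm_ring_hom "value_at x y z" by (rule comm_ring_hom_value_at)
    interpret W: comm_ring_hom "value_at x z y" by (rule comm_ring_hom_value_at)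
    show ?case using mult.IH by (simp add: V.hom_mult W.hom_mult)
  qed
  define X :: "'a poly eis" where "X = eis_of (monom 1 1)"
  have "X ^ k = eis_of (monom 1 k)" for k
    by (induction k) (simp_all add: X_def eis_of_mult[symmetric] mult_monom eis_of_1)
  then have "eis_of (monom (1 :: 'a) 3) = eis_of (monom 1 6)"
    using sym[of 1 X 0] by (simp add: value_at_cyclic_invariant)
  then show False by (simp add: eis_of_def monom_eq_iff')
qed

lemma noether_number_perm_rep: "9 \<le> noether_number_rep heisenberg3 9 (perm_rep :: heis_gen word set \<Rightarrow> 'a mat)"
  using noether_number_rep_ge[OF cyclic_invariant_indecomposable] by (simp add: numeral_eq_enat)

end

section \<open>The Noether number\<close>

theorem corollary18:
  assumes "CHAR('a::field) \<noteq> 3"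
  shows "noether_number TYPE('a) heisenberg3 = 9"
proof -
  have three: "(3 :: 'a) \<noteq> 0"
  proof
    assume "(3 :: 'a) = 0"
    then have "of_nat 3 = (0 :: 'a)" by simp
    then have "CHAR('a) dvd 3" by (simp only: of_nat_eq_0_iff_char_dvd)
    moreover have "prime (3 :: nat)" by simp
    ultimately have "CHAR('a) = 1 \<or> CHAR('a) = 3" by (auto simp: prime_nat_iff)
    then show False using assms CHAR_not_1' by auto
  qed
  show ?thesis
    unfolding noether_number_def
  proof (rule antisym)
    show "(SUP (n, \<rho> :: heis_gen word set \<Rightarrow> 'a mat)\<in>{(n, \<rho>). \<rho> \<in> representations heisenberg3 n}.
        noether_number_rep heisenberg3 n \<rho>) \<le> 9"
    proof (rule SUP_least, clarify)
      fix n and \<rho> :: "heis_gen word set \<Rightarrow> 'a mat"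
      assume "\<rho> \<in> representations heisenberg3 n"
      then interpret nonmodular_heisenberg_rep n \<rho> using three by unfold_locales
      show "noether_number_rep heisenberg3 n \<rho> \<le> 9" by (rule noether_number_rep_le_9)
    qed
    interpret char_not_3 "TYPE('a)" using three by unfold_locales
    have "9 \<le> noether_number_rep heisenberg3 9 (perm_rep :: heis_gen word set \<Rightarrow> 'a mat)"
      by (rule noether_number_perm_rep)
    also have "\<dots> \<le> (SUP (n, \<rho> :: heis_gen word set \<Rightarrow> 'a mat)\<in>{(n, \<rho>). \<rho> \<in> representations heisenberg3 n}.
        noether_number_rep heisenberg3 n \<rho>)"
      by (rule SUP_upper2[of "(9, perm_rep)"]) (simp_all add: perm_rep_representation)
    finally show "9 \<le> (SUP (n, \<rho> :: heis_gen word set \<Rightarrow> 'a mat)\<in>{(n, \<rho>). \<rho> \<in> representations heisenberg3 n}.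
        noether_number_rep heisenberg3 n \<rho>)" .
  qed
qed

end
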